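(* Let $m\ge1$ and let $\omega$ be a continuous nondecreasing function on $[0,+\infty)$ with $\omega(0)=0$, such that $\omega(2\delta)<2\omega(\delta)$ for all sufficiently small $\delta>0$. Let $\chi(\delta)=\delta\omega(\delta)$, $\chi^{-1}$ its inverse function, and define $$\Theta_1(y)=\frac{y}{\log y}\chi^{-1}\Big(\frac{(\log y)^2}{y}\Big),\qquad \Theta_p(y)=\Big(\int_1^y\Big(\chi^{-1}\Big(\frac1\tau\Big)\Big)^pd\tau\Big)^{1/p}\ (1<p<2).$$ Then there exists a real function $\varphi\in C^{1,\omega}(\mathbb T^m)$ with nowhere degenerate gradient such that for all $p$, $1\leq p<2$, $$\|e^{i\lambda\varphi}\|_{A_p(\mathbb T^m)}=O\big((\Theta_p(|\lambda|))^m\big),\qquad |\lambda|\to\infty,\ \lambda\in\mathbb R.$$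
   Context: $\mathbb T^m=\mathbb R^m/2\pi\mathbb Z^m$; functions on $\mathbb T^m$ are identified with $2\pi$-periodic (in each variable) functions on $\mathbb R^m$. $\widehat f(k)=(2\pi)^{-m}\int_{\mathbb T^m}f(t)e^{-i(k,t)}dt$; $A_1(\mathbb T^m)$ is the space of continuous $f$ with $\widehat f\in l^1(\mathbb Z^m)$, for $1<p\le2$ $A_p(\mathbb T^m)$ is the space of integrable $f$ with $\widehat f\in l^p$; $\|f\|_{A_p(\mathbb T^m)}=\|\widehat f\|_{l^p(\mathbb Z^m)}$. $C^{1,\omega}(\mathbb T^m)$ is the class of $2\pi$-periodic functions on $\mathbb R^m$ whose first-order partial derivatives $g$ satisfy $\sup_{|t_1-t_2|\le\delta}|g(t_1)-g(t_2)|=O(\omega(\delta))$ as $\delta\to+0$. The gradient of $\varphi$ is nowhere degenerate if $|\nabla\varphi(V)|>0$ (Lebesgue measure) for every nonempty open set $V\subseteq\mathbb R^m$. *)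

theory Defs
  imports "HOL-Analysis.Analysis"
begin

text \<open>Functions on the torus T^m are 2pi-periodic functions on real^'m (m = CARD('m) \<ge> 1).\<close>

definition torus_periodic :: "(real^'m \<Rightarrow> 'b) \<Rightarrow> bool" where
  "torus_periodic f \<longleftrightarrow> (\<forall>x i. f (x + (2*pi) *\<^sub>R axis i 1) = f x)"

definition fourier_coeff :: "(real^'m \<Rightarrow> complex) \<Rightarrow> int^'m \<Rightarrow> complex" where
  "fourier_coeff f k = complex_of_real ((2*pi) powr (- real CARD('m))) *
     integral (cbox 0 (\<chi> i. 2*pi))
       (\<lambda>t. f t * exp (- \<i> * complex_of_real (\<Sum>i\<in>UNIV. of_int (k$i) * t$i)))"

definition in_Ap :: "real \<Rightarrow> (real^'m \<Rightarrow> complex) \<Rightarrow> bool" where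
  "in_Ap p f \<longleftrightarrow> (\<lambda>k. norm (fourier_coeff f k) powr p) summable_on UNIV"

definition Ap_norm :: "real \<Rightarrow> (real^'m \<Rightarrow> complex) \<Rightarrow> real" where
  "Ap_norm p f = (\<Sum>\<^sub>\<infinity>k\<in>UNIV. norm (fourier_coeff f k) powr p) powr (1/p)"

definition partials :: "(real^'m \<Rightarrow> real) \<Rightarrow> ('m \<Rightarrow> real^'m \<Rightarrow> real) \<Rightarrow> bool" where
  "partials \<phi> g \<longleftrightarrow>
     (\<forall>i x. ((\<lambda>s. \<phi> (x + s *\<^sub>R axis i 1)) has_real_derivative g i x) (at 0))"

definition C1_omega :: "(real \<Rightarrow> real) \<Rightarrow> (real^'m \<Rightarrow> real) \<Rightarrow> bool" where
  "C1_omega \<omega> \<phi> \<longleftrightarrow> torus_periodic \<phi> \<and>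
     (\<exists>g. partials \<phi> g \<and>
        (\<forall>i. \<exists>C \<delta>0. \<delta>0 > 0 \<and> (\<forall>\<delta> t1 t2. 0 < \<delta> \<and> \<delta> \<le> \<delta>0 \<and> dist t1 t2 \<le> \<delta> \<longrightarrow>
              \<bar>g i t1 - g i t2\<bar> \<le> C * \<omega> \<delta>)))"

definition grad_nowhere_degenerate :: "(real^'m \<Rightarrow> real) \<Rightarrow> bool" where
  "grad_nowhere_degenerate \<phi> \<longleftrightarrow>
     (\<exists>g. partials \<phi> g \<and>
        (\<forall>V. open V \<and> V \<noteq> {} \<longrightarrow>
           (\<lambda>x. \<chi> i. g i x) ` V \<in> sets lebesgue \<and>
           emeasure lebesgue ((\<lambda>x. \<chi> i. g i x) ` V) > 0))"

definition chi_inv :: "(real \<Rightarrow> real) \<Rightarrow> real \<Rightarrow> real" where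
  "chi_inv \<omega> = inv_into {0..} (\<lambda>d. d * \<omega> d)"

definition Theta :: "(real \<Rightarrow> real) \<Rightarrow> real \<Rightarrow> real \<Rightarrow> real" where
  "Theta \<omega> p y = (if p = 1 then y / ln y * chi_inv \<omega> ((ln y)^2 / y)
     else (integral {1..y} (\<lambda>\<tau>. chi_inv \<omega> (1/\<tau>) powr p)) powr (1/p))"

end

theory Submission
  imports Defs
begin

text \<open>
  The phase is a sum of one function of one variable over the coordinates, so that the Fourier
  coefficients factor and the image of a box under the gradient contains a box; only the circle matters.

  The derivative of the one-dimensional phase cannot be strictly monotone on an interval: when
  \<open>\<Theta>\<^sub>p\<close> is bounded, some level set of the derivative must have positive measure. It is
  therefore a superposition of bumps of zero mean, each placed on a plateau of the sum of the previous ones.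
  The flanks of a bump of length \<open>L\<close> are Cantor staircases of height \<open>\<omega> L\<close> whose level \<open>n\<close> consists of
  \<open>2^n\<close> intervals of length \<open>l n\<close> with \<open>\<omega> (l n) = \<omega> L / 2^n\<close>; the strict doubling condition is exactly
  what leaves gaps between them.

  If \<open>\<xi>\<close> stays farther than \<open>1/r\<close> from the \<open>O(2^n)\<close> frequencies \<open>\<mu> \<cdot> \<omega> L \<cdot> i / 2^n\<close>, where \<open>l n \<le> r\<close>,
  the van der Corput lemma bounds the coefficient of the bump at \<open>\<xi>\<close> by \<open>O(r)\<close>. Hence at most
  \<open>O(\<omega> L / (r \<omega> r))\<close> coefficients exceed \<open>r\<close>, uniformly in \<open>\<mu>\<close>. Summing over dyadic levels bounds the
  \<open>p\<close>-th power sum by \<open>\<omega> L\<close> times the sum of \<open>2^i \<chi>^(-1)(1/2^i)^p\<close>, which is \<open>O(\<Theta>\<^sub>p^p)\<close> also for \<open>p = 1\<close>;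
  the factors \<open>\<omega> L\<close> are summable over the bumps.
\<close>

subsection \<open>Moduli of continuity\<close>

text \<open>The step that decouples the bumps is hidden in the plateaus. Where an earlier derivative
  sum is constant, the earlier phase is affine, so adding a bump changes each coefficient by a
  coefficient of that bump alone, taken at an integer shifted by a real \<open>\<theta>\<close>.
  Zero mean keeps the primitive of a bump inside the same interval. Hence every one-bump estimate
  has to be uniform in the shift \<open>\<theta>\<close> as well as in the amplitude
  \<open>\<mu>\<close>; this works because both only move the exceptional frequencies without
  changing their number.

  Counting does not settle everything. Frequencies beyond the range of the phase derivative are
  infinitely many and need square decay; bumps with \<open>\<mu> * L * \<omega> L\<close> below 1
  must gain from the smallness of \<open>cis (\<mu> * W t) - 1\<close>. For \<open>p = 1\<close>
  what remains is a contribution of order 1 from each of about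
  \<open>log \<bar>\<lambda>\<bar>\<close> bumps; it is absorbed because the dyadic sum
  \<open>S 1 m\<close> grows at least linearly in \<open>m\<close>. For \<open>p > 1\<close> the
  superposition of \<open>p\<close>-th powers loses a factor \<open>2 powr (p - 1)\<close> per bump,
  which the decay \<open>(1/8)^n\<close> of the lengths and heights pays for.\<close>

locale modulus =
  fixes \<omega> :: "real \<Rightarrow> real" and \<delta>0 :: real
  assumes cont: "continuous_on {0..} \<omega>"
    and mono: "mono_on {0..} \<omega>"
    and zero: "\<omega> 0 = 0"
    and \<delta>0: "\<delta>0 > 0"
    and double: "\<And>\<delta>. 0 < \<delta> \<Longrightarrow> \<delta> < \<delta>0 \<Longrightarrow> \<omega> (2*\<delta>) < 2 * \<omega> \<delta>"
begin

lemma le: "0 \<le> x \<Longrightarrow> x \<le> y \<Longrightarrow> \<omega> x \<le> \<omega> y"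
  using mono by (auto simp: mono_on_def)

lemma nonneg: "0 \<le> x \<Longrightarrow> 0 \<le> \<omega> x"
  using le[of 0 x] zero by simp

text \<open>Monotonicity and strict doubling give
  \<open>\<omega> y \<le> \<omega> (2*y) < 2 * \<omega> y\<close> for small \<open>y\<close>, which
  excludes the value 0; \<open>y\<close> is chosen below both \<open>x\<close> and
  \<open>\<delta>0\<close>.\<close>

lemma pos: assumes "0 < x" shows "0 < \<omega> x"
proof -
  define y where "y = min x (\<delta>0/2)"
  have y: "0 < y" "y < \<delta>0" "y \<le> x" using assms \<delta>0 by (auto simp: y_def)
  have "\<omega> y \<le> \<omega> (2*y)" using y by (intro le) auto
  with double[OF y(1,2)] have "0 < \<omega> y" by linarith
  with le[of y x] y show ?thesis by simp
qed

definition chi :: "real \<Rightarrow> real" where "chi d = d * \<omega> d"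

lemma chi_less: assumes "0 \<le> x" "x < y" shows "chi x < chi y"
proof -
  have "x * \<omega> x \<le> x * \<omega> y" using assms by (intro mult_left_mono le) auto
  also have "\<dots> < y * \<omega> y" using assms pos[of y] by (intro mult_strict_right_mono) auto
  finally show ?thesis by (simp add: chi_def)
qed

lemma chi_le: "0 \<le> x \<Longrightarrow> x \<le> y \<Longrightarrow> chi x \<le> chi y"
  using chi_less[of x y] by (cases "x = y") auto

lemma chi_pos: "0 < x \<Longrightarrow> 0 < chi x"
  by (simp add: chi_def pos)

lemma chi_zero [simp]: "chi 0 = 0"
  by (simp add: chi_def)

lemma chi_cont: "continuous_on {0..} chi"
  unfolding chi_def by (intro continuous_intros cont)

lemma chi_surj: assumes "0 \<le> s" shows "\<exists>x\<ge>0. chi x = s"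
proof -
  \<comment> \<open>\<open>b \<ge> 1\<close> gives \<open>\<omega> b \<ge> \<omega> 1\<close>, and
    the other entry gives \<open>b * \<omega> 1 \<ge> s\<close>; so \<open>chi\<close> is onto even
    if \<open>\<omega>\<close> is bounded.\<close>
  define b where "b = max 1 (s / \<omega> 1)"
  have b: "b \<ge> 1" "s / \<omega> 1 \<le> b" by (auto simp: b_def)
  have w: "\<omega> 1 > 0" by (intro pos) auto
  have "s \<le> b * \<omega> 1" using b w by (simp add: field_simps)
  also have "\<dots> \<le> b * \<omega> b" using b by (intro mult_left_mono le) auto
  finally have "s \<le> chi b" by (simp add: chi_def)
  moreover have "chi 0 \<le> s" using assms by simp
  moreover have "continuous_on {0..b} chi" using chi_cont continuous_on_subset by fastforce
  ultimately obtain x where "0 \<le> x" "chi x = s"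
    using IVT'[of chi 0 s b] b by auto
  then show ?thesis by blast
qed

abbreviation \<eta> :: "real \<Rightarrow> real" where "\<eta> \<equiv> chi_inv \<omega>"

lemma chi_inv_eq: "\<eta> = inv_into {0..} chi"
  by (simp add: chi_inv_def chi_def[abs_def])

lemma chi_image: "0 \<le> s \<Longrightarrow> s \<in> chi ` {0..}"
  using chi_surj[of s] by force

lemma chi_\<eta> [simp]: "0 \<le> s \<Longrightarrow> chi (\<eta> s) = s"
  unfolding chi_inv_eq by (rule f_inv_into_f[OF chi_image])

lemma \<eta>_nonneg [simp]: "0 \<le> s \<Longrightarrow> 0 \<le> \<eta> s"
  using inv_into_into[OF chi_image] unfolding chi_inv_eq by fastforce

lemma \<eta>_le_iff: assumes "0 \<le> s" "0 \<le> x" shows "\<eta> s \<le> x \<longleftrightarrow> s \<le> chi x"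
  using assms chi_le[of "\<eta> s" x] chi_less[of x "\<eta> s"] chi_\<eta>[of s] \<eta>_nonneg[of s]
  by (metis linorder_not_le)

lemma \<eta>_mono: "0 \<le> s \<Longrightarrow> s \<le> t \<Longrightarrow> \<eta> s \<le> \<eta> t"
  by (subst \<eta>_le_iff) auto

lemma \<eta>_pos: assumes "0 < s" shows "0 < \<eta> s"
proof -
  have "\<eta> s \<noteq> 0" using chi_\<eta>[of s] assms by (metis chi_zero less_irrefl less_imp_le)
  then show ?thesis using \<eta>_nonneg[of s] assms by linarith
qed

lemma \<omega>_\<eta>: assumes "0 < s" shows "\<omega> (\<eta> s) = s / \<eta> s"
  using chi_\<eta>[of s] \<eta>_pos[OF assms] assms by (simp add: chi_def field_simps)

text \<open>The hypothesis concerns the last argument that gets doubled; the endpoint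
  \<open>2^Suc i * \<delta>\<close> itself may exceed \<open>\<delta>0\<close>.\<close>

lemma double_iter: assumes "0 < \<delta>" "2^i * \<delta> < \<delta>0" shows "\<omega> (2^Suc i * \<delta>) \<le> 2^Suc i * \<omega> \<delta>"
  using assms(2)
proof (induction i)
  case 0 then show ?case using double[of \<delta>] assms by simp
next
  case (Suc i)
  have lt: "2^i*\<delta> < \<delta>0" 
    by (rule le_less_trans[OF _ Suc.prems]) (use assms in simp)
  have "\<omega> (2 * (2^Suc i * \<delta>)) < 2 * \<omega> (2^Suc i * \<delta>)"
    using Suc.prems assms(1) by (intro double) auto
  also have "\<dots> \<le> 2 * (2^Suc i * \<omega> \<delta>)" by (intro mult_left_mono Suc.IH[OF lt]) auto
  finally show ?case by (simp add: mult_ac)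
qed

text \<open>Up to the factor 2, \<open>\<omega> t / t\<close> is nonincreasing: iterated doubling
  handles powers of two, and rounding \<open>e / \<delta>\<close> up to one costs the
  factor.\<close>

lemma quasi_concave: assumes "0 < \<delta>" "\<delta> \<le> e" "e < \<delta>0" shows "\<omega> e * \<delta> \<le> 2 * e * \<omega> \<delta>"
proof -
  define i where "i = nat \<lfloor>log 2 (e/\<delta>)\<rfloor>"
  have r: "1 \<le> e / \<delta>" using assms by simp
  then have l0: "0 \<le> log 2 (e/\<delta>)" by simp
  have "real i \<le> log 2 (e/\<delta>)" "log 2 (e/\<delta>) < real i + 1"
    using l0 by (auto simp: i_def) 
  then have "2 powr real i \<le> e/\<delta>" "e/\<delta> < 2 powr (real i + 1)"
    using r by (auto simp: le_log_iff log_less_iff)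
  then have i: "2^i * \<delta> \<le> e" "e < 2^Suc i * \<delta>"
    using assms by (auto simp: powr_realpow powr_add field_simps)
  have "\<omega> e \<le> \<omega> (2^Suc i * \<delta>)" using i assms by (intro le) auto
  also have "\<dots> \<le> 2^Suc i * \<omega> \<delta>" using i assms by (intro double_iter) auto
  finally have "\<omega> e * \<delta> \<le> 2^Suc i * \<omega> \<delta> * \<delta>" using assms by simp
  also have "\<dots> = 2 * (2^i * \<delta>) * \<omega> \<delta>" by simp
  also have "\<dots> \<le> 2 * e * \<omega> \<delta>" using i assms pos[of \<delta>] by (intro mult_right_mono mult_left_mono) auto
  finally show ?thesis .
qed

section \<open>Dyadic sums and their comparison with \<Theta>_p\<close>

definition \<rho> :: "nat \<Rightarrow> real" where "\<rho> i = \<eta> (1 / 2^i)"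

text \<open>About \<open>2^i\<close> coefficients will exceed a multiple of \<open>\<rho> i\<close>,
  so this is what a layer-by-layer count of \<open>p\<close>-th powers produces. It is also the
  dyadic condensation of the integral in \<open>Theta\<close>.\<close>

definition S :: "real \<Rightarrow> nat \<Rightarrow> real" where "S p n = (\<Sum>i\<le>n. 2^i * \<rho> i powr p)"

lemma \<rho>_pos: "0 < \<rho> i" by (simp add: \<rho>_def \<eta>_pos)

lemma \<rho>_Suc: "\<rho> (Suc i) \<le> \<rho> i"
  unfolding \<rho>_def by (intro \<eta>_mono) (auto simp: field_simps)

lemma \<omega>_\<rho>: "2^i * \<rho> i = 1 / \<omega> (\<rho> i)"
  using \<rho>_pos[of i] unfolding \<rho>_def by (subst \<omega>_\<eta>) auto

lemma S_nonneg: "0 \<le> S p n" unfolding S_def by (intro sum_nonneg) auto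

lemma S_mono: "m \<le> n \<Longrightarrow> S p m \<le> S p n" unfolding S_def by (intro sum_mono2) auto

lemma S_ge: "\<rho> 0 powr p \<le> S p n"
  using S_mono[of 0 n p] by (simp add: S_def)

text \<open>The terms of \<open>S 1\<close> equal \<open>1 / \<omega> (\<rho> i)\<close> and
  therefore do not decrease in \<open>i\<close>.\<close>

lemma S1_ge: "\<rho> 0 * (real n + 1) \<le> S 1 n"
proof -
  have "\<rho> 0 \<le> 2^i * \<rho> i" for i
  proof -
    have "\<rho> i \<le> \<rho> 0" by (induction i) (use \<rho>_Suc order_trans in auto)
    then have "\<omega> (\<rho> i) \<le> \<omega> (\<rho> 0)" using \<rho>_pos[of i] by (intro le) auto
    then have "1 / \<omega> (\<rho> 0) \<le> 1 / \<omega> (\<rho> i)" using pos \<rho>_pos by (intro divide_left_mono) auto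
    then show ?thesis using \<omega>_\<rho>[of i] \<omega>_\<rho>[of 0] by simp
  qed
  then have "(\<Sum>i\<le>n. \<rho> 0) \<le> (\<Sum>i\<le>n. 2^i * \<rho> i)" by (intro sum_mono)
  then show ?thesis using \<rho>_pos by (simp add: S_def powr_one_eq_one algebra_simps abs_of_pos)
qed

text \<open>The scale \<open>e\<close> belongs to the place where \<open>2^i\<close> passes
  \<open>Y\<close>. Before it, the terms \<open>1 / \<omega> (\<rho> i)\<close> stay below
  \<open>1 / \<omega> e = Y * e\<close>. Beyond it, \<open>quasi_concave\<close> bounds the square
  of the term by \<open>2^i * 2 * Y * e^2\<close>, so the growth is at most that of
  \<open>sqrt 2 ^ i\<close>.\<close>

lemma S_term_bound:
  assumes Y: "1 \<le> Y" and e: "e = \<eta> (1/Y)" "e < \<delta>0"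
  shows "2^i * \<rho> i \<le> Y * e + e * sqrt (2*Y) * sqrt 2 ^ i"
proof -
  have e0: "0 < e" using Y e by (simp add: \<eta>_pos)
  have we: "\<omega> e = 1 / (Y * e)" using \<omega>_\<eta>[of "1/Y"] Y e by (simp add: field_simps)
  consider "2^i \<le> Y" | "Y < 2^i" by linarith
  then show ?thesis
  proof cases
    case 1
    have "e \<le> \<rho> i" using 1 Y unfolding e \<rho>_def by (intro \<eta>_mono) (auto simp: field_simps)
    then have "\<omega> e \<le> \<omega> (\<rho> i)" using e0 by (intro le) auto
    then have "1 / \<omega> (\<rho> i) \<le> 1 / \<omega> e" using e0 by (intro divide_left_mono) (auto simp: pos \<rho>_pos)
    then have "2^i * \<rho> i \<le> Y * e" using \<omega>_\<rho>[of i] we e0 Y by simp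
    moreover have "0 \<le> e * sqrt (2*Y) * sqrt 2 ^ i" using e0 Y by simp
    ultimately show ?thesis by linarith
  next
    case 2
    have r: "\<rho> i \<le> e" using 2 Y unfolding e \<rho>_def by (intro \<eta>_mono) (auto simp: field_simps)
    have "\<omega> e * \<rho> i \<le> 2 * e * \<omega> (\<rho> i)" by (rule quasi_concave) (use r e \<rho>_pos in auto)
    moreover have "\<omega> (\<rho> i) = 1 / (2^i * \<rho> i)" using \<omega>_\<rho>[of i] \<rho>_pos[of i] pos[of "\<rho> i"] by (simp add: field_simps)
    ultimately have "\<rho> i / (Y * e) \<le> 2 * e / (2^i * \<rho> i)" using we by simp
    then have "2^i * \<rho> i * \<rho> i \<le> 2 * e * (Y * e)"
      using e0 Y \<rho>_pos[of i] by (simp add: divide_simps mult_ac)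
    then have "2^i * (2^i * \<rho> i * \<rho> i) \<le> 2^i * (2 * e * (Y * e))" by (intro mult_left_mono) auto
    then have "(2^i * \<rho> i)\<^sup>2 \<le> (e * sqrt (2*Y) * sqrt 2 ^ i)\<^sup>2"
      using Y by (simp add: power2_eq_square power_mult_distrib mult_ac flip: real_sqrt_power)
    then have "2^i * \<rho> i \<le> e * sqrt (2*Y) * sqrt 2 ^ i"
      using e0 Y by (intro power2_le_imp_le[of "2^i * \<rho> i"]) auto
    moreover have "0 \<le> Y * e" using e0 Y by simp
    ultimately show ?thesis by linarith
  qed
qed

lemma sum_sqrt2: "(\<Sum>i\<le>n. sqrt 2 ^ i) \<le> 4 * sqrt 2 ^ n"
proof (induction n)
  case (Suc n)
  \<comment> \<open>This is what the constant 4 requires: the induction step amounts to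
    \<open>4 \<le> 3 * sqrt 2\<close>.\<close>
  have "4/3 \<le> sqrt 2" by (rule real_le_rsqrt) (simp add: power2_eq_square)
  then have "4/3 * sqrt 2 ^ n \<le> sqrt 2 * sqrt 2 ^ n" by (intro mult_right_mono) auto
  with Suc have "sum ((^) (sqrt 2)) {..n} \<le> 3 * (sqrt 2 * sqrt 2 ^ n)" by linarith
  then show ?case by simp
qed auto

text \<open>The choice \<open>Y = y / (ln y)^2\<close> balances the two parts of
  \<open>S_term_bound\<close>: \<open>O(ln y)\<close> terms of size \<open>Y * e\<close> sum to
  order \<open>ln y * Y * e\<close>, and the geometric part, of order
  \<open>e * sqrt Y * sqrt y\<close>, is the same quantity. It equals
  \<open>Theta \<omega> 1 y\<close>, which explains the logarithms there.\<close>

lemma S1_Theta: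
  "\<exists>C R. \<forall>y\<ge>R. \<forall>n. 2^n \<le> y \<longrightarrow> S 1 n \<le> C * Theta \<omega> 1 y"
proof -
  have "((\<lambda>y::real. (ln y)\<^sup>2 / y) \<longlongrightarrow> 0) at_top" by real_asymp
  \<comment> \<open>The bound 1 will give \<open>Y \<ge> 1\<close>; the bound
    \<open>chi \<delta>0\<close> puts \<open>e\<close> below \<open>\<delta>0\<close>, where
    \<open>quasi_concave\<close> is available.\<close>
  then have "eventually (\<lambda>y::real. (ln y)\<^sup>2 / y < min 1 (chi \<delta>0)) at_top"
    by (rule order_tendstoD(2)) (use chi_pos \<delta>0 in auto)
  then obtain R where R: "\<And>y. y \<ge> R \<Longrightarrow> (ln y)\<^sup>2 / y < min 1 (chi \<delta>0)"
    by (auto simp: eventually_at_top_linorder)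
  have "S 1 n \<le> 9 * Theta \<omega> 1 y" if y: "y \<ge> max R (exp 1)" and n: "2^n \<le> y" for y n
  proof -
    have y0: "0 < y" using y exp_gt_zero[of 1] by (smt (verit))
    have l1: "1 \<le> ln y" using y y0 by (subst ln_ge_iff) auto
    then have la: "\<bar>ln y\<bar> = ln y" by linarith
    define Y where "Y = y / (ln y)\<^sup>2"
    define e where "e = \<eta> (1/Y)"
    have Yi: "1/Y = (ln y)\<^sup>2 / y" by (simp add: Y_def)
    have "(ln y)\<^sup>2 / y < 1" using R[of y] y by simp
    then have "(ln y)\<^sup>2 \<le> y" using y0 by (simp add: field_simps)
    then have Y1: "1 \<le> Y" using l1 by (simp add: Y_def le_divide_eq_1_pos)
    have e0: "0 < e" using Y1 by (simp add: e_def \<eta>_pos)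
    have "1/Y < chi \<delta>0" using R[of y] y Yi by auto
    then have ed: "e < \<delta>0" using \<eta>_le_iff[of "1/Y" \<delta>0] Y1 \<delta>0 chi_\<eta>[of "1/Y"]
      unfolding e_def by (smt (verit) divide_nonneg_nonneg)
    have s2: "sqrt 2 \<le> 3/2" by (rule real_le_lsqrt) (auto simp: power2_eq_square)
    have sq: "sqrt 2 ^ n \<le> sqrt y" using n by (simp flip: real_sqrt_power)
    have "real n * ln 2 \<le> ln y" using n y0 by (metis ln_le_cancel_iff ln_realpow zero_less_numeral zero_less_power)
    moreover have "1/2 \<le> ln (2::real)" using ln2_ge_two_thirds by simp
    ultimately have "real n * (1/2) \<le> ln y" 
      by (meson dual_order.trans mult_left_mono of_nat_0_le_iff)
    then have n3: "real n + 1 \<le> 3 * ln y" using l1 by simp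
    have "S 1 n = (\<Sum>i\<le>n. 2^i * \<rho> i)" using \<rho>_pos by (simp add: S_def abs_of_pos)
    also have "\<dots> \<le> (\<Sum>i\<le>n. Y * e + e * sqrt (2*Y) * sqrt 2 ^ i)"
      by (intro sum_mono S_term_bound Y1 e_def ed)
    also have "\<dots> = (real n + 1) * (Y * e) + e * sqrt (2*Y) * (\<Sum>i\<le>n. sqrt 2 ^ i)"
      by (simp add: sum.distrib sum_distrib_left)
    also have "\<dots> \<le> 3 * ln y * (Y * e) + e * sqrt (2*Y) * (4 * sqrt 2 ^ n)"
      using n3 e0 Y1 by (intro add_mono mult_right_mono mult_left_mono sum_sqrt2) auto
    also have "\<dots> \<le> 3 * ln y * (Y * e) + e * sqrt (2*Y) * (4 * sqrt y)"
      using sq e0 Y1 l1 by (intro add_mono mult_left_mono) auto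
    also have "e * sqrt (2*Y) * (4 * sqrt y) = 4 * sqrt 2 * (e * (sqrt Y * sqrt y))"
      by (simp add: real_sqrt_mult)
    also have "sqrt Y * sqrt y = ln y * Y"
      using y0 l1 by (simp add: Y_def real_sqrt_divide power2_eq_square la)
    also have "4 * sqrt 2 * (e * (ln y * Y)) \<le> 6 * (e * (ln y * Y))"
      using e0 l1 Y1 s2 by (intro mult_right_mono) auto
    finally have "S 1 n \<le> 9 * (ln y * Y * e)" by (simp add: algebra_simps)
    also have "ln y * Y * e = Theta \<omega> 1 y" using l1 y0 by (simp add: Theta_def e_def Yi Y_def power2_eq_square)
    finally show ?thesis .
  qed
  then show ?thesis by blast
qed

lemma \<eta>_powr_integrable:
  assumes "0 < a" "0 \<le> p" shows "(\<lambda>\<tau>. \<eta> (1/\<tau>) powr p) integrable_on {a..b}"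
proof -
  have "mono_on {a..b} (\<lambda>\<tau>. - (\<eta> (1/\<tau>) powr p))"
    using assms by (auto intro!: mono_onI powr_mono2 \<eta>_mono divide_left_mono)
  then have "(\<lambda>\<tau>. - (\<eta> (1/\<tau>) powr p)) integrable_on {a..b}" by (rule integrable_on_mono_on)
  then show ?thesis by (simp add: integrable_neg_iff)
qed

text \<open>On this shell \<open>1/\<tau>\<close> is at least \<open>1/2^Suc n\<close>. The left
  side is half of the term of \<open>S\<close> with index \<open>n + 1\<close>, whence the factor 2
  in the comparison below.\<close>

lemma \<eta>_powr_integral_ge:
  assumes "0 \<le> p"
  shows "2^n * \<rho> (Suc n) powr p \<le> integral {2^n..2^Suc n} (\<lambda>\<tau>. \<eta> (1/\<tau>) powr p)"
proof -
  have "integral {2^n..2^Suc n :: real} (\<lambda>\<tau>. \<rho> (Suc n) powr p) \<le> integral {2^n..2^Suc n} (\<lambda>\<tau>. \<eta> (1/\<tau>) powr p)"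
  proof (rule integral_le)
    fix x :: real assume x: "x \<in> {2^n..2^Suc n}"
    then have x0: "0 < x" by (meson atLeastAtMost_iff less_le_trans zero_less_numeral zero_less_power)
    have "\<eta> (1/2^Suc n) \<le> \<eta> (1/x)" using x x0 by (intro \<eta>_mono divide_left_mono) auto
    then show "\<rho> (Suc n) powr p \<le> \<eta> (1/x) powr p"
      unfolding \<rho>_def using assms by (intro powr_mono2) auto
  qed (auto intro!: \<eta>_powr_integrable assms)
  then show ?thesis by simp
qed

lemma Sp_Theta:
  assumes p: "1 < p"
  shows "\<exists>C R. \<forall>y\<ge>R. \<forall>n. 2^n \<le> y \<longrightarrow> S p n \<le> C * Theta \<omega> p y powr p"
proof -
  define J where "J y = integral {1..y} (\<lambda>\<tau>. \<eta> (1/\<tau>) powr p)" for y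
  have J_mono: "J x \<le> J y" if "x \<le> y" for x y
    unfolding J_def using that p by (intro integral_subset_le \<eta>_powr_integrable) auto
  have J0: "0 \<le> J y" for y
    unfolding J_def using p by (intro integral_nonneg \<eta>_powr_integrable) auto
  have SJ: "S p n \<le> \<rho> 0 powr p + 2 * J (2^n)" for n
  proof (induction n)
    case 0 then show ?case using J0[of 1] by (simp add: S_def)
  next
    case (Suc n)
    have "J (2^Suc n) = J (2^n) + integral {2^n..2^Suc n} (\<lambda>\<tau>. \<eta> (1/\<tau>) powr p)"
      using Henstock_Kurzweil_Integration.integral_combine[OF _ _ \<eta>_powr_integrable, of 1 "2^n" "2^Suc n" p] p
      unfolding J_def by simp
    with \<eta>_powr_integral_ge[of p n] p
    have "J (2^Suc n) \<ge> J (2^n) + 2^n * \<rho> (Suc n) powr p" by linarith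
    with Suc show ?case by (simp add: S_def)
  qed
  \<comment> \<open>The term with index 0 has no shell of its own. It is charged to the first shell,
    whose integral is at least \<open>\<rho> 1 powr p\<close>.\<close>
  define c where "c = \<rho> 0 powr p / \<rho> 1 powr p"
  have "S p n \<le> (c + 2) * Theta \<omega> p y powr p" if "y \<ge> 2" "2^n \<le> y" for y n
  proof -
    have "\<rho> 1 powr p \<le> J 2" using \<eta>_powr_integral_ge[of p 0] p by (simp add: J_def)
    also have "\<dots> \<le> J y" using that by (intro J_mono)
    finally have "c * \<rho> 1 powr p \<le> c * J y" by (intro mult_left_mono) (auto simp: c_def)
    then have "\<rho> 0 powr p \<le> c * J y" using \<rho>_pos[of 1] by (simp add: c_def)
    moreover have "S p n \<le> \<rho> 0 powr p + 2 * J y" using SJ[of n] J_mono[OF that(2)] by linarith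
    ultimately have "S p n \<le> (c + 2) * J y" by (simp add: algebra_simps)
    also have "J y = Theta \<omega> p y powr p" using p J0[of y] by (simp add: Theta_def J_def powr_powr)
    finally show ?thesis .
  qed
  then show ?thesis by blast
qed

lemma S_Theta:
  assumes "1 \<le> p"
  shows "\<exists>C R. \<forall>y\<ge>R. \<forall>n. 2^n \<le> y \<longrightarrow> S p n \<le> C * Theta \<omega> p y powr p"
proof (cases "p = 1")
  case True
  obtain C R where R: "\<And>y n. y \<ge> R \<Longrightarrow> 2^n \<le> y \<Longrightarrow> S 1 n \<le> C * Theta \<omega> 1 y" using S1_Theta by blast
  have "0 \<le> Theta \<omega> 1 y" if "y \<ge> 1" for y
    using that by (simp add: Theta_def)
  then have "\<forall>y\<ge>max R 1. \<forall>n. 2^n \<le> y \<longrightarrow> S p n \<le> C * Theta \<omega> p y powr p"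
    using R True by auto
  then show ?thesis by blast
qed (use assms Sp_Theta[of p] in auto)

end

subsection \<open>Oscillatory integrals\<close>

text \<open>The second mean value theorem moves the monotone amplitude to the two endpoints; each
  remaining integral of \<open>f\<close> is a difference of values of \<open>F\<close>, hence at
  most 2. No derivative of \<open>r\<close> occurs, which matters because \<open>r\<close> will be
  built from a Cantor function.\<close>

lemma van_der_corput_real:
  fixes r f :: "real \<Rightarrow> real"
  assumes ab: "a \<le> b"
    and r: "mono_on {a..b} r \<or> mono_on {a..b} (\<lambda>t. - r t)"
    and R: "\<And>t. t \<in> {a..b} \<Longrightarrow> \<bar>r t\<bar> \<le> R"
    and f: "\<And>t. t \<in> {a..b} \<Longrightarrow> (F has_real_derivative f t) (at t within {a..b})"
    and F: "\<And>t. \<bar>F t\<bar> \<le> 1"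
  shows "(\<lambda>t. r t * f t) integrable_on {a..b}" "\<bar>integral {a..b} (\<lambda>t. r t * f t)\<bar> \<le> 4 * R"
proof -
  have *: "(\<lambda>t. r t * f t) integrable_on {a..b} \<and> \<bar>integral {a..b} (\<lambda>t. r t * f t)\<bar> \<le> 4 * R"
    if r: "mono_on {a..b} r" and R: "\<And>t. t \<in> {a..b} \<Longrightarrow> \<bar>r t\<bar> \<le> R" for r
  proof -
    have hi: "(f has_integral F d - F c) {c..d}" if "a \<le> c" "c \<le> d" "d \<le> b" for c d
      using that by (intro fundamental_theorem_of_calculus)
        (auto simp flip: has_real_derivative_iff_has_vector_derivative intro!: DERIV_subset[OF f])
    have "f integrable_on {a..b}" using hi[of a b] ab by auto
    then obtain c where c: "c \<in> {a..b}"
      "((\<lambda>x. r x * f x) has_integral (r a * integral {a..c} f + r b * integral {c..b} f)) {a..b}"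
      by (rule second_mean_value_theorem_full[OF _ ab, where g = r]) (use r in \<open>auto simp: mono_on_def\<close>)
    have "\<bar>integral {a..c} f\<bar> \<le> 2" "\<bar>integral {c..b} f\<bar> \<le> 2"
      using integral_unique[OF hi[of a c]] integral_unique[OF hi[of c b]] c F[of a] F[of b] F[of c] by auto
    then have "\<bar>r a\<bar> * \<bar>integral {a..c} f\<bar> \<le> R * 2" "\<bar>r b\<bar> * \<bar>integral {c..b} f\<bar> \<le> R * 2"
      using R[of a] R[of b] ab by (auto intro!: mult_mono intro: order_trans[OF abs_ge_zero])
    then have "\<bar>r a * integral {a..c} f + r b * integral {c..b} f\<bar> \<le> 4 * R"
      using abs_triangle_ineq[of "r a * integral {a..c} f" "r b * integral {c..b} f"] by (simp add: abs_mult)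
    with c show ?thesis by (auto simp: integral_unique)
  qed
  have "(\<lambda>t. r t * f t) integrable_on {a..b} \<and> \<bar>integral {a..b} (\<lambda>t. r t * f t)\<bar> \<le> 4 * R"
    using r
  proof
    assume "mono_on {a..b} (\<lambda>t. - r t)"
    from *[OF this] R show ?thesis by (simp add: integrable_neg_iff)
  qed (use * R in auto)
  then show "(\<lambda>t. r t * f t) integrable_on {a..b}" "\<bar>integral {a..b} (\<lambda>t. r t * f t)\<bar> \<le> 4 * R" by auto
qed

text \<open>Writing the amplitude as \<open>r * u\<close> makes the real and imaginary parts
  \<open>r\<close> times the derivatives of \<open>sin \<psi>\<close> and
  \<open>- cos \<psi>\<close>. A given amplitude is treated by dividing it by the phase derivative
  \<open>u\<close>.\<close>

lemma van_der_corput: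
  fixes r u \<psi> :: "real \<Rightarrow> real"
  assumes ab: "a \<le> b"
    and r: "mono_on {a..b} r \<or> mono_on {a..b} (\<lambda>t. - r t)"
    and R: "\<And>t. t \<in> {a..b} \<Longrightarrow> \<bar>r t\<bar> \<le> R"
    and u: "\<And>t. t \<in> {a..b} \<Longrightarrow> (\<psi> has_real_derivative u t) (at t within {a..b})"
  shows "norm (integral {a..b} (\<lambda>t. of_real (r t * u t) * cis (\<psi> t))) \<le> 8 * R"
proof -
  let ?c = "\<lambda>t. r t * (u t * cos (\<psi> t))" and ?s = "\<lambda>t. r t * (u t * sin (\<psi> t))"
  note vc = van_der_corput_real[OF ab r R, of "\<lambda>t. sin (\<psi> t)" "\<lambda>t. u t * cos (\<psi> t)"]
  note vs = van_der_corput_real[OF ab r R, of "\<lambda>t. - cos (\<psi> t)" "\<lambda>t. u t * sin (\<psi> t)"]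
  have ds: "((\<lambda>t. sin (\<psi> t)) has_real_derivative u t * cos (\<psi> t)) (at t within {a..b})" if "t \<in> {a..b}" for t
    by (rule derivative_eq_intros u[OF that] refl)+ simp
  have dc: "((\<lambda>t. - cos (\<psi> t)) has_real_derivative u t * sin (\<psi> t)) (at t within {a..b})" if "t \<in> {a..b}" for t
    by (rule derivative_eq_intros u[OF that] refl)+ simp
  have c: "?c integrable_on {a..b}" "\<bar>integral {a..b} ?c\<bar> \<le> 4 * R"
    using vc ds by auto
  have s: "?s integrable_on {a..b}" "\<bar>integral {a..b} ?s\<bar> \<le> 4 * R"
    using vs dc by auto
  have eq: "of_real (r t * u t) * cis (\<psi> t) = of_real (?c t) + \<i> * of_real (?s t)" for t
    by (simp add: complex_eq_iff)
  have "((\<lambda>t. of_real (r t * u t) * cis (\<psi> t)) has_integral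
      of_real (integral {a..b} ?c) + \<i> * of_real (integral {a..b} ?s)) {a..b}"
    unfolding eq using c(1) s(1)
    by (intro has_integral_add has_integral_mult_right has_integral_of_real integrable_integral)
  then have I: "integral {a..b} (\<lambda>t. of_real (r t * u t) * cis (\<psi> t)) =
      of_real (integral {a..b} ?c) + \<i> * of_real (integral {a..b} ?s)"
    by (rule integral_unique)
  have "norm (complex_of_real (integral {a..b} ?c) + \<i> * of_real (integral {a..b} ?s)) \<le>
      \<bar>integral {a..b} ?c\<bar> + \<bar>integral {a..b} ?s\<bar>"
    by (rule order_trans[OF norm_triangle_ineq]) (simp add: norm_mult)
  also have "\<dots> \<le> 4 * R + 4 * R" using c(2) s(2) by (rule add_mono)
  finally show ?thesis unfolding I by simp
qed

text \<open>The difference of two values is \<open>(a*d - b*c) * (A t - A s)\<close> over a product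
  of two denominators of equal sign, so the determinant alone decides the direction.\<close>

lemma mono_on_moebius:
  fixes A :: "real \<Rightarrow> real"
  assumes A: "mono_on X A" and nz: "(\<forall>t\<in>X. 0 < c * A t + d) \<or> (\<forall>t\<in>X. c * A t + d < 0)"
  shows "mono_on X (\<lambda>t. (a * A t + b) / (c * A t + d)) \<or> mono_on X (\<lambda>t. - ((a * A t + b) / (c * A t + d)))"
proof -
  have diff: "(a * A t + b) / (c * A t + d) - (a * A s + b) / (c * A s + d) =
      (a * d - b * c) * (A t - A s) / ((c * A t + d) * (c * A s + d))" if "s \<in> X" "t \<in> X" for s t
  proof -
    have "c * A t + d \<noteq> 0" "c * A s + d \<noteq> 0" using nz that by (metis less_irrefl)+
    then show ?thesis by (simp add: diff_frac_eq) (simp add: algebra_simps)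
  qed
  have pr: "0 \<le> (A t - A s) / ((c * A t + d) * (c * A s + d))" if "s \<in> X" "t \<in> X" "s \<le> t" for s t
    using nz that A by (intro divide_nonneg_pos) (auto simp: mono_on_def zero_less_mult_iff)
  show ?thesis
  proof (cases "a * d - b * c \<ge> 0")
    case True
    have "mono_on X (\<lambda>t. (a * A t + b) / (c * A t + d))"
    proof (rule mono_onI)
      fix s t assume "s \<in> X" "t \<in> X" "s \<le> t"
      from mult_nonneg_nonneg[OF True pr[OF this]] diff[of s t] \<open>s \<in> X\<close> \<open>t \<in> X\<close>
      show "(a * A s + b) / (c * A s + d) \<le> (a * A t + b) / (c * A t + d)" by simp
    qed
    then show ?thesis ..
  next
    case False
    have "mono_on X (\<lambda>t. - ((a * A t + b) / (c * A t + d)))"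
    proof (rule mono_onI)
      fix s t assume "s \<in> X" "t \<in> X" "s \<le> t"
      from mult_nonpos_nonneg[OF _ pr[OF this], of "a * d - b * c"] diff[of s t] False \<open>s \<in> X\<close> \<open>t \<in> X\<close>
      show "- ((a * A s + b) / (c * A s + d)) \<le> - ((a * A t + b) / (c * A t + d))" by simp
    qed
    then show ?thesis ..
  qed
qed

text \<open>Amplitude and phase derivative are affine in the same \<open>A\<close>, so their
  quotient is monotone. Pure exponentials are the case \<open>p = 0\<close>, \<open>q = 1\<close>;
  the general amplitude serves the tail estimate, where integration by parts brings the derivative
  of the bump in front.\<close>

lemma van_der_corput_moebius:
  fixes A \<psi> :: "real \<Rightarrow> real"
  assumes ab: "a \<le> b" and A: "mono_on {a..b} A"
    and \<psi>: "\<And>t. t \<in> {a..b} \<Longrightarrow> (\<psi> has_real_derivative c * A t + d) (at t within {a..b})"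
    and h: "0 < h" "(\<forall>t\<in>{a..b}. h \<le> c * A t + d) \<or> (\<forall>t\<in>{a..b}. c * A t + d \<le> - h)"
    and Q: "\<And>t. t \<in> {a..b} \<Longrightarrow> \<bar>p * A t + q\<bar> \<le> Q"
  shows "norm (integral {a..b} (\<lambda>t. of_real (p * A t + q) * cis (\<psi> t))) \<le> 8 * (Q / h)"
proof -
  let ?r = "\<lambda>t. (p * A t + q) / (c * A t + d)"
  have ge: "h \<le> \<bar>c * A t + d\<bar>" if "t \<in> {a..b}" for t using h that by fastforce
  have "norm (integral {a..b} (\<lambda>t. of_real (?r t * (c * A t + d)) * cis (\<psi> t))) \<le> 8 * (Q / h)"
  proof (rule van_der_corput[OF ab])
    show "mono_on {a..b} ?r \<or> mono_on {a..b} (\<lambda>t. - ?r t)"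
      by (rule mono_on_moebius[OF A]) (use h in fastforce)
    show "\<bar>?r t\<bar> \<le> Q / h" if "t \<in> {a..b}" for t
      using Q[OF that] ge[OF that] h(1) unfolding abs_divide by (intro frac_le) auto
  qed (use \<psi> in auto)
  also have "integral {a..b} (\<lambda>t. of_real (?r t * (c * A t + d)) * cis (\<psi> t)) =
      integral {a..b} (\<lambda>t. of_real (p * A t + q) * cis (\<psi> t))"
    using ge h(1) by (intro integral_cong) force
  finally show ?thesis .
qed

subsection \<open>Cantor staircases\<close>

text \<open>The binary digits of \<open>j\<close> record the choices of child:
  \<open>j div 2\<close> is the parent, an even \<open>j\<close> is aligned with its left end and an
  odd \<open>j\<close> with its right end.\<close>

fun left_end :: "(nat \<Rightarrow> real) \<Rightarrow> nat \<Rightarrow> nat \<Rightarrow> real" where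
  "left_end l 0 j = 0"
| "left_end l (Suc n) j = left_end l n (j div 2) + (if odd j then l n - l (Suc n) else 0)"

context
  fixes l :: "nat \<Rightarrow> real"
  assumes l_pos: "\<And>n. 0 < l n" and l_Suc: "\<And>n. 2 * l (Suc n) < l n"
begin

lemma left_end_even: "left_end l (Suc n) (2 * j) = left_end l n j"
  and left_end_odd: "left_end l (Suc n) (Suc (2 * j)) = left_end l n j + l n - l (Suc n)"
  by auto

lemma left_end_gap: "Suc j < 2^n \<Longrightarrow> left_end l n j + l n < left_end l n (Suc j)"
proof (induction n arbitrary: j)
  case (Suc n)
  show ?case
  proof (cases "even j")
    case True
    then obtain i where "j = 2 * i" by blast
    then show ?thesis using l_Suc[of n] by simp
  next
    case False
    then obtain i where i: "j = Suc (2 * i)" by (metis oddE Suc_eq_plus1)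
    then have "Suc i < 2^n" "Suc j = 2 * Suc i" using Suc.prems by auto
    then show ?thesis using Suc.IH[of i] i left_end_even[of n "Suc i"] left_end_odd[of n i] by simp
  qed
qed auto

lemma left_end_less: "i < j \<Longrightarrow> j < 2^n \<Longrightarrow> left_end l n i + l n < left_end l n j"
proof (induction j)
  case (Suc j)
  show ?case
  proof (cases "i = j")
    case False
    then have "left_end l n i + l n < left_end l n j" using Suc by simp
    with left_end_gap[of j n] Suc.prems l_pos[of n] show ?thesis by simp
  qed (use left_end_gap Suc in auto)
qed auto

lemma left_end_le: "i \<le> j \<Longrightarrow> j < 2^n \<Longrightarrow> left_end l n i \<le> left_end l n j"
  using left_end_less[of i j n] l_pos[of n] by (cases "i = j") auto

text \<open>The leftmost descendant keeps the left endpoint; the companion statement keeps the right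
  endpoint for the rightmost one. Intervals of levels \<open>m\<close> and \<open>n\<close> can thus
  be compared at the common level \<open>m + n\<close>.\<close>

lemma left_end_refine: "left_end l (n + k) (j * 2^k) = left_end l n j"
proof (induction k)
  case (Suc k)
  have "left_end l (Suc (n + k)) (2 * (j * 2^k)) = left_end l n j"
    unfolding left_end_even by (rule Suc.IH)
  then show ?case by (simp add: mult_ac)
qed auto

lemma right_end_refine: "left_end l (n + k) (Suc j * 2^k - 1) + l (n + k) = left_end l n j + l n"
proof (induction k)
  case (Suc k)
  have "(0::nat) < Suc j * 2^k" by simp
  moreover have "Suc j * 2^Suc k = 2 * (Suc j * 2^k)" by simp
  ultimately have "Suc j * 2^Suc k - 1 = Suc (2 * (Suc j * 2^k - 1))" by linarith
  then show ?case using Suc left_end_odd[of "n + k" "Suc j * 2^k - 1"] by simp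
qed auto

lemma left_end_nonneg: "0 \<le> left_end l n j"
proof (induction n arbitrary: j)
  case (Suc n)
  have "l (Suc n) \<le> l n" using l_Suc[of n] l_pos[of "Suc n"] by linarith
  with Suc[of "j div 2"] show ?case by simp
qed auto

lemma right_end_le: "left_end l n j + l n \<le> l 0"
proof (induction n arbitrary: j)
  case (Suc n)
  have "l (Suc n) \<le> l n" using l_Suc[of n] l_pos[of "Suc n"] by linarith
  with Suc[of "j div 2"] show ?case by simp
qed auto

text \<open>The order of right endpoints agrees with the order of the dyadic values to be attached
  to them. Otherwise, at level \<open>m + n\<close>, the last descendant of interval
  \<open>j\<close> would lie strictly to the left of the last descendant of interval
  \<open>i\<close>.\<close>

lemma index_le: 
  assumes "left_end l m i + l m \<le> left_end l n j + l n" "i < 2^m" "j < 2^n"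
  shows "Suc i * 2^n \<le> Suc j * 2^m"
proof (rule ccontr)
  assume "\<not> ?thesis"
  moreover have "0 < Suc j * 2^m" by simp
  ultimately have lt: "Suc j * 2^m - 1 < Suc i * 2^n - 1" by linarith
  have "Suc i * 2^n \<le> 2^m * 2^n" using assms(2) by (intro mult_right_mono) auto
  moreover have "0 < Suc i * 2^n" by simp
  ultimately have "Suc i * 2^n - 1 < 2^(m+n)" unfolding power_add by linarith
  then have "left_end l (m+n) (Suc j * 2^m - 1) + l (m+n) < left_end l (m+n) (Suc i * 2^n - 1)"
    by (intro left_end_less lt)
  also have "\<dots> < left_end l (m+n) (Suc i * 2^n - 1) + l (m + n)" using l_pos by simp
  also have "\<dots> = left_end l m i + l m" by (rule right_end_refine)
  also have "left_end l (m+n) (Suc j * 2^m - 1) + l (m+n) = left_end l n j + l n"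
    using right_end_refine[of n m j] by (simp add: add.commute)
  finally show False using assms by simp
qed

lemma index_le':
  assumes "left_end l m i + l m \<le> left_end l n j" "i < 2^m" "j < 2^n"
  shows "Suc i * 2^n \<le> j * 2^m"
proof (rule ccontr)
  assume "\<not> ?thesis"
  then have lt: "j * 2^m \<le> Suc i * 2^n - 1" by simp
  have "Suc i * 2^n \<le> 2^m * 2^n" using assms(2) by (intro mult_right_mono) auto
  moreover have "0 < Suc i * 2^n" by simp
  ultimately have "Suc i * 2^n - 1 < 2^(m+n)" unfolding power_add by linarith
  then have "left_end l (m+n) (j * 2^m) \<le> left_end l (m+n) (Suc i * 2^n - 1)"
    by (intro left_end_le lt)
  also have "\<dots> < left_end l (m+n) (Suc i * 2^n - 1) + l (m + n)" using l_pos by simp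
  also have "\<dots> = left_end l m i + l m" by (rule right_end_refine)
  also have "left_end l (m+n) (j * 2^m) = left_end l n j"
    using left_end_refine[of n m j] by (simp add: add.commute)
  finally show False using assms by simp
qed

lemma cantor_function:
  obtains A :: "real \<Rightarrow> real" where
    "mono A" "\<And>t. t \<le> 0 \<Longrightarrow> A t = 0" "\<And>t. l 0 \<le> t \<Longrightarrow> A t = 1"
    "\<And>n j. j < 2^n \<Longrightarrow> \<exists>x\<ge>0. x + l n \<le> l 0 \<and> A x = real j / 2^n \<and> A (x + l n) = real (Suc j) / 2^n"
proof -
  \<comment> \<open>These are the values due at the right ends of all Cantor intervals completed by
    \<open>t\<close>. A supremum over all levels at once makes monotonicity immediate and avoids a
    uniform limit; continuity follows later from the step property. The 0 keeps the set nonempty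
    before anything is completed.\<close>
  define D where "D t = insert 0 {real (Suc j) / 2^n | n j. j < 2^n \<and> left_end l n j + l n \<le> t}" for t
  define A where "A t = Sup (D t)" for t
  have D1: "d \<le> 1" if "d \<in> D t" for d t
  proof -
    have "real (Suc j) / 2^n \<le> 1" if "j < 2^n" for j n :: nat
    proof -
      have "Suc j \<le> 2^n" using that by simp
      then have "real (Suc j) \<le> 2^n" by (metis of_nat_le_iff of_nat_numeral of_nat_power)
      then show ?thesis by simp
    qed
    then show ?thesis using that by (auto simp: D_def)
  qed
  have bdd: "bdd_above (D t)" for t using D1 by (rule bdd_aboveI)
  have D0: "0 \<in> D t" for t by (simp add: D_def)
  have mono: "mono A"
  proof (rule monoI)
    fix s t :: real assume "s \<le> t"
    then have "D s \<subseteq> D t" by (force simp: D_def)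
    then show "A s \<le> A t" unfolding A_def using bdd D0 by (intro cSup_subset_mono) auto
  qed
  have eqI: "A t = d" if "d \<in> D t" "\<And>e. e \<in> D t \<Longrightarrow> e \<le> d" for d t
    unfolding A_def using that by (intro cSup_eq_maximum)
  have cross: "real a / 2^m \<le> real b / 2^n" if "a * 2^n \<le> b * 2^m" for a b m n :: nat
  proof -
    have "real (a * 2^n) \<le> real (b * 2^m)" using that by (simp only: of_nat_le_iff)
    then show ?thesis by (simp add: divide_simps)
  qed
  have zero: "A t = 0" if "t \<le> 0" for t
  proof (rule eqI)
    fix e assume "e \<in> D t"
    moreover have "\<not> left_end l n j + l n \<le> t" for n j
      using left_end_nonneg[of n j] l_pos[of n] that by linarith
    ultimately show "e \<le> 0" by (auto simp: D_def)
  qed (simp add: D_def)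
  have one: "A t = 1" if "l 0 \<le> t" for t
  proof (rule eqI)
    have "1 = real (Suc 0) / 2^0 \<and> 0 < (2::nat)^0 \<and> left_end l 0 0 + l 0 \<le> t" using that by simp
    then show "1 \<in> D t" unfolding D_def by blast
  qed (rule D1)
  have P: "\<exists>x\<ge>0. x + l n \<le> l 0 \<and> A x = real j / 2^n \<and> A (x + l n) = real (Suc j) / 2^n" if j: "j < 2^n" for n j
  proof (intro exI conjI)
    show "0 \<le> left_end l n j" by (rule left_end_nonneg)
    show "left_end l n j + l n \<le> l 0" by (rule right_end_le)
    show "A (left_end l n j + l n) = real (Suc j) / 2^n"
    proof (rule eqI)
      show "real (Suc j) / 2^n \<in> D (left_end l n j + l n)" using j by (auto simp: D_def)
      fix e assume "e \<in> D (left_end l n j + l n)"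
      then show "e \<le> real (Suc j) / 2^n"
        unfolding D_def using index_le[OF _ _ j] by (auto intro!: cross simp del: of_nat_Suc mult_Suc)
    qed
    show "A (left_end l n j) = real j / 2^n"
    proof (rule eqI)
      show "real j / 2^n \<in> D (left_end l n j)"
      proof (cases j)
        case (Suc i)
        \<comment> \<open>The preceding interval of the same level has already ended, and its value
          is \<open>j / 2^n\<close>. For \<open>j = 0\<close> the inserted 0 takes this
          part.\<close>
        then have "real j / 2^n = real (Suc i) / 2^n \<and> i < 2^n \<and> left_end l n i + l n \<le> left_end l n j"
          using left_end_less[of i j n] j by simp
        then show ?thesis unfolding D_def by blast
      qed (simp add: D_def)
      fix e assume "e \<in> D (left_end l n j)"
      then show "e \<le> real j / 2^n"
        unfolding D_def using index_le'[OF _ _ j] by (auto intro!: cross simp del: of_nat_Suc mult_Suc)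
    qed
  qed
  from that[OF mono zero one P] show thesis .
qed

end

section \<open>Scales and staircases adapted to \<omega>\<close>

context modulus
begin

lemma small: assumes "0 < e" shows "\<exists>d>0. \<forall>x. 0 \<le> x \<longrightarrow> x < d \<longrightarrow> \<omega> x < e"
proof -
  obtain d where d: "d > 0" "\<And>x. x \<in> {0..} \<Longrightarrow> dist x 0 < d \<Longrightarrow> dist (\<omega> x) (\<omega> 0) < e"
    using bspec[OF cont[unfolded continuous_on_iff], of 0] assms by auto
  have "\<omega> x < e" if "0 \<le> x" "x < d" for x
    using d(2)[of x] that zero by (auto simp: dist_real_def abs_if split: if_splits)
  with d show ?thesis by blast
qed

lemma continuous_on_modulus:
  fixes f :: "real \<Rightarrow> real"
  assumes "\<And>s t. \<bar>f t - f s\<bar> \<le> C * \<omega> \<bar>t - s\<bar>"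
  shows "continuous_on X f"
  unfolding continuous_on_iff
proof (intro ballI allI impI)
  fix x and e :: real assume e: "0 < e"
  define C' where "C' = max C 1"
  have C': "C' \<ge> 1" "C \<le> C'" by (auto simp: C'_def)
  obtain d where d: "d > 0" "\<And>x. 0 \<le> x \<Longrightarrow> x < d \<Longrightarrow> \<omega> x < e / C'"
    using small[of "e / C'"] e C' by auto
  have "dist (f y) (f x) < e" if "dist y x < d" for y
  proof -
    have "dist (f y) (f x) \<le> C * \<omega> \<bar>y - x\<bar>" using assms by (simp add: dist_real_def)
    also have "\<dots> \<le> C' * \<omega> \<bar>y - x\<bar>" using C' nonneg by (intro mult_right_mono) auto
    also have "\<dots> < C' * (e / C')" using d(2)[of "\<bar>y - x\<bar>"] that C' by (intro mult_strict_left_mono) (auto simp: dist_real_def)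
    finally show ?thesis using C' by simp
  qed
  with d show "\<exists>d>0. \<forall>x'\<in>X. dist x' x < d \<longrightarrow> dist (f x') (f x) < e" by blast
qed

text \<open>The lengths come from the intermediate value theorem. If
  \<open>2 * l (Suc n) \<ge> l n\<close>, then
  \<open>\<omega> (l n / 2) \<le> \<omega> (l n) / 2\<close>, against strict doubling at
  \<open>l n / 2\<close>.\<close>

lemma levels_exist:
  assumes "0 < L" "L < \<delta>0"
  obtains l where "l 0 = L" "\<And>n. 0 < l n" "\<And>n. 2 * l (Suc n) < l n" "\<And>n. \<omega> (l n) = \<omega> L / 2^n"
proof -
  have "\<exists>x. 0 < x \<and> x \<le> L \<and> \<omega> x = \<omega> L / 2^n" for n
  proof -
    have c: "continuous_on {0..L} \<omega>" using cont by (rule continuous_on_subset) auto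
    have p: "0 < \<omega> L" using assms pos by simp
    have "\<omega> 0 \<le> \<omega> L / 2^n" "\<omega> L / 2^n \<le> \<omega> L"
      using zero p by (auto simp: divide_le_eq mult_le_cancel_left1)
    then obtain x where x: "0 \<le> x" "x \<le> L" "\<omega> x = \<omega> L / 2^n"
      using IVT'[of \<omega> 0 "\<omega> L / 2^n" L] c assms by auto
    then have "x \<noteq> 0" using zero p by auto
    with x show ?thesis by (intro exI[of _ x]) auto
  qed
  then obtain g where g: "\<And>n. 0 < g n" "\<And>n. g n \<le> L" "\<And>n. \<omega> (g n) = \<omega> L / 2^n" by metis
  \<comment> \<open>\<open>\<omega>\<close> may be constant on intervals, so the preimage
    \<open>g 0\<close> of \<open>\<omega> L\<close> need not be \<open>L\<close>; level 0 is set by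
    hand.\<close>
  define l where "l n = (if n = 0 then L else g n)" for n
  have l: "0 < l n" "l n \<le> L" "\<omega> (l n) = \<omega> L / 2^n" for n using g assms by (auto simp: l_def)
  have "2 * l (Suc n) < l n" for n
  proof (rule ccontr)
    assume "\<not> ?thesis"
    then have "\<omega> (l n / 2) \<le> \<omega> (l (Suc n))" using l(1)[of n] by (intro le) auto
    moreover have "\<omega> (2 * (l n / 2)) < 2 * \<omega> (l n / 2)"
      using l(1,2)[of n] assms by (intro double) auto
    ultimately show False using l(3)[of n] l(3)[of "Suc n"] by simp
  qed
  with l that[of l] show thesis by (auto simp: l_def)
qed

end

text \<open>The positions of the steps are forgotten. Existence of a step for each level and index,
  with monotonicity, already yields the modulus, the plateaus and the oscillation estimates.\<close>

locale staircase = modulus +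
  fixes L :: real and l :: "nat \<Rightarrow> real" and A :: "real \<Rightarrow> real"
  assumes L: "0 < L" "L < \<delta>0"
    and l_0: "l 0 = L" and l_pos: "\<And>n. 0 < l n" and l_Suc: "\<And>n. 2 * l (Suc n) < l n"
    and \<omega>_l: "\<And>n. \<omega> (l n) = \<omega> L / 2^n"
    and A_mono: "mono A" and A_left: "\<And>t. t \<le> 0 \<Longrightarrow> A t = 0" and A_right: "\<And>t. L \<le> t \<Longrightarrow> A t = \<omega> L"
    and steps: "\<And>n j. j < 2^n \<Longrightarrow>
      \<exists>x\<ge>0. x + l n \<le> L \<and> A x = real j / 2^n * \<omega> L \<and> A (x + l n) = real (Suc j) / 2^n * \<omega> L"

lemma (in modulus) staircase_exists:
  assumes "0 < L" "L < \<delta>0"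
  obtains l A where "staircase \<omega> \<delta>0 L l A"
proof -
  obtain l where l: "l 0 = L" "\<And>n. 0 < l n" "\<And>n. 2 * l (Suc n) < l n" "\<And>n. \<omega> (l n) = \<omega> L / 2^n"
    using levels_exist[OF assms] by blast
  obtain A :: "real \<Rightarrow> real" where A: "mono A" "\<And>t. t \<le> 0 \<Longrightarrow> A t = 0" "\<And>t. l 0 \<le> t \<Longrightarrow> A t = 1"
    "\<And>n j. j < 2^n \<Longrightarrow> \<exists>x\<ge>0. x + l n \<le> l 0 \<and> A x = real j / 2^n \<and> A (x + l n) = real (Suc j) / 2^n"
    using cantor_function[of l, OF l(2,3)] by blast
  have "staircase \<omega> \<delta>0 L l (\<lambda>t. A t * \<omega> L)"
  proof unfold_locales
    show "mono (\<lambda>t. A t * \<omega> L)" using A(1) nonneg[of L] assms by (auto simp: mono_def intro: mult_right_mono)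
    fix n j :: nat assume "j < 2^n"
    from A(4)[OF this] obtain x where "x \<ge> 0" "x + l n \<le> l 0" "A x = real j / 2^n" "A (x + l n) = real (Suc j) / 2^n"
      by blast
    then show "\<exists>x\<ge>0. x + l n \<le> L \<and> A x * \<omega> L = real j / 2 ^ n * \<omega> L \<and> A (x + l n) * \<omega> L = real (Suc j) / 2 ^ n * \<omega> L"
      using l by (intro exI[of _ x]) auto
  qed (use l A assms in auto)
  then show thesis by (rule that)
qed

context staircase
begin

lemma \<omega>L: "0 < \<omega> L" using pos L by simp

lemma A_ge: "0 \<le> A t"
  using monoD[OF A_mono, of "min t 0" t] A_left[of "min t 0"] by simp

lemma A_le: "A t \<le> \<omega> L"
  using monoD[OF A_mono, of t "max t L"] A_right[of "max t L"] by simp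

lemma l_le: "l n \<le> L / 2^n"
proof (induction n)
  case (Suc n)
  have "l (Suc n) \<le> l n / 2" using l_Suc[of n] by simp
  also have "\<dots> \<le> L / 2^n / 2" using Suc by simp
  finally show ?case by simp
qed (simp add: l_0)

text \<open>If \<open>A s\<close> lies in the value range of step \<open>j\<close>, then step
  \<open>j + 1\<close> starts to the right of \<open>s\<close> and takes length \<open>l n\<close>,
  so \<open>t\<close> cannot pass its end.\<close>

lemma A_step: assumes "t - s \<le> l n" shows "A t - A s \<le> 2 * (\<omega> L / 2^n)"
proof -
  define h where "h = \<omega> L / 2^n"
  have h: "0 < h" "2^n * h = \<omega> L" using \<omega>L by (auto simp: h_def)
  define j where "j = nat \<lfloor>A s / h\<rfloor>"
  have j1: "real j * h \<le> A s" "A s < real (Suc j) * h"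
  proof -
    have "0 \<le> A s / h" using A_ge h by simp
    then have "real j \<le> A s / h" "A s / h < real j + 1" by (auto simp: j_def)
    then show "real j * h \<le> A s" "A s < real (Suc j) * h" using h by (auto simp: field_simps)
  qed
  have "A t \<le> real (Suc (Suc j)) * h"
  proof (cases "Suc j < 2^n")
    case False
    then have "2^n \<le> real (Suc j)" by (metis of_nat_le_iff of_nat_numeral of_nat_power not_less)
    then have "2^n * h \<le> real (Suc j) * h" using h by (intro mult_right_mono) auto
    then show ?thesis using A_le[of t] h by (simp add: algebra_simps)
  next
    case True
    obtain x where x: "A x = real (Suc j) * h" "A (x + l n) = real (Suc (Suc j)) * h"
      using steps[OF True] by (auto simp: h_def)
    have "s < x" using x j1 monoD[OF A_mono, of x s] by (metis linorder_not_le)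
    then have "t \<le> x + l n" using assms by simp
    then show ?thesis using x monoD[OF A_mono, of t "x + l n"] by simp
  qed
  also have "\<dots> = real j * h + 2 * h" by (simp add: algebra_simps)
  finally show ?thesis using j1 unfolding h_def by linarith
qed

lemma level_below: assumes "0 < d" "d < L" obtains n where "l (Suc n) \<le> d" "d < l n"
proof -
  obtain m where "(1/2)^m < d / L" using real_arch_pow_inv[of "d/L" "1/2"] assms by auto
  then have "L / 2^m < d" using assms by (simp add: field_simps)
  then have ex: "l m \<le> d" using l_le[of m] by simp
  define N where "N = (LEAST n. l n \<le> d)"
  have N: "l N \<le> d" unfolding N_def by (rule LeastI[of _ m]) (rule ex)
  then obtain n where n: "N = Suc n" using l_0 assms by (cases N) auto
  then have "\<not> l n \<le> d" using not_less_Least[of n "\<lambda>n. l n \<le> d"] N_def by simp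
  with N n that show thesis by simp
qed

text \<open>For \<open>l (Suc n) \<le> t - s < l n\<close>, two steps of height
  \<open>\<omega> L / 2^n\<close> amount to \<open>4 * \<omega> (l (Suc n))\<close>; the lengths
  were tied to \<omega> for this purpose.\<close>

lemma A_modulus: "\<bar>A t - A s\<bar> \<le> 4 * \<omega> \<bar>t - s\<bar>"
proof -
  have *: "A t - A s \<le> 4 * \<omega> (t - s)" if st: "s < t" for s t
  proof (cases "t - s < L")
    case True
    then obtain n where n: "l (Suc n) \<le> t - s" "t - s < l n" using level_below[of "t - s"] st by auto
    have "A t - A s \<le> 4 * \<omega> (l (Suc n))" using A_step[of t s n] n \<omega>_l[of "Suc n"] by simp
    also have "\<dots> \<le> 4 * \<omega> (t - s)" using n l_pos[of "Suc n"] by (intro mult_left_mono le) auto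
    finally show ?thesis .
  next
    case False
    have "A t - A s \<le> \<omega> L" using A_le[of t] A_ge[of s] by simp
    also have "\<dots> \<le> \<omega> (t - s)" using False L by (intro le) auto
    finally show ?thesis using nonneg[of "t - s"] st by simp
  qed
  show ?thesis
    using *[of s t] *[of t s] monoD[OF A_mono, of s t] monoD[OF A_mono, of t s] zero
    by (cases s t rule: linorder_cases) simp_all
qed

lemma A_cont: "continuous_on X A"
  by (rule continuous_on_modulus[OF A_modulus])

text \<open>Without a plateau \<open>A\<close> would be strictly increasing between \<open>s\<close>
  and \<open>t\<close>, and intermediate values would have unique preimages. The ends of a step and
  of its two half-steps would then coincide, forcing \<open>l n = 2 * l (Suc n)\<close>.\<close>

lemma A_plateau:
  assumes "s < t" shows "\<exists>p q. s \<le> p \<and> p < q \<and> q \<le> t \<and> (\<forall>x\<in>{p..q}. A x = A p)"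
proof (rule ccontr)
  assume neg: "\<not> ?thesis"
  have less: "A p < A q" if "s \<le> p" "p < q" "q \<le> t" for p q
  proof (rule ccontr)
    assume "\<not> A p < A q"
    then have "A x = A p" if "x \<in> {p..q}" for x
      using that monoD[OF A_mono, of p x] monoD[OF A_mono, of x q] by auto
    with neg that show False by blast
  qed
  have inj: "p = q" if "A s < A p" "A p < A t" "A p = A q" for p q
  proof -
    have "s < p" "s < q" using that monoD[OF A_mono, of p s] monoD[OF A_mono, of q s] by (metis linorder_not_le)+
    moreover have "p < t" "q < t" using that monoD[OF A_mono, of t p] monoD[OF A_mono, of t q] by (metis linorder_not_le)+
    ultimately show ?thesis using less[of p q] less[of q p] that by (cases p q rule: linorder_cases) auto
  qed
  have st: "A s < A t" using less[of s t] assms by simp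
  obtain n where "(1/2)^n < (A t - A s) / (2 * \<omega> L)"
    using real_arch_pow_inv[of "(A t - A s) / (2 * \<omega> L)" "1/2"] st \<omega>L by auto
  \<comment> \<open>Two step heights fit between \<open>A s\<close> and \<open>A t\<close>, so the
    step \<open>j\<close> that begins next above \<open>A s\<close> also ends below
    \<open>A t\<close>.\<close>
  then have n: "2 * (\<omega> L / 2^n) < A t - A s" using \<omega>L by (simp add: field_simps)
  define h where "h = \<omega> L / 2^n"
  have h: "0 < h" "2^n * h = \<omega> L" using \<omega>L by (auto simp: h_def)
  define j where "j = nat (\<lfloor>A s / h\<rfloor> + 1)"
  have j: "A s < real j * h" "real j * h \<le> A s + h"
  proof -
    have "0 \<le> A s / h" using A_ge h by simp
    then have "A s / h < real j" "real j \<le> A s / h + 1" by (auto simp: j_def)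
    then show "A s < real j * h" "real j * h \<le> A s + h" using h by (auto simp: field_simps)
  qed
  have j': "real (Suc j) * h < A t" using j(2) n unfolding h_def[symmetric] by (simp add: algebra_simps)
  then have "real (Suc j) * h < 2^n * h" using A_le[of t] h(2) by linarith
  then have "real (Suc j) < 2^n" using h(1) by (rule mult_right_less_imp_less[OF _ less_imp_le])
  then have jn: "j < 2^n" by (metis Suc_lessD of_nat_less_iff of_nat_numeral of_nat_power)
  obtain x where x: "A x = real j * h" "A (x + l n) = real (Suc j) * h"
    using steps[OF jn] by (auto simp: h_def)
  obtain x' where x': "A x' = real j * h" "A (x' + l (Suc n)) = real (Suc (2*j)) * (h/2)"
    using steps[of "2*j" "Suc n"] jn by (auto simp: h_def)
  obtain x'' where x'': "A x'' = real (Suc (2*j)) * (h/2)" "A (x'' + l (Suc n)) = real (Suc j) * h"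
    using steps[of "Suc (2*j)" "Suc n"] jn by (auto simp: h_def field_simps)
  have mid: "A s < real (Suc (2*j)) * (h/2)" "real (Suc (2*j)) * (h/2) < A t" "real j * h < A t"
    "A s < real (Suc j) * h"
  proof -
    have m: "real (Suc (2*j)) * (h/2) = real j * h + h/2" "real (Suc j) * h = real j * h + h"
      by (simp_all add: algebra_simps)
    show "A s < real (Suc (2*j)) * (h/2)" "real (Suc (2*j)) * (h/2) < A t" "real j * h < A t"
      "A s < real (Suc j) * h" unfolding m using j(1) j'[unfolded m] h(1) by linarith+
  qed
  have "x = x'" by (rule inj; unfold x x'; (rule refl | fact j mid))
  moreover have "x + l n = x'' + l (Suc n)" by (rule inj; unfold x x''; (rule refl | fact j' mid))
  moreover have "x' + l (Suc n) = x''" by (rule inj; unfold x' x''; (rule refl | fact mid))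
  ultimately show False using l_Suc[of n] by simp
qed

end

subsection \<open>Bumps\<close>

lemma norm_cis_minus_one: "norm (cis x - 1) \<le> \<bar>x\<bar>"
  using dist_exp_i_1[of x] abs_sin_x_le_abs_x[of "x/2"] by (simp add: cis_conv_exp)

lemma antiderivative_exists:
  fixes f :: "real \<Rightarrow> real"
  assumes "continuous_on UNIV f"
  obtains F where "\<And>t. (F has_real_derivative f t) (at t)" "F 0 = 0"
proof -
  have "\<exists>F. \<forall>x::real. -\<infinity> < ereal x \<longrightarrow> ereal x < \<infinity> \<longrightarrow> (F has_vector_derivative f x) (at x)"
    using assms by (intro einterval_antiderivative) (auto simp: continuous_on_eq_continuous_at)
  then obtain F where F: "\<And>x. (F has_real_derivative f x) (at x)"
    by (auto simp: has_real_derivative_iff_has_vector_derivative)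
  show thesis
    by (rule that[of "\<lambda>t. F t - F 0"]) (auto intro!: derivative_eq_intros F)
qed

lemma integral_three_shifts:
  fixes f :: "real \<Rightarrow> complex"
  assumes "continuous_on UNIV f" "0 \<le> L"
  shows "integral {0..3*L} f =
    integral {0..L} f + integral {0..L} (\<lambda>t. f (t + L)) + integral {0..L} (\<lambda>t. f (t + 2*L))"
proof -
  have i: "f integrable_on {a..b}" for a b
    using assms by (intro integrable_continuous_real continuous_on_subset[OF assms(1)]) auto
  have "integral {0..3*L} f = integral {0..2*L} f + integral {2*L..3*L} f"
    using assms(2) by (intro Henstock_Kurzweil_Integration.integral_combine[symmetric] i) auto
  also have "integral {0..2*L} f = integral {0..L} f + integral {L..2*L} f"
    using assms(2) by (intro Henstock_Kurzweil_Integration.integral_combine[symmetric] i) auto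
  also have "integral {L..2*L} f = integral {0..L} (\<lambda>t. f (t + L))"
    using integral_shift_real_ivl[of L L "2*L" f] by simp
  also have "integral {2*L..3*L} f = integral {0..L} (\<lambda>t. f (t + 2*L))"
    using integral_shift_real_ivl[of "2*L" "2*L" "3*L" f] by simp
  finally show ?thesis .
qed

context staircase
begin

definition F :: "real \<Rightarrow> real" where
  "F = (SOME F. (\<forall>t. (F has_real_derivative A t) (at t)) \<and> F 0 = 0)"

lemma F: "(F has_real_derivative A t) (at t)" and F_0: "F 0 = 0"
proof -
  obtain G where "\<And>t. (G has_real_derivative A t) (at t)" "G 0 = 0"
    using antiderivative_exists[OF A_cont[of UNIV]] by blast
  then have "\<exists>F. (\<forall>t. (F has_real_derivative A t) (at t)) \<and> F 0 = 0" by (intro exI[of _ G]) simp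
  then have "(\<forall>t. (F has_real_derivative A t) (at t)) \<and> F 0 = 0"
    unfolding F_def by (rule someI_ex)
  then show "(F has_real_derivative A t) (at t)" "F 0 = 0" by auto
qed

lemma F_within: "(F has_real_derivative A t) (at t within X)"
  using F by (rule has_field_derivative_at_within)

lemma F_shift: "((\<lambda>t. F (t + c)) has_real_derivative A (t + c)) (at t within X)"
  by (rule DERIV_chain'[where g = F, THEN DERIV_cong]) (auto intro!: derivative_eq_intros F)

lemma F_cont: "continuous_on X F"
  using F by (metis DERIV_isCont continuous_at_imp_continuous_on)

lemma A_integral: "s \<le> t \<Longrightarrow> (A has_integral F t - F s) {s..t}"
  by (intro fundamental_theorem_of_calculus)
    (auto simp flip: has_real_derivative_iff_has_vector_derivative intro: F_within)

lemma F_left: assumes "t \<le> 0" shows "F t = 0"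
proof -
  have "((\<lambda>_. 0) has_integral F 0 - F t) {t..0}"
    by (rule has_integral_eq[OF _ A_integral]) (use assms in \<open>auto simp: A_left\<close>)
  then show ?thesis using F_0 by (simp add: has_integral_iff)
qed

lemma F_right: assumes "L \<le> t" shows "F t = F L + \<omega> L * (t - L)"
proof -
  have "((\<lambda>_. \<omega> L) has_integral F t - F L) {L..t}"
    by (rule has_integral_eq[OF _ A_integral]) (use assms in \<open>auto simp: A_right\<close>)
  moreover have "((\<lambda>_. \<omega> L) has_integral (t - L) *\<^sub>R \<omega> L) {L..t}"
    using has_integral_const_real[of "\<omega> L" L t] assms by simp
  ultimately show ?thesis by (metis has_integral_unique add_diff_cancel_left' diff_add_cancel mult.commute real_scaleR_def add.commute)
qed

text \<open>A rise, a fall of twice the height and a rise. Since \<open>F\<close> is affine to the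
  right of \<open>L\<close>, the corresponding second difference of \<open>F\<close> vanishes beyond
  \<open>3*L\<close>, which is the zero mean of \<open>w\<close>. On each third, \<open>w\<close> is
  affine in one translate of \<open>A\<close>, as \<open>van_der_corput_moebius\<close>
  demands.\<close>

definition w :: "real \<Rightarrow> real" where "w t = A t - 2 * A (t - L) + A (t - 2*L)"

definition W :: "real \<Rightarrow> real" where "W t = F t - 2 * F (t - L) + F (t - 2*L)"

lemma W: "(W has_real_derivative w t) (at t within X)"
proof -
  have "((\<lambda>t. F t - 2 * F (t + - L) + F (t + - (2*L))) has_real_derivative
      A t - 2 * A (t + - L) + A (t + - (2*L))) (at t within X)"
    by (intro DERIV_add DERIV_diff DERIV_cmult F_within F_shift)
  then show ?thesis by (simp add: W_def[abs_def] w_def)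
qed

lemma W_cont: "continuous_on X W"
  by (rule DERIV_continuous_on) (rule W)

lemma w_modulus: "\<bar>w t - w s\<bar> \<le> 16 * \<omega> \<bar>t - s\<bar>"
proof -
  have e: "t - L - (s - L) = t - s" "t - 2*L - (s - 2*L) = t - s" by simp_all
  show ?thesis
    using A_modulus[of t s] A_modulus[of "t - L" "s - L", unfolded e] A_modulus[of "t - 2*L" "s - 2*L", unfolded e]
    unfolding w_def by linarith
qed

lemma w_left: "t \<le> 0 \<Longrightarrow> w t = 0"
  using L by (simp add: w_def A_left)

lemma w_right: "3*L \<le> t \<Longrightarrow> w t = 0"
  using L by (simp add: w_def A_right)

lemma w_L: "w L = \<omega> L"
  using L by (simp add: w_def A_left A_right)

lemma w_piece0: "t \<le> L \<Longrightarrow> w t = A t"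
  using L by (simp add: w_def A_left)

lemma w_piece1: "t \<in> {0..L} \<Longrightarrow> w (t + L) = \<omega> L - 2 * A t"
  using L by (simp add: w_def A_left A_right)

lemma w_piece2: "t \<in> {0..L} \<Longrightarrow> w (t + 2*L) = A t - \<omega> L"
  using L A_right[of "t + L"] A_right[of "t + 2*L"] by (simp add: w_def algebra_simps)

lemma w_bound: "\<bar>w t\<bar> \<le> \<omega> L"
proof -
  consider "t \<le> 0" | "t \<in> {0..L}" | "t - L \<in> {0..L}" | "t - 2*L \<in> {0..L}" | "3*L \<le> t"
    by force
  then show ?thesis
  proof cases
    case 2 then show ?thesis using w_piece0[of t] A_le[of t] A_ge[of t] by simp
  next
    case 3 then show ?thesis using w_piece1[of "t - L"] A_le[of "t-L"] A_ge[of "t-L"] by (simp add: abs_le_iff)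
  next
    case 4 then show ?thesis using w_piece2[of "t - 2*L"] A_le[of "t-2*L"] A_ge[of "t-2*L"] by (simp add: abs_le_iff)
  qed (use w_left w_right \<omega>L in auto)
qed

lemma W_left: "t \<le> 0 \<Longrightarrow> W t = 0"
  using L by (simp add: W_def F_left)

lemma W_piece0: "t \<le> L \<Longrightarrow> W t = F t"
  using L by (simp add: W_def F_left)

lemma W_piece1: "t \<in> {0..L} \<Longrightarrow> W (t + L) = F L + \<omega> L * t - 2 * F t"
  using L F_right[of "t + L"] by (simp add: W_def F_left)

lemma W_piece2: "t \<in> {0..L} \<Longrightarrow> W (t + 2*L) = \<omega> L * L - F L - \<omega> L * t + F t"
  using L F_right[of "t + 2*L"] F_right[of "t + L"] by (simp add: W_def algebra_simps)

lemma W_right: "3*L \<le> t \<Longrightarrow> W t = 0"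
  using L F_right[of t] F_right[of "t - L"] F_right[of "t - 2*L"] by (simp add: W_def algebra_simps)

lemma W_bound: "\<bar>W t\<bar> \<le> 3 * L * \<omega> L"
proof -
  consider "t \<le> 0" | "3*L \<le> t" | "0 < t" "t < 3*L" by linarith
  then show ?thesis
  proof cases
    case 3
    obtain z where "0 < z" "z < t" "W t - W 0 = (t - 0) * w z"
      using MVT2[of 0 t W w] 3 W[where X = UNIV] by auto
    then have "\<bar>W t\<bar> = t * \<bar>w z\<bar>" using W_left[of 0] 3 by (simp add: abs_mult)
    also have "\<dots> \<le> 3 * L * \<omega> L" using 3 w_bound[of z] by (intro mult_mono) auto
    finally show ?thesis .
  qed (use W_left W_right L \<omega>L in auto)
qed

text \<open>Plateaus of the three translates of \<open>A\<close> are found one inside the other,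
  which is possible because every interval contains one.\<close>

lemma w_plateau:
  assumes "s < t" shows "\<exists>p q. s \<le> p \<and> p < q \<and> q \<le> t \<and> (\<forall>x\<in>{p..q}. w x = w p)"
proof -
  obtain p q where 1: "s \<le> p" "p < q" "q \<le> t" "\<forall>x\<in>{p..q}. A x = A p"
    using A_plateau[OF assms] by blast
  then have "p - L < q - L" by simp
  from A_plateau[OF this] obtain p' q' where 2: "p - L \<le> p'" "p' < q'" "q' \<le> q - L" "\<forall>x\<in>{p'..q'}. A x = A p'"
    by blast
  then have "p' - L < q' - L" by simp
  from A_plateau[OF this] obtain p'' q'' where 3: "p' - L \<le> p''" "p'' < q''" "q'' \<le> q' - L" "\<forall>x\<in>{p''..q''}. A x = A p''"
    by blast
  have "w x = w (p'' + 2*L)" if "x \<in> {p''+2*L..q''+2*L}" for x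
  proof -
    have "x \<in> {p..q}" "p'' + 2*L \<in> {p..q}" "x - L \<in> {p'..q'}" "p'' + 2*L - L \<in> {p'..q'}"
        "x - 2*L \<in> {p''..q''}"
      using 1(1-3) 2(1-3) 3(1-3) that unfolding atLeastAtMost_iff by linarith+
    then have "A x = A p" "A (p'' + 2*L) = A p" "A (x - L) = A p'" "A (p'' + 2*L - L) = A p'"
        "A (x - 2*L) = A p''"
      using 1(4) 2(4) 3(4) by blast+
    then show ?thesis by (simp add: w_def)
  qed
  moreover have "s \<le> p'' + 2*L" "p'' + 2*L < q'' + 2*L" "q'' + 2*L \<le> t"
    using 1(1-3) 2(1-3) 3(1-3) by linarith+
  ultimately show ?thesis by blast
qed

text \<open>The phase derivative \<open>c * A t + d\<close> is monotone and at the ends of steps it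
  avoids the band from \<open>-1/r\<close> to \<open>1/r\<close>. It can cross the band only within
  one step, of length \<open>l n \<le> r\<close>, where the trivial bound \<open>r\<close> is used;
  van der Corput gives \<open>8 * r\<close> on either side, in total \<open>17 * r\<close>.\<close>

lemma piece_bound:
  assumes r: "0 < r" "l n \<le> r"
    and good: "\<And>j. j \<le> 2^n \<Longrightarrow> 1/r < \<bar>c * (real j / 2^n * \<omega> L) + d\<bar>"
  shows "norm (integral {0..L} (\<lambda>t. cis (c * F t + d * t + e))) \<le> 17 * r"
proof -
  have *: "norm (integral {0..L} (\<lambda>t. cis (c * F t + d * t + e))) \<le> 17 * r"
    if c: "0 \<le> c" and good: "\<And>j. j \<le> 2^n \<Longrightarrow> 1/r < \<bar>c * (real j / 2^n * \<omega> L) + d\<bar>" for c d e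
  proof -
    let ?f = "\<lambda>t. cis (c * F t + d * t + e)"
    define P where "P j = c * (real j / 2^n * \<omega> L) + d" for j
    have P0: "P 0 = d" and P1: "P (2^n) = c * \<omega> L + d" by (auto simp: P_def)
    have cont: "continuous_on X ?f" for X by (intro continuous_intros F_cont)
    have vc: "norm (integral {s..t} ?f) \<le> 8 * r"
      if "s \<le> t" "(\<forall>x\<in>{s..t}. 1/r \<le> c * A x + d) \<or> (\<forall>x\<in>{s..t}. c * A x + d \<le> -(1/r))" for s t
    proof -
      have d: "((\<lambda>t. c * F t + d * t + e) has_real_derivative c * A x + d) (at x within {s..t})" for x
        by (rule derivative_eq_intros F_within refl | simp)+
      have "norm (integral {s..t} (\<lambda>t. of_real (0 * A t + 1) * ?f t)) \<le> 8 * (1 / (1/r))"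
        by (rule van_der_corput_moebius[OF that(1) _ _ _ that(2)])
          (use r in \<open>auto intro: mono_imp_mono_on A_mono d\<close>)
      then show ?thesis by simp
    qed
    have incr: "c * A s + d \<le> c * A t + d" if "s \<le> t" for s t
      using c monoD[OF A_mono that] by (auto intro: mult_left_mono)
    have lo: "P 0 \<le> c * A t + d" and hi: "c * A t + d \<le> P (2^n)" for t
      using A_ge[of t] A_le[of t] c by (auto simp: P0 P1 intro: mult_left_mono)
    consider "1/r < P 0" | "P (2^n) < -(1/r)" | "P 0 < -(1/r)" "1/r < P (2^n)"
      using good[of 0] good[of "2^n"] unfolding P_def by force
    then show ?thesis
    proof cases
      case 1
      then have "norm (integral {0..L} ?f) \<le> 8 * r" using L lo by (intro vc disjI1 ballI) (auto intro: order_trans less_imp_le)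
      then show ?thesis using r by simp
    next
      case 2
      then have "norm (integral {0..L} ?f) \<le> 8 * r" using L hi by (intro vc disjI2 ballI) (auto intro: order_trans less_imp_le)
      then show ?thesis using r by simp
    next
      case 3
      \<comment> \<open>This is the first index above the band. By minimality and
        \<open>good\<close> its predecessor is below the band, so the crossing happens on the step
        between them.\<close>
      define k where "k = (LEAST k. 1/r < P k)"
      have k: "1/r < P k" "k \<le> 2^n" unfolding k_def
        by (rule LeastI[of "\<lambda>k. 1/r < P k", OF 3(2)], rule Least_le[of "\<lambda>k. 1/r < P k", OF 3(2)])
      have "k \<noteq> 0" using k 3 r by (metis less_asym neg_less_0_iff_less zero_less_divide_1_iff less_trans)
      then obtain j where j: "k = Suc j" by (cases k) auto
      have "\<not> 1/r < P j" using not_less_Least[of j "\<lambda>k. 1/r < P k"] j k_def by simp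
      then have Pj: "P j < -(1/r)" using good[of j] k j by (auto simp: P_def abs_if split: if_splits)
      have "j < 2^n" using k j by simp
      from steps[OF this] obtain x where x: "0 \<le> x" "x + l n \<le> L" "A x = real j / 2 ^ n * \<omega> L"
        "A (x + l n) = real (Suc j) / 2 ^ n * \<omega> L" by blast
      have x': "c * A x + d \<le> -(1/r)" "1/r \<le> c * A (x + l n) + d"
        using Pj k unfolding j P_def x(3,4) by simp_all
      have i1: "norm (integral {0..x} ?f) \<le> 8 * r" 
        by (rule vc[OF x(1)], intro disjI2 ballI, rule order_trans[OF incr x'(1)]) simp
      have i3: "norm (integral {x+l n..L} ?f) \<le> 8 * r" 
        by (rule vc[OF x(2)], intro disjI1 ballI, rule order_trans[OF x'(2) incr]) simp
      have xl: "x \<le> x + l n" using l_pos[of n] by simp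
      have i2: "norm (integral {x..x+l n} ?f) \<le> 1 * (x + l n - x)"
        by (rule integral_bound[OF xl cont]) (simp only: norm_cis order_refl)
      have "integral {0..L} ?f = integral {0..x+l n} ?f + integral {x+l n..L} ?f"
        by (rule Henstock_Kurzweil_Integration.integral_combine[symmetric])
          (use x(1,2) xl in \<open>auto intro!: integrable_continuous_real cont\<close>)
      also have "integral {0..x+l n} ?f = integral {0..x} ?f + integral {x..x+l n} ?f"
        by (rule Henstock_Kurzweil_Integration.integral_combine[symmetric])
          (use x(1,2) xl in \<open>auto intro!: integrable_continuous_real cont\<close>)
      finally have "norm (integral {0..L} ?f) \<le>
          norm (integral {0..x} ?f) + norm (integral {x..x+l n} ?f) + norm (integral {x+l n..L} ?f)"
        by (simp only:) (intro order_trans[OF norm_triangle_ineq] add_right_mono norm_triangle_ineq)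
      also have "\<dots> \<le> 8 * r + r + 8 * r"
        by (intro add_mono i1 i3) (use i2 r in simp)
      finally show ?thesis by simp
    qed
  qed
  show ?thesis
  proof (cases "0 \<le> c")
    case True then show ?thesis using * good by blast
  next
    case False
    \<comment> \<open>For negative \<open>c\<close> the whole phase changes sign under conjugation,
      which preserves the norm.\<close>
    have ab: "\<bar>- c * x + - d\<bar> = \<bar>c * x + d\<bar>" for x by linarith
    have "norm (integral {0..L} (\<lambda>t. cis (- c * F t + - d * t + - e))) \<le> 17 * r"
      by (rule *) (use False in simp, simp only: ab good)
    moreover have "integral {0..L} (\<lambda>t. cis (- c * F t + - d * t + - e)) = cnj (integral {0..L} (\<lambda>t. cis (c * F t + d * t + e)))"
      unfolding Henstock_Kurzweil_Integration.integral_cnj cis_cnj by (simp add: algebra_simps)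
    ultimately show ?thesis by simp
  qed
qed

text \<open>The change in a Fourier integral caused by a bump of amplitude \<open>\<mu>\<close>;
  subtracting 1 confines it to the support. The frequency is real because the affine phase on a
  plateau shifts the integers.\<close>

definition bump_coeff :: "real \<Rightarrow> real \<Rightarrow> complex" where
  "bump_coeff \<mu> \<xi> = integral {0..3*L} (\<lambda>t. (cis (\<mu> * W t) - 1) * cis (- \<xi> * t))"

lemma bump_cont: "continuous_on X (\<lambda>t. (cis (\<mu> * W t) - 1) * cis (- \<xi> * t))"
  by (intro continuous_intros W_cont)

lemma bump_coeff_le_length: "norm (bump_coeff \<mu> \<xi>) \<le> 6 * L"
proof -
  have "norm (cis x - 1) \<le> 2" for x using norm_triangle_ineq4[of "cis x" 1] by simp
  then have "norm (bump_coeff \<mu> \<xi>) \<le> 2 * (3*L - 0)"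
    unfolding bump_coeff_def using L by (intro integral_bound bump_cont) (auto simp: norm_mult)
  then show ?thesis by simp
qed

lemma bump_coeff_le_small: "norm (bump_coeff \<mu> \<xi>) \<le> 9 * \<bar>\<mu>\<bar> * \<omega> L * L^2"
proof -
  have "norm (cis (\<mu> * W t) - 1) \<le> \<bar>\<mu>\<bar> * (3 * L * \<omega> L)" for t
    using W_bound[of t] by (intro order_trans[OF norm_cis_minus_one]) (auto simp: abs_mult intro: mult_left_mono)
  then have "norm (bump_coeff \<mu> \<xi>) \<le> \<bar>\<mu>\<bar> * (3 * L * \<omega> L) * (3*L - 0)"
    unfolding bump_coeff_def using L by (intro integral_bound bump_cont) (auto simp: norm_mult)
  then show ?thesis by (simp add: power2_eq_square mult_ac)
qed

text \<open>On the three pieces the phase derivative at the ends of steps is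
  \<open>\<mu> * \<omega> L * (i / 2^n) - \<xi>\<close> with \<open>i = j\<close>,
  \<open>i = 2^n - 2*j\<close> and \<open>i = j - 2^n\<close>, all in the range of the hypothesis.
  The pieces cost \<open>51 * r\<close>; the subtracted exponential costs \<open>8 * r\<close>,
  using \<open>i = 0\<close>.\<close>

lemma bump_coeff_good:
  assumes r: "0 < r" "l n \<le> r"
    and good: "\<And>i::int. \<bar>i\<bar> \<le> 2^n \<Longrightarrow> 1/r < \<bar>\<xi> - \<mu> * \<omega> L * (of_int i / 2^n)\<bar>"
  shows "norm (bump_coeff \<mu> \<xi>) \<le> 60 * r"
proof -
  have good': "1/r < \<bar>\<mu> * \<omega> L * (of_int i / 2^n) - \<xi>\<bar>" if "\<bar>i\<bar> \<le> 2^n" for i :: int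
    using good[OF that] by (simp add: abs_minus_commute)
  let ?f = "\<lambda>t. cis (\<mu> * W t - \<xi> * t)"
  have cont: "continuous_on X ?f" for X by (intro continuous_intros W_cont)
  have "norm (integral {0..L} ?f) \<le> 17 * r"
  proof -
    have "integral {0..L} ?f = integral {0..L} (\<lambda>t. cis (\<mu> * F t + (-\<xi>) * t + 0))"
      by (intro integral_cong) (simp add: W_piece0)
    also have "norm \<dots> \<le> 17 * r"
    proof (rule piece_bound[OF r])
      fix j :: nat assume "j \<le> 2^n"
      then have "\<bar>int j\<bar> \<le> 2^n" by (metis abs_of_nat of_nat_le_iff of_nat_numeral of_nat_power)
      from good'[OF this] show "1/r < \<bar>\<mu> * (real j / 2^n * \<omega> L) + - \<xi>\<bar>" by (simp add: mult_ac)
    qed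
    finally show ?thesis .
  qed
  moreover have "norm (integral {0..L} (\<lambda>t. ?f (t + L))) \<le> 17 * r"
  proof -
    have "integral {0..L} (\<lambda>t. ?f (t + L)) =
        integral {0..L} (\<lambda>t. cis ((-2*\<mu>) * F t + (\<mu> * \<omega> L - \<xi>) * t + (\<mu> * F L - \<xi> * L)))"
      by (intro integral_cong arg_cong[where f = cis], simp only: W_piece1) (simp add: algebra_simps)
    also have "norm \<dots> \<le> 17 * r"
    proof (rule piece_bound[OF r])
      fix j :: nat assume "j \<le> 2^n"
      then have "int j \<le> 2^n" by (metis of_nat_le_iff of_nat_numeral of_nat_power)
      then have "\<bar>2^n - 2 * int j\<bar> \<le> 2^n" using of_nat_0_le_iff[of j, where 'a=int] by linarith
      from good'[OF this] show "1/r < \<bar>(-2*\<mu>) * (real j / 2^n * \<omega> L) + (\<mu> * \<omega> L - \<xi>)\<bar>"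
        by (simp add: algebra_simps diff_divide_distrib)
    qed
    finally show ?thesis .
  qed
  moreover have "norm (integral {0..L} (\<lambda>t. ?f (t + 2*L))) \<le> 17 * r"
  proof -
    have "integral {0..L} (\<lambda>t. ?f (t + 2*L)) =
        integral {0..L} (\<lambda>t. cis (\<mu> * F t + (- \<mu> * \<omega> L - \<xi>) * t + (\<mu> * (\<omega> L * L - F L) - 2 * \<xi> * L)))"
      by (intro integral_cong arg_cong[where f = cis], simp only: W_piece2) (simp add: algebra_simps)
    also have "norm \<dots> \<le> 17 * r"
    proof (rule piece_bound[OF r])
      fix j :: nat assume "j \<le> 2^n"
      then have "int j \<le> 2^n" by (metis of_nat_le_iff of_nat_numeral of_nat_power)
      then have "\<bar>int j - 2^n\<bar> \<le> 2^n" using of_nat_0_le_iff[of j, where 'a=int] by linarith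
      from good'[OF this] show "1/r < \<bar>\<mu> * (real j / 2^n * \<omega> L) + (- \<mu> * \<omega> L - \<xi>)\<bar>"
        by (simp add: algebra_simps diff_divide_distrib)
    qed
    finally show ?thesis .
  qed
  moreover have "integral {0..3*L} ?f = integral {0..L} ?f + integral {0..L} (\<lambda>t. ?f (t + L)) + integral {0..L} (\<lambda>t. ?f (t + 2*L))"
    using L by (intro integral_three_shifts cont) simp
  ultimately have 1: "norm (integral {0..3*L} ?f) \<le> 51 * r"
    by (smt (verit) norm_triangle_ineq)
  have "1/r < \<bar>\<xi>\<bar>" using good[of 0] by simp
  have d: "((\<lambda>t. - (\<xi> * t)) has_real_derivative - \<xi>) (at x within X)" for x X
    by (auto intro!: derivative_eq_intros)
  from \<open>1/r < \<bar>\<xi>\<bar>\<close> have "1/r \<le> - \<xi> \<or> - \<xi> \<le> -(1/r)" by (auto simp: abs_if split: if_splits)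
  then have "norm (integral {0..3*L} (\<lambda>t. of_real (0 * A t + 1) * cis (- \<xi> * t))) \<le> 8 * (1 / (1/r))"
    using L r by (intro van_der_corput_moebius[where c = 0 and d = "-\<xi>"])
      (auto intro: mono_imp_mono_on A_mono d)
  then have 2: "norm (integral {0..3*L} (\<lambda>t. cis (- \<xi> * t))) \<le> 8 * r" by simp
  have "bump_coeff \<mu> \<xi> = integral {0..3*L} (\<lambda>t. ?f t - cis (- \<xi> * t))"
    unfolding bump_coeff_def by (simp add: algebra_simps cis_mult)
  also have "\<dots> = integral {0..3*L} ?f - integral {0..3*L} (\<lambda>t. cis (- \<xi> * t))"
    by (intro Henstock_Kurzweil_Integration.integral_diff integrable_continuous_real continuous_intros W_cont)
  finally have "norm (bump_coeff \<mu> \<xi>) \<le> 51 * r + 8 * r"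
    using 1 2 norm_triangle_ineq4 by (smt (verit))
  then show ?thesis using r by simp
qed

text \<open>The boundary terms vanish because \<open>W\<close> is 0 at both ends. This supplies the
  first of the two factors \<open>1/\<xi>\<close> in the tail estimate.\<close>

lemma bump_coeff_by_parts:
  "of_real \<xi> * bump_coeff \<mu> \<xi> = of_real \<mu> * integral {0..3*L} (\<lambda>t. of_real (w t) * cis (\<mu> * W t - \<xi> * t))"
proof -
  let ?g = "\<lambda>t. (cis (\<mu> * W t) - 1) * cis (- \<xi> * t)"
  let ?h = "\<lambda>t. of_real (w t) * cis (\<mu> * W t - \<xi> * t)"
  have wc: "continuous_on X w" for X by (rule continuous_on_modulus[OF w_modulus])
  have d: "(?g has_vector_derivative \<i> * (of_real \<mu> * ?h t - of_real \<xi> * ?g t)) (at t within {0..3*L})" for t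
  proof -
    have W': "(W has_derivative (\<lambda>h. h * w t)) (at t within {0..3*L})"
      using W[of t "{0..3*L}"] by (simp add: has_field_derivative_def mult.commute[of _ "w t"])
    have e: "cis (\<mu> * W t - \<xi> * t) = cis (\<mu> * W t) * cis (- \<xi> * t)" by (simp add: cis_mult)
    show ?thesis
      unfolding has_vector_derivative_def e
      by (rule derivative_eq_intros W' refl | simp)+
        (auto simp: fun_eq_iff scaleR_conv_of_real algebra_simps)
  qed
  have "((\<lambda>t. \<i> * (of_real \<mu> * ?h t - of_real \<xi> * ?g t)) has_integral ?g (3*L) - ?g 0) {0..3*L}"
    using L by (intro fundamental_theorem_of_calculus d) simp
  then have "((\<lambda>t. \<i> * (of_real \<mu> * ?h t - of_real \<xi> * ?g t)) has_integral 0) {0..3*L}"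
    by (simp add: W_left W_right)
  moreover have "((\<lambda>t. \<i> * (of_real \<mu> * ?h t - of_real \<xi> * ?g t)) has_integral
      \<i> * (of_real \<mu> * integral {0..3*L} ?h - of_real \<xi> * integral {0..3*L} ?g)) {0..3*L}"
    by (intro has_integral_mult_right has_integral_diff integrable_integral
        integrable_continuous_real continuous_intros W_cont wc)
  ultimately have "\<i> * (of_real \<mu> * integral {0..3*L} ?h - of_real \<xi> * integral {0..3*L} ?g) = 0"
    by (rule has_integral_unique[symmetric])
  then show ?thesis by (simp add: bump_coeff_def)
qed

text \<open>The frequency dominates, so the phase derivative \<open>\<mu> * w t - \<xi>\<close>
  keeps its sign and has modulus at least \<open>\<bar>\<xi>\<bar>/2\<close>; van der Corput then
  yields the second factor \<open>1/\<xi>\<close>. The constant is 3 pieces times 8 times 2.\<close>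

lemma bump_coeff_tail:
  assumes \<xi>: "2 * \<bar>\<mu>\<bar> * \<omega> L \<le> \<bar>\<xi>\<bar>" "\<xi> \<noteq> 0"
  shows "norm (bump_coeff \<mu> \<xi>) \<le> 48 * \<bar>\<mu>\<bar> * \<omega> L / \<xi>\<^sup>2"
proof -
  let ?h = "\<lambda>t. of_real (w t) * cis (\<mu> * W t - \<xi> * t)"
  let ?B = "8 * (\<omega> L / (\<bar>\<xi>\<bar>/2))"
  have wc: "continuous_on X w" for X by (rule continuous_on_modulus[OF w_modulus])
  have piece: "norm (integral {0..L} (\<lambda>t. of_real (w (t + s)) * cis (\<mu> * W (t + s) - \<xi> * (t + s)))) \<le> ?B"
    if pq: "\<And>t. t \<in> {0..L} \<Longrightarrow> w (t + s) = p * A t + q" for p q s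
  proof -
    have "\<bar>\<mu> * w t\<bar> \<le> \<bar>\<xi>\<bar>/2" for t
      using mult_left_mono[OF w_bound[of t], of "\<bar>\<mu>\<bar>"] \<xi>(1) by (simp add: abs_mult)
    then have "(\<forall>t. \<bar>\<xi>\<bar>/2 \<le> \<mu> * w t - \<xi>) \<or> (\<forall>t. \<mu> * w t - \<xi> \<le> - (\<bar>\<xi>\<bar>/2))"
      by (cases "\<xi> < 0") (smt (verit) field_sum_of_halves)+
    moreover have e: "\<mu> * p * A t + (\<mu> * q - \<xi>) = \<mu> * w (t + s) - \<xi>" if "t \<in> {0..L}" for t
      using pq[OF that] by (simp add: algebra_simps)
    ultimately have sgn: "(\<forall>t\<in>{0..L}. \<bar>\<xi>\<bar>/2 \<le> \<mu> * p * A t + (\<mu> * q - \<xi>)) \<or>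
        (\<forall>t\<in>{0..L}. \<mu> * p * A t + (\<mu> * q - \<xi>) \<le> - (\<bar>\<xi>\<bar>/2))"
      by (simp only: e cong: ball_cong) blast
    have "norm (integral {0..L} (\<lambda>t. of_real (p * A t + q) * cis (\<mu> * W (t + s) - \<xi> * (t + s)))) \<le> ?B"
    proof (rule van_der_corput_moebius[OF _ _ _ _ sgn])
      fix t assume t: "t \<in> {0..L}"
      have "((\<lambda>t. W (t + s)) has_real_derivative w (t + s)) (at t within {0..L})"
        by (rule DERIV_chain'[where g = W, THEN DERIV_cong]) (auto intro!: derivative_eq_intros W)
      then have "((\<lambda>t. \<mu> * W (t + s) - \<xi> * (t + s)) has_real_derivative \<mu> * w (t + s) - \<xi>) (at t within {0..L})"
        by (auto intro!: derivative_eq_intros)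
      then show "((\<lambda>t. \<mu> * W (t + s) - \<xi> * (t + s)) has_real_derivative \<mu> * p * A t + (\<mu> * q - \<xi>)) (at t within {0..L})"
        unfolding e[OF t] .
      show "\<bar>p * A t + q\<bar> \<le> \<omega> L" using w_bound[of "t + s"] pq[OF t] by simp
    qed (use L \<xi> in \<open>auto intro: mono_imp_mono_on A_mono\<close>)
    also have "integral {0..L} (\<lambda>t. of_real (p * A t + q) * cis (\<mu> * W (t + s) - \<xi> * (t + s))) =
        integral {0..L} (\<lambda>t. of_real (w (t + s)) * cis (\<mu> * W (t + s) - \<xi> * (t + s)))"
      by (intro integral_cong) (simp only: pq)
    finally show ?thesis .
  qed
  have eq: "integral {0..3*L} ?h = integral {0..L} ?h + integral {0..L} (\<lambda>t. ?h (t + L)) + integral {0..L} (\<lambda>t. ?h (t + 2*L))"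
    using L by (intro integral_three_shifts continuous_intros W_cont wc) simp
  have "norm (integral {0..3*L} ?h) \<le> norm (integral {0..L} ?h) + norm (integral {0..L} (\<lambda>t. ?h (t + L))) + norm (integral {0..L} (\<lambda>t. ?h (t + 2*L)))"
    unfolding eq by (intro order_trans[OF norm_triangle_ineq] add_right_mono norm_triangle_ineq)
  also have "\<dots> \<le> ?B + ?B + ?B"
  proof (intro add_mono)
    show "norm (integral {0..L} ?h) \<le> ?B" using piece[of 0 1 0] by (simp add: w_piece0)
    show "norm (integral {0..L} (\<lambda>t. ?h (t + L))) \<le> ?B" by (rule piece[of L "-2" "\<omega> L"]) (simp add: w_piece1)
    show "norm (integral {0..L} (\<lambda>t. ?h (t + 2*L))) \<le> ?B" by (rule piece[of "2*L" 1 "-\<omega> L"]) (simp add: w_piece2)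
  qed
  finally have I: "norm (integral {0..3*L} ?h) \<le> 48 * \<omega> L / \<bar>\<xi>\<bar>" by simp
  have "\<bar>\<xi>\<bar> * norm (bump_coeff \<mu> \<xi>) = \<bar>\<mu>\<bar> * norm (integral {0..3*L} ?h)"
    using arg_cong[OF bump_coeff_by_parts[of \<xi> \<mu>], of norm] by (simp add: norm_mult)
  also have "\<dots> \<le> \<bar>\<mu>\<bar> * (48 * \<omega> L / \<bar>\<xi>\<bar>)" by (intro mult_left_mono I) auto
  finally have "norm (bump_coeff \<mu> \<xi>) \<le> \<bar>\<mu>\<bar> * (48 * \<omega> L / \<bar>\<xi>\<bar>) / \<bar>\<xi>\<bar>"
    using \<xi>(2) by (subst pos_le_divide_eq) (auto simp only: mult.commute zero_less_abs_iff)
  also have "\<dots> = 48 * \<bar>\<mu>\<bar> * \<omega> L / \<xi>\<^sup>2"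
    by (subst power2_abs[of \<xi>, symmetric]) (simp add: power2_eq_square)
  finally show ?thesis .
qed

end

subsection \<open>Counting large coefficients\<close>

lemma card_int_near:
  fixes y h :: real
  assumes "0 \<le> h"
  shows "finite {k::int. \<bar>of_int k - y\<bar> \<le> h}" "real (card {k::int. \<bar>of_int k - y\<bar> \<le> h}) \<le> 2 * h + 1"
proof -
  have sub: "{k::int. \<bar>of_int k - y\<bar> \<le> h} \<subseteq> {\<lceil>y - h\<rceil>..\<lfloor>y + h\<rfloor>}"
    by (auto simp: abs_le_iff ceiling_le_iff le_floor_iff)
  then show "finite {k::int. \<bar>of_int k - y\<bar> \<le> h}" by (rule finite_subset) simp
  have "card {k::int. \<bar>of_int k - y\<bar> \<le> h} \<le> card {\<lceil>y - h\<rceil>..\<lfloor>y + h\<rfloor>}"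
    by (rule card_mono[OF _ sub]) simp
  then have "real (card {k::int. \<bar>of_int k - y\<bar> \<le> h}) \<le> real (nat (\<lfloor>y + h\<rfloor> - \<lceil>y - h\<rceil> + 1))" by simp
  also have "\<dots> \<le> 2 * h + 1"
  proof (cases "\<lfloor>y + h\<rfloor> - \<lceil>y - h\<rceil> + 1 \<ge> 0")
    case True
    then have "real (nat (\<lfloor>y + h\<rfloor> - \<lceil>y - h\<rceil> + 1)) = of_int \<lfloor>y + h\<rfloor> - of_int \<lceil>y - h\<rceil> + 1" by simp
    then show ?thesis using of_int_floor_le[of "y+h"] le_of_int_ceiling[of "y-h"] by linarith
  qed (use assms in simp)
  finally show "real (card {k::int. \<bar>of_int k - y\<bar> \<le> h}) \<le> 2 * h + 1" .
qed

text \<open>Telescoping through \<open>1/z^2 \<le> 2/z - 2/(z+1)\<close> for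
  \<open>z \<ge> 1\<close>, after \<open>T\<close> has been enlarged to a run of consecutive
  integers from the least admissible one.\<close>

lemma sum_inverse_squares_upper:
  fixes \<theta> :: real
  assumes X: "1 \<le> X" and T: "finite T" "\<And>k::int. k \<in> T \<Longrightarrow> X \<le> of_int k + \<theta>"
  shows "(\<Sum>k\<in>T. 1 / (of_int k + \<theta>)\<^sup>2) \<le> 2 / X"
proof -
  define y where "y = of_int \<lceil>X - \<theta>\<rceil> + \<theta>"
  have y: "X \<le> y" unfolding y_def using le_of_int_ceiling[of "X - \<theta>"] by linarith
  have *: "(\<Sum>i<n. 1 / (y + real i)\<^sup>2) \<le> 2 / y - 2 / (y + real n)" for n
  proof (induction n)
    case (Suc n)
    define z where "z = y + real n"
    have z: "1 \<le> z" using X y by (simp add: z_def)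
    have "1 / z\<^sup>2 \<le> 2 / z - 2 / (z + 1)"
    proof -
      have "2 / z - 2 / (z + 1) = 2 / (z * (z + 1))" using z by (simp add: field_simps)
      moreover have "z * (z + 1) \<le> 2 * z\<^sup>2" using z by (simp add: power2_eq_square algebra_simps)
      then have "2 / (2 * z\<^sup>2) \<le> 2 / (z * (z + 1))" using z by (intro divide_left_mono) auto
      ultimately show ?thesis by simp
    qed
    with Suc show ?case by (simp add: z_def add_ac)
  qed simp
  obtain n where n: "T \<subseteq> (\<lambda>i. \<lceil>X - \<theta>\<rceil> + int i) ` {..<n}"
  proof -
    define M where "M = Max (insert 0 T)"
    have "k \<in> (\<lambda>i. \<lceil>X - \<theta>\<rceil> + int i) ` {..<Suc (nat (M - \<lceil>X - \<theta>\<rceil>))}" if "k \<in> T" for k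
    proof (rule image_eqI[of _ _ "nat (k - \<lceil>X - \<theta>\<rceil>)"])
      have "\<lceil>X - \<theta>\<rceil> \<le> k" using T(2)[OF that] by (simp add: ceiling_le_iff)
      moreover have "k \<le> M" unfolding M_def using that T(1) by simp
      ultimately show "k = \<lceil>X - \<theta>\<rceil> + int (nat (k - \<lceil>X - \<theta>\<rceil>))" "nat (k - \<lceil>X - \<theta>\<rceil>) \<in> {..<Suc (nat (M - \<lceil>X - \<theta>\<rceil>))}" by auto
    qed
    then show thesis using that by blast
  qed
  have "(\<Sum>k\<in>T. 1 / (of_int k + \<theta>)\<^sup>2) \<le> (\<Sum>k\<in>(\<lambda>i. \<lceil>X - \<theta>\<rceil> + int i) ` {..<n}. 1 / (of_int k + \<theta>)\<^sup>2)"
    using n by (intro sum_mono2) auto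
  also have "\<dots> = (\<Sum>i<n. 1 / (y + real i)\<^sup>2)"
    by (subst sum.reindex) (auto simp: inj_on_def y_def add_ac)
  also have "\<dots> \<le> 2 / y - 2 / (y + real n)" by (rule *)
  also have "\<dots> \<le> 2 / y" using X y by simp
  also have "\<dots> \<le> 2 / X" using X y by (intro divide_left_mono) auto
  finally show ?thesis .
qed

lemma sum_inverse_squares:
  fixes \<theta> :: real
  assumes X: "1 \<le> X" and T: "finite T" "\<And>k::int. k \<in> T \<Longrightarrow> X \<le> \<bar>of_int k + \<theta>\<bar>"
  shows "(\<Sum>k\<in>T. 1 / (of_int k + \<theta>)\<^sup>2) \<le> 4 / X"
proof -
  define P where "P = {k\<in>T. 0 \<le> of_int k + \<theta>}"
  define N where "N = {k\<in>T. \<not> 0 \<le> of_int k + \<theta>}"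
  have fin: "finite P" "finite N" "P \<inter> N = {}" "T = P \<union> N" using T(1) by (auto simp: P_def N_def)
  have "(\<Sum>k\<in>P. 1 / (of_int k + \<theta>)\<^sup>2) \<le> 2 / X"
  proof (rule sum_inverse_squares_upper[OF X fin(1)])
    fix k assume "k \<in> P"
    then show "X \<le> of_int k + \<theta>" using T(2)[of k] by (simp add: P_def)
  qed
  moreover have "(\<Sum>k\<in>N. 1 / (of_int k + \<theta>)\<^sup>2) = (\<Sum>k\<in>uminus ` N. 1 / (of_int k + - \<theta>)\<^sup>2)"
  proof -
    have "(of_int k + \<theta>)\<^sup>2 = (of_int (- k) + - \<theta>)\<^sup>2" for k :: int
      using power2_minus[of "of_int k + \<theta>"] by simp
    then show ?thesis by (subst sum.reindex) (auto simp: inj_on_def)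
  qed
  moreover have "(\<Sum>k\<in>uminus ` N. 1 / (of_int k + - \<theta>)\<^sup>2) \<le> 2 / X"
  proof (rule sum_inverse_squares_upper[OF X])
    fix k assume "k \<in> uminus ` N"
    then obtain j where "k = - j" "j \<in> N" by blast
    then show "X \<le> of_int k + - \<theta>" using T(2)[of j] by (simp add: N_def)
  qed (use fin in simp)
  ultimately show ?thesis
    using sum.union_disjoint[OF fin(1,2,3), of "\<lambda>k. 1 / (of_int k + \<theta>)\<^sup>2"] fin(4) by simp
qed

context staircase
begin

text \<open>By \<open>bump_coeff_good\<close> such a \<open>k\<close> lies within \<open>1/r\<close>
  of one of \<open>2 * 2^n + 1\<close> points, and at most \<open>3/r\<close> integers are that
  close to each. Since \<open>r\<close> is below the length of level \<open>n - 1\<close>,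
  \<open>\<omega> r\<close> is at most \<open>\<omega> L / 2^(n-1)\<close>, which turns the number
  of points into \<open>\<omega> L / \<omega> r\<close>.\<close>

lemma card_bump_coeff_large:
  assumes r: "0 < r" "r < L" and L1: "L \<le> 1"
  shows "finite {k::int. 60 * r < norm (bump_coeff \<mu> (of_int k + \<theta>))}"
    and "real (card {k::int. 60 * r < norm (bump_coeff \<mu> (of_int k + \<theta>))}) \<le> 18 * \<omega> L / chi r"
proof -
  obtain n' where n': "l (Suc n') \<le> r" "r < l n'" using level_below[OF r] .
  define n where "n = Suc n'"
  define B where "B = {k::int. 60 * r < norm (bump_coeff \<mu> (of_int k + \<theta>))}"
  define C where "C i = {k::int. \<bar>of_int k - (\<mu> * \<omega> L * (of_int i / 2^n) - \<theta>)\<bar> \<le> 1/r}" for i :: int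
  have B: "B \<subseteq> (\<Union>i\<in>{-(2^n)..2^n}. C i)"
  proof
    fix k assume "k \<in> B"
    then have "\<not> norm (bump_coeff \<mu> (of_int k + \<theta>)) \<le> 60 * r" by (simp add: B_def)
    then obtain i :: int where "\<bar>i\<bar> \<le> 2^n" "\<not> 1/r < \<bar>of_int k + \<theta> - \<mu> * \<omega> L * (of_int i / 2^n)\<bar>"
      using bump_coeff_good[OF r(1), of n "of_int k + \<theta>" \<mu>] n' n_def by blast
    then have "i \<in> {-(2^n)..2^n}" "k \<in> C i" by (auto simp: C_def algebra_simps abs_le_iff)
    then show "k \<in> (\<Union>i\<in>{-(2^n)..2^n}. C i)" by blast
  qed
  have finC: "finite (C i)" and cardC: "real (card (C i)) \<le> 3 / r" for i
  proof -
    show "finite (C i)" unfolding C_def using r by (intro card_int_near) auto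
    have "real (card (C i)) \<le> 2 * (1/r) + 1" unfolding C_def using r by (intro card_int_near) auto
    also have "\<dots> \<le> 3 / r" using r L1 by (simp add: field_simps)
    finally show "real (card (C i)) \<le> 3 / r" .
  qed
  show "finite {k::int. 60 * r < norm (bump_coeff \<mu> (of_int k + \<theta>))}"
    using finite_subset[OF B] finC unfolding B_def by blast
  have "card B \<le> card (\<Union>i\<in>{-(2^n)..2^n}. C i)" using finC by (intro card_mono B) auto
  also have "\<dots> \<le> (\<Sum>i\<in>{-(2^n)..2^n}. card (C i))" by (rule card_UN_le) simp
  finally have "real (card B) \<le> (\<Sum>i\<in>{-(2^n)..2^n::int}. real (card (C i)))" by (metis of_nat_le_iff of_nat_sum)
  also have "\<dots> \<le> (\<Sum>i\<in>{-(2^n)..2^n::int}. 3 / r)" by (intro sum_mono cardC)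
  also have "\<dots> = (2 * 2^n + 1) * (3 / r)" by (simp add: nat_add_distrib)
  also have "\<dots> \<le> (3 * 2^n) * (3 / r)" using r by (intro mult_right_mono) auto
  also have "\<dots> = 18 * 2^n' / r" by (simp add: n_def)
  also have "\<dots> \<le> 18 * (\<omega> L / \<omega> r) / r"
  proof -
    have "\<omega> r \<le> \<omega> L / 2^n'" using le[of r "l n'"] r n' \<omega>_l[of n'] by simp
    then have "2^n' \<le> \<omega> L / \<omega> r" using pos[OF r(1)] by (simp add: field_simps)
    then show ?thesis using r by (intro divide_right_mono mult_left_mono) auto
  qed
  also have "\<dots> = 18 * \<omega> L / chi r" by (simp add: chi_def)
  finally show "real (card {k::int. 60 * r < norm (bump_coeff \<mu> (of_int k + \<theta>))}) \<le> 18 * \<omega> L / chi r"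
    unfolding B_def .
qed

text \<open>The cutoff is the range of the phase derivative, enlarged by the bandwidth
  \<open>1/L\<close> of the interval. Writing \<open>X\<close> for it, \<open>D/X \<le> 1\<close>
  and \<open>D/X \<le> D * L\<close> produce the minimum; 9216 is \<open>4 * 48^2\<close>.\<close>

lemma bump_tail_sum:
  fixes \<mu> :: real
  defines "D \<equiv> \<bar>\<mu>\<bar> * \<omega> L"
  assumes p: "1 \<le> p" "p \<le> 2" and L1: "L \<le> 1"
    and T: "finite T" "\<And>k::int. k \<in> T \<Longrightarrow> 2 * D + 1/L \<le> \<bar>of_int k + \<theta>\<bar>"
  shows "(\<Sum>k\<in>T. norm (bump_coeff \<mu> (of_int k + \<theta>)) powr p) \<le> 9216 * (min 1 (D * L) * L powr (p - 1))"
proof -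
  define X where "X = 2 * D + 1/L"
  have D0: "0 \<le> D" using \<omega>L by (simp add: D_def)
  have XL: "1/L \<le> X" "2 * D \<le> X" using D0 L by (auto simp: X_def)
  have "1 \<le> 1/L" using L L1 by simp
  with XL have X1: "1 \<le> X" by linarith
  have each: "norm (bump_coeff \<mu> (of_int k + \<theta>)) powr p \<le> (48 * D / X\<^sup>2) powr p * X\<^sup>2 * (1 / (of_int k + \<theta>)\<^sup>2)"
    if "k \<in> T" for k
  proof -
    let ?x = "of_int k + \<theta>"
    have x: "X \<le> \<bar>?x\<bar>" using T(2)[OF that] by (simp add: X_def)
    then have "?x \<noteq> 0" using X1 by auto
    have "X\<^sup>2 \<le> \<bar>?x\<bar>\<^sup>2" using x X1 by (intro power_mono) auto
    then have x2: "X\<^sup>2 / ?x\<^sup>2 \<le> 1" "0 < ?x\<^sup>2" using \<open>?x \<noteq> 0\<close> by auto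
    have "norm (bump_coeff \<mu> ?x) \<le> 48 * D / ?x\<^sup>2"
      using bump_coeff_tail[of \<mu> ?x] \<open>?x \<noteq> 0\<close> x XL by (simp add: D_def)
    also have "\<dots> = (48 * D / X\<^sup>2) * (X\<^sup>2 / ?x\<^sup>2)" using X1 by simp
    finally have "norm (bump_coeff \<mu> ?x) powr p \<le> ((48 * D / X\<^sup>2) * (X\<^sup>2 / ?x\<^sup>2)) powr p"
      using p by (intro powr_mono2) auto
    also have "\<dots> = (48 * D / X\<^sup>2) powr p * (X\<^sup>2 / ?x\<^sup>2) powr p" by (rule powr_mult)
    also have "\<dots> \<le> (48 * D / X\<^sup>2) powr p * (X\<^sup>2 / ?x\<^sup>2)"
      using x2 p powr_mono'[of 1 p "X\<^sup>2 / ?x\<^sup>2"] X1 by (intro mult_left_mono) auto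
    finally show ?thesis by simp
  qed
  have "(\<Sum>k\<in>T. norm (bump_coeff \<mu> (of_int k + \<theta>)) powr p) \<le>
      (\<Sum>k\<in>T. (48 * D / X\<^sup>2) powr p * X\<^sup>2 * (1 / (of_int k + \<theta>)\<^sup>2))"
    by (intro sum_mono each)
  also have "\<dots> = (48 * D / X\<^sup>2) powr p * X\<^sup>2 * (\<Sum>k\<in>T. 1 / (of_int k + \<theta>)\<^sup>2)"
    by (simp add: sum_distrib_left)
  also have "\<dots> \<le> (48 * D / X\<^sup>2) powr p * X\<^sup>2 * (4 / X)"
    using T X1 by (intro mult_left_mono sum_inverse_squares) (auto simp: X_def)
  also have "(48 * D / X\<^sup>2) powr p = 48 powr p * (D / X) powr p * (1 / X) powr p"
    using D0 X1 by (simp add: power2_eq_square flip: powr_mult)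
  also have "48 powr p * (D / X) powr p * (1 / X) powr p * X\<^sup>2 * (4 / X) =
      4 * (48 powr p * ((D / X) powr p * (1 / X) powr (p - 1)))"
    using X1 by (simp add: powr_diff power2_eq_square)
  also have "\<dots> \<le> 4 * (48 powr 2 * (min 1 (D * L) * L powr (p - 1)))"
  proof (intro mult_left_mono mult_mono)
    have "D / X \<le> D / (1/L)" using XL D0 L X1 by (intro divide_left_mono) auto
    moreover have "D / X \<le> 1" using XL D0 X1 by simp
    ultimately have m: "D / X \<le> min 1 (D * L)" by simp
    have "(D / X) powr p \<le> (D / X) powr 1" using D0 X1 XL p by (intro powr_mono') auto
    then have "(D / X) powr p \<le> D / X" using D0 X1 by simp
    then show "(D / X) powr p \<le> min 1 (D * L)" using m by (rule order_trans)
    show "(48::real) powr p \<le> 48 powr 2" using p by (intro powr_mono) auto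
    show "(1 / X) powr (p - 1) \<le> L powr (p - 1)"
      using XL X1 L p by (intro powr_mono2) (auto simp: field_simps)
  qed (use p D0 L in auto)
  also have "\<dots> = 9216 * (min 1 (D * L) * L powr (p - 1))" by simp
  finally show ?thesis .
qed

text \<open>Here \<open>cis (\<mu> * W t) - 1\<close> is of order \<open>D * L\<close>, and the
  range contains at most \<open>7/L\<close> integers, so the trivial bound suffices; 567 is
  \<open>7 * 81\<close>.\<close>

lemma bump_near_sum_small:
  fixes \<mu> :: real
  defines "D \<equiv> \<bar>\<mu>\<bar> * \<omega> L"
  assumes p: "1 \<le> p" "p \<le> 2" and L1: "L \<le> 1" and DL: "D * L \<le> 1"
    and T: "finite T" "\<And>k::int. k \<in> T \<Longrightarrow> \<bar>of_int k + \<theta>\<bar> \<le> 2 * D + 1/L"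
  shows "(\<Sum>k\<in>T. norm (bump_coeff \<mu> (of_int k + \<theta>)) powr p) \<le> 567 * (D * L * L powr (p - 1))"
proof -
  have D0: "0 \<le> D" using \<omega>L by (simp add: D_def)
  have "D \<le> 1/L" using DL L by (simp add: field_simps)
  moreover have "1 \<le> 1/L" using L L1 by simp
  moreover have "real (card T) \<le> 2 * (2 * D + 1/L) + 1"
  proof -
    have sub: "T \<subseteq> {k. \<bar>of_int k - (- \<theta>)\<bar> \<le> 2 * D + 1/L}" using T by auto
    have "0 \<le> 2 * D + 1/L" using D0 L by simp
    note near = card_int_near[OF this, of "- \<theta>"]
    from card_mono[OF near(1) sub] near(2) show ?thesis by linarith
  qed
  ultimately have card: "real (card T) \<le> 7 / L" by simp
  have "(\<Sum>k\<in>T. norm (bump_coeff \<mu> (of_int k + \<theta>)) powr p) \<le> (\<Sum>k\<in>T. 81 * (D * L * L powr p))"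
  proof (rule sum_mono)
    fix k
    have "norm (bump_coeff \<mu> (of_int k + \<theta>)) \<le> 9 * (D * L) * L"
      using bump_coeff_le_small[of \<mu> "of_int k + \<theta>"] by (simp add: D_def power2_eq_square mult_ac)
    then have "norm (bump_coeff \<mu> (of_int k + \<theta>)) powr p \<le> (9 * (D * L) * L) powr p"
      using p by (intro powr_mono2) auto
    also have "\<dots> = 9 powr p * (D * L) powr p * L powr p" using D0 L by (simp add: powr_mult)
    also have "\<dots> \<le> 9 powr 2 * (D * L) powr 1 * L powr p"
      using p D0 L DL by (intro mult_right_mono mult_mono powr_mono powr_mono') auto
    also have "\<dots> = 81 * (D * L * L powr p)" using D0 L by simp
    finally show "norm (bump_coeff \<mu> (of_int k + \<theta>)) powr p \<le> 81 * (D * L * L powr p)" .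
  qed
  also have "\<dots> = real (card T) * (81 * (D * L * L powr p))" by simp
  also have "\<dots> \<le> 7 / L * (81 * (D * L * L powr p))" using card D0 L by (intro mult_right_mono) auto
  also have "\<dots> = 567 * (D * L * L powr (p - 1))" using L by (simp add: powr_diff)
  finally show ?thesis .
qed

text \<open>A discrete layer-cake estimate truncated at \<open>n\<close>. If \<open>c\<close>
  exceeds \<open>R (Suc n)\<close>, the old leading term \<open>R n powr p\<close> passes into the
  sum; otherwise \<open>R (Suc n) powr p\<close> suffices alone.\<close>

lemma threshold_bound:
  fixes c :: real and R :: "nat \<Rightarrow> real"
  assumes "0 \<le> c" "c \<le> R 0" "0 \<le> p" "\<And>i. 0 \<le> R i"
  shows "c powr p \<le> R n powr p + (\<Sum>i<n. if R (Suc i) < c then R i powr p else 0)"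
proof (induction n)
  case 0 then show ?case using assms by (simp add: powr_mono2)
next
  case (Suc n)
  show ?case
  proof (cases "R (Suc n) < c")
    case True
    have "0 \<le> R (Suc n) powr p" by simp
    with True Suc show ?thesis unfolding sum.lessThan_Suc by (simp only: if_True)
  next
    case False
    then have "c powr p \<le> R (Suc n) powr p" using assms by (intro powr_mono2) auto
    moreover have "0 \<le> (\<Sum>i<Suc n. if R (Suc i) < c then R i powr p else 0)" by (intro sum_nonneg) auto
    ultimately show ?thesis by linarith
  qed
qed

lemma bump_near_sum_large:
  fixes \<mu> :: real
  defines "D \<equiv> \<bar>\<mu>\<bar> * \<omega> L"
  assumes p: "1 \<le> p" "p \<le> 2" and L1: "L \<le> 1" "L \<le> \<rho> 0" and DL: "1 \<le> D * L"
    and \<mu>: "\<bar>\<mu>\<bar> \<le> 2^Suc n"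
    and T: "finite T" "\<And>k::int. k \<in> T \<Longrightarrow> \<bar>of_int k + \<theta>\<bar> \<le> 2 * D + 1/L"
  shows "(\<Sum>k\<in>T. norm (bump_coeff \<mu> (of_int k + \<theta>)) powr p) \<le> 180000 * (\<omega> L * S p n)"
proof -
  define c where "c k = norm (bump_coeff \<mu> (of_int k + \<theta>))" for k :: int
  \<comment> \<open>Capping at \<open>L\<close> makes the layers with
    \<open>\<rho> i \<ge> L\<close> empty, as every coefficient is at most \<open>6 * L\<close>; the
    counting lemma covers the thresholds below \<open>L\<close>.\<close>
  define R where "R i = 60 * min L (\<rho> i)" for i
  have D0: "0 \<le> D" using \<omega>L by (simp add: D_def)
  have R0: "0 \<le> R i" for i using L \<rho>_pos[of i] by (simp add: R_def)
  have c6: "c k \<le> 6 * L" for k unfolding c_def by (rule bump_coeff_le_length)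
  have cR: "c k \<le> R 0" for k using c6[of k] L L1 by (simp add: R_def)
  have Rp: "R i powr p \<le> 3600 * \<rho> i powr p" for i
  proof -
    have "R i powr p \<le> (60 * \<rho> i) powr p" using p R0[of i] by (intro powr_mono2) (auto simp: R_def)
    also have "\<dots> = 60 powr p * \<rho> i powr p" using \<rho>_pos[of i] by (simp add: powr_mult)
    also have "\<dots> \<le> 60 powr 2 * \<rho> i powr p" using p by (intro mult_right_mono powr_mono) auto
    finally show ?thesis by simp
  qed
  have count: "real (card {k\<in>T. R i < c k}) \<le> 18 * \<omega> L * 2^i" for i
  proof (cases "\<rho> i < L")
    case True
    then have Ri: "R i = 60 * \<rho> i" by (simp add: R_def)
    have "chi (\<rho> i) = 1 / 2^i" by (simp add: \<rho>_def)
    moreover have "card {k\<in>T. R i < c k} \<le> card {k::int. 60 * \<rho> i < norm (bump_coeff \<mu> (of_int k + \<theta>))}"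
      unfolding Ri c_def by (intro card_mono card_bump_coeff_large True L1 \<rho>_pos) auto
    ultimately show ?thesis
      using card_bump_coeff_large(2)[OF \<rho>_pos True L1(1), of \<mu> \<theta>] by simp
  next
    case False
    have "\<not> R i < c k" for k using c6[of k] L False by (simp add: R_def)
    then have eq: "{k\<in>T. R i < c k} = {}" by blast
    show ?thesis unfolding eq using \<omega>L by simp
  qed
  \<comment> \<open>Since \<open>1/L \<le> D\<close>, the whole range holds at most a multiple of
    \<open>2^n * \<omega> L\<close> integers. Charging \<open>R n powr p\<close> to each of them
    costs no more than the last term of \<open>S p n\<close>, so finer layers are avoided.\<close>
  have "D \<le> 2^Suc n * \<omega> L" unfolding D_def using \<mu> \<omega>L by (intro mult_right_mono) auto
  moreover have "1/L \<le> D" using DL L by (simp add: field_simps)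
  moreover have "1 \<le> 1/L" using L L1 by simp
  moreover have "real (card T) \<le> 2 * (2 * D + 1/L) + 1"
  proof -
    have sub: "T \<subseteq> {k. \<bar>of_int k - (- \<theta>)\<bar> \<le> 2 * D + 1/L}" using T by auto
    have "0 \<le> 2 * D + 1/L" using D0 L by simp
    note near = card_int_near[OF this, of "- \<theta>"]
    from card_mono[OF near(1) sub] near(2) show ?thesis by linarith
  qed
  ultimately have card: "real (card T) \<le> 14 * (2^n * \<omega> L)" by simp
  have 1: "(\<Sum>k\<in>T. R n powr p) \<le> 50400 * (\<omega> L * S p n)"
  proof -
    have "(\<Sum>k\<in>T. R n powr p) = real (card T) * R n powr p" by simp
    also have "\<dots> \<le> (14 * (2^n * \<omega> L)) * (3600 * \<rho> n powr p)" using card Rp by (intro mult_mono) auto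
    also have "\<dots> = 50400 * (\<omega> L * (2^n * \<rho> n powr p))" by simp
    also have "\<dots> \<le> 50400 * (\<omega> L * S p n)"
      unfolding S_def using \<omega>L by (intro mult_left_mono member_le_sum) auto
    finally show ?thesis .
  qed
  have 2: "(\<Sum>k\<in>T. \<Sum>i<n. if R (Suc i) < c k then R i powr p else 0) \<le> 129600 * (\<omega> L * S p n)"
  proof -
    have "(\<Sum>k\<in>T. \<Sum>i<n. if R (Suc i) < c k then R i powr p else 0) =
        (\<Sum>i<n. \<Sum>k\<in>T. if R (Suc i) < c k then R i powr p else 0)" by (rule sum.swap)
    also have "\<dots> = (\<Sum>i<n. real (card {k\<in>T. R (Suc i) < c k}) * R i powr p)"
      by (intro sum.cong refl) (simp add: sum.If_cases[OF T(1)] Int_def)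
    also have "\<dots> \<le> (\<Sum>i<n. (18 * \<omega> L * 2^Suc i) * (3600 * \<rho> i powr p))"
      using \<omega>L by (intro sum_mono mult_mono count Rp) auto
    also have "\<dots> = 129600 * (\<omega> L * (\<Sum>i<n. 2^i * \<rho> i powr p))"
      unfolding sum_distrib_left by (intro sum.cong refl) simp
    also have "\<dots> \<le> 129600 * (\<omega> L * S p n)"
      unfolding S_def using \<omega>L by (intro mult_left_mono sum_mono2) auto
    finally show ?thesis .
  qed
  have "(\<Sum>k\<in>T. c k powr p) \<le> (\<Sum>k\<in>T. R n powr p + (\<Sum>i<n. if R (Suc i) < c k then R i powr p else 0))"
    using p by (intro sum_mono threshold_bound cR R0) (auto simp: c_def)
  with 1 2 show ?thesis by (simp add: sum.distrib c_def)
qed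

lemma bump_sum:
  fixes \<mu> :: real
  assumes p: "1 \<le> p" "p \<le> 2" and L1: "L \<le> 1" "L \<le> \<rho> 0"
    and \<mu>: "\<bar>\<mu>\<bar> \<le> 2^Suc n" and T: "finite T"
  shows "(\<Sum>k\<in>T. norm (bump_coeff \<mu> (of_int k + \<theta>)) powr p) \<le>
    200000 * (min 1 (\<bar>\<mu>\<bar> * \<omega> L * L) * L powr (p - 1) + \<omega> L * S p n)"
proof -
  define D where "D = \<bar>\<mu>\<bar> * \<omega> L"
  let ?c = "\<lambda>k. norm (bump_coeff \<mu> (of_int k + \<theta>)) powr p"
  define N where "N = {k\<in>T. \<bar>of_int k + \<theta>\<bar> \<le> 2 * D + 1/L}"
  define M where "M = {k\<in>T. \<not> \<bar>of_int k + \<theta>\<bar> \<le> 2 * D + 1/L}"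
  have fin: "finite N" "finite M" "N \<inter> M = {}" "T = N \<union> M" using T by (auto simp: N_def M_def)
  have m0: "0 \<le> min 1 (D * L) * L powr (p - 1)" using \<omega>L L by (simp add: D_def)
  have s0: "0 \<le> \<omega> L * S p n" using \<omega>L S_nonneg by simp
  have "sum ?c M \<le> 9216 * (min 1 (D * L) * L powr (p - 1))"
    unfolding D_def by (rule bump_tail_sum[OF p L1(1) fin(2)]) (simp add: M_def D_def)
  moreover have "sum ?c N \<le> 567 * (min 1 (D * L) * L powr (p - 1)) + 180000 * (\<omega> L * S p n)"
  proof (cases "D * L \<le> 1")
    case True
    then have "sum ?c N \<le> 567 * (D * L * L powr (p - 1))"
      unfolding D_def by (intro bump_near_sum_small[OF p L1(1) _ fin(1)]) (simp_all add: N_def D_def)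
    with True s0 show ?thesis by simp
  next
    case False
    then have "sum ?c N \<le> 180000 * (\<omega> L * S p n)"
      by (intro bump_near_sum_large[OF p L1 _ \<mu> fin(1)]) (simp_all add: N_def D_def)
    with m0 show ?thesis by simp
  qed
  moreover have "sum ?c T = sum ?c N + sum ?c M"
    using sum.union_disjoint[OF fin(1,2,3), of ?c] fin(4) by simp
  ultimately have "sum ?c T \<le> 200000 * (min 1 (D * L) * L powr (p - 1) + \<omega> L * S p n)"
    using m0 s0 by (simp add: distrib_left)
  then show ?thesis by (simp add: D_def)
qed

end

subsection \<open>Superposition of bumps\<close>

context modulus
begin

text \<open>Hides the staircase and its lengths, so that bumps of different lengths can be chosen as
  plain functions. The last clause must hold for every amplitude and every shift, since both depend
  on \<open>\<lambda>\<close> in the superposition.\<close>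

definition bump :: "real \<Rightarrow> (real \<Rightarrow> real) \<Rightarrow> (real \<Rightarrow> real) \<Rightarrow> bool" where
  "bump L w W \<longleftrightarrow>
    (\<forall>t. (W has_real_derivative w t) (at t)) \<and>
    (\<forall>t. t \<le> 0 \<or> 3*L \<le> t \<longrightarrow> w t = 0 \<and> W t = 0) \<and>
    (\<forall>t. \<bar>w t\<bar> \<le> \<omega> L) \<and> w L = \<omega> L \<and> (\<forall>t. \<bar>W t\<bar> \<le> 3 * L * \<omega> L) \<and>
    (\<forall>s t. \<bar>w t - w s\<bar> \<le> 16 * \<omega> \<bar>t - s\<bar>) \<and>
    (\<forall>s t. s < t \<longrightarrow> (\<exists>p q. s \<le> p \<and> p < q \<and> q \<le> t \<and> (\<forall>x\<in>{p..q}. w x = w p))) \<and>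
    (\<forall>p \<mu> n T \<theta>. 1 \<le> p \<longrightarrow> p \<le> 2 \<longrightarrow> \<bar>\<mu>\<bar> \<le> 2^Suc n \<longrightarrow> finite T \<longrightarrow>
      (\<Sum>k\<in>T. norm (integral {0..3*L} (\<lambda>t. (cis (\<mu> * W t) - 1) * cis (- (of_int k + \<theta>) * t))) powr p)
        \<le> 200000 * (min 1 (\<bar>\<mu>\<bar> * \<omega> L * L) * L powr (p - 1) + \<omega> L * S p n))"

lemma bump_exists:
  assumes "0 < L" "L < \<delta>0" "L \<le> 1" "L \<le> \<rho> 0"
  shows "\<exists>w W. bump L w W"
proof -
  obtain l A where "staircase \<omega> \<delta>0 L l A" using staircase_exists[OF assms(1,2)] .
  then interpret staircase \<omega> \<delta>0 L l A .
  have "bump L w W"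
    unfolding bump_def
    using W w_left w_right W_left W_right w_bound w_L W_bound w_modulus w_plateau
      bump_sum[OF _ _ assms(3,4), unfolded bump_coeff_def]
    by blast
  then show ?thesis by blast
qed

end

text \<open>The decrease by 16 keeps later bumps from undoing the rise of an earlier one; the decay
  \<open>(1/8)^n\<close> outweighs the powers of \<open>2 powr (p - 1) \<le> 2\<close> lost when
  \<open>p\<close>-th powers are superposed.\<close>

locale bump_sequence = modulus +
  fixes L x :: "nat \<Rightarrow> real" and w W :: "nat \<Rightarrow> real \<Rightarrow> real"
  assumes L_pos: "\<And>n. 0 < L n"
    and bumps: "\<And>n. bump (L n) (w n) (W n)"
    and x_pos: "\<And>n. 0 < x n" and x_less: "\<And>n. x n + 3 * L n < 2*pi"
    and L_small: "\<And>n. L n \<le> (1/8)^n" and \<omega>L_small: "\<And>n. \<omega> (L n) \<le> (1/8)^n"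
    and \<omega>L_decr: "\<And>n. \<omega> (L (Suc n)) \<le> \<omega> (L n) / 16"
    and plateau: "\<And>n t. t \<in> {x n..x n + 3 * L n} \<Longrightarrow>
      (\<Sum>j<n. (1/2)^j * w j (t - x j)) = (\<Sum>j<n. (1/2)^j * w j (x n - x j))"
begin

lemma W_deriv: "(W n has_real_derivative w n t) (at t)"
  and w_out: "t \<le> 0 \<or> 3 * L n \<le> t \<Longrightarrow> w n t = 0"
  and W_out: "t \<le> 0 \<or> 3 * L n \<le> t \<Longrightarrow> W n t = 0"
  and w_bound: "\<bar>w n t\<bar> \<le> \<omega> (L n)"
  and w_L: "w n (L n) = \<omega> (L n)"
  and W_bound: "\<bar>W n t\<bar> \<le> 3 * L n * \<omega> (L n)"
  and w_modulus: "\<bar>w n t - w n s\<bar> \<le> 16 * \<omega> \<bar>t - s\<bar>"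
  using bumps[of n] unfolding bump_def by blast+

lemma bump_sum:
  "1 \<le> p \<Longrightarrow> p \<le> 2 \<Longrightarrow> \<bar>\<mu>\<bar> \<le> 2^Suc m \<Longrightarrow> finite T \<Longrightarrow>
      (\<Sum>k\<in>T. norm (integral {0..3*L n} (\<lambda>t. (cis (\<mu> * W n t) - 1) * cis (- (of_int k + \<theta>) * t))) powr p)
        \<le> 200000 * (min 1 (\<bar>\<mu>\<bar> * \<omega> (L n) * L n) * L n powr (p - 1) + \<omega> (L n) * S p m)"
  using bumps[of n] unfolding bump_def by blast

lemma \<omega>L: "0 < \<omega> (L n)" using pos L_pos by simp

text \<open>The modulus constant 16 of a bump does not improve as its length shrinks; the weight
  \<open>(1/2)^n\<close> makes these moduli summable.\<close>

definition g :: "nat \<Rightarrow> real \<Rightarrow> real" where "g n t = (1/2)^n * w n (t - x n)"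
definition f :: "nat \<Rightarrow> real \<Rightarrow> real" where "f n t = (1/2)^n * W n (t - x n)"
definition G :: "real \<Rightarrow> real" where "G t = (\<Sum>n. g n t)"
definition \<Phi> :: "real \<Rightarrow> real" where "\<Phi> t = (\<Sum>n. f n t)"

lemma f_deriv: "(f n has_real_derivative g n t) (at t within X)"
proof -
  have "((\<lambda>t. W n (t + - x n)) has_real_derivative w n (t + - x n)) (at t within X)"
    by (rule DERIV_chain'[where g = "W n", THEN DERIV_cong]) (auto intro!: derivative_eq_intros W_deriv)
  then show ?thesis unfolding f_def[abs_def] g_def by (auto intro!: derivative_eq_intros)
qed

lemma f_cont: "continuous_on X (f n)"
  by (rule DERIV_continuous_on) (rule f_deriv)

lemma g_bound: "\<bar>g n t\<bar> \<le> (1/2)^n * \<omega> (L n)"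
  using w_bound by (simp add: g_def abs_mult)

lemma g_bound': "\<bar>g n t\<bar> \<le> (1/8)^n"
proof -
  have "(1/2)^n * \<omega> (L n) \<le> 1 * (1/8)^n" using \<omega>L[of n] by (intro mult_mono \<omega>L_small power_le_one) auto
  then show ?thesis using g_bound[of n t] by simp
qed

lemma f_bound: "\<bar>f n t\<bar> \<le> 3 * (1/8)^n"
proof -
  have "\<bar>f n t\<bar> \<le> 1 * (3 * L n * \<omega> (L n))"
    unfolding f_def abs_mult by (intro mult_mono W_bound) (auto intro: power_le_one)
  also have "\<dots> \<le> 3 * (1/8)^n * 1"
    using L_small[of n] \<omega>L_small[of n] \<omega>L[of n] power_le_one[of "1/8::real" n] L_pos[of n]
    by (simp only: mult_1_left) (intro mult_mono, auto)
  finally show ?thesis by simp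
qed

lemma g_summable: "summable (\<lambda>n. g n t)"
  by (rule summable_comparison_test'[of "\<lambda>n. (1/8)^n" 0]) (use g_bound' in auto)

lemma f_summable: "summable (\<lambda>n. f n t)"
  by (rule summable_comparison_test'[of "\<lambda>n. 3 * (1/8)^n" 0]) (use f_bound in \<open>auto intro: summable_mult\<close>)

lemma \<Phi>_deriv: "(\<Phi> has_real_derivative G t) (at t)"
  unfolding \<Phi>_def[abs_def] G_def
proof (rule has_field_derivative_series'(2)[of UNIV _ _ 0])
  show "uniformly_convergent_on UNIV (\<lambda>n t. \<Sum>i<n. g i t)"
    by (rule Weierstrass_m_test'[of UNIV g "\<lambda>n. (1/8)^n"]) (use g_bound' in auto)
qed (auto simp: f_summable f_deriv)

lemma \<Phi>_cont: "continuous_on X \<Phi>"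
  using \<Phi>_deriv by (meson DERIV_continuous_on has_field_derivative_at_within)

lemma \<Phi>_out: assumes "t \<le> 0 \<or> 2*pi \<le> t" shows "\<Phi> t = 0"
proof -
  have "f n t = 0" for n
    using assms W_out[of "t - x n" n] x_pos[of n] x_less[of n] by (auto simp: f_def)
  then show ?thesis by (simp add: \<Phi>_def)
qed

lemma G_out: assumes "t \<le> 0 \<or> 2*pi \<le> t" shows "G t = 0"
proof -
  have "g n t = 0" for n
    using assms w_out[of "t - x n" n] x_pos[of n] x_less[of n] by (auto simp: g_def)
  then show ?thesis by (simp add: G_def)
qed

lemma G_modulus: "\<bar>G t - G s\<bar> \<le> 32 * \<omega> \<bar>t - s\<bar>"
proof -
  have each: "\<bar>g n t - g n s\<bar> \<le> 16 * \<omega> \<bar>t - s\<bar> * (1/2)^n" for n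
  proof -
    have "\<bar>g n t - g n s\<bar> = (1/2)^n * \<bar>w n (t - x n) - w n (s - x n)\<bar>"
      by (simp add: g_def abs_mult flip: right_diff_distrib)
    also have "\<dots> \<le> (1/2)^n * (16 * \<omega> \<bar>t - s\<bar>)"
      using w_modulus[of n "t - x n" "s - x n"] by (intro mult_left_mono) auto
    finally show ?thesis by (simp add: mult_ac)
  qed
  have sums: "(\<lambda>n. 16 * \<omega> \<bar>t - s\<bar> * (1/2)^n) sums (16 * \<omega> \<bar>t - s\<bar> * 2)"
    using geometric_sums[of "1/2::real"] by (intro sums_mult) simp
  have "G t - G s = (\<Sum>n. g n t - g n s)"
    unfolding G_def by (intro suminf_diff g_summable)
  also have "\<bar>\<dots>\<bar> \<le> (\<Sum>n. 16 * \<omega> \<bar>t - s\<bar> * (1/2)^n)"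
    using norm_suminf_le[of "\<lambda>n. g n t - g n s" "\<lambda>n. 16 * \<omega> \<bar>t - s\<bar> * (1/2)^n"] each sums
    by (simp add: sums_iff)
  also have "\<dots> = 32 * \<omega> \<bar>t - s\<bar>" using sums by (simp add: sums_iff)
  finally show ?thesis .
qed

text \<open>Consecutive bounds have ratio at most 1/32, relaxed to 1/8. A quarter of the height of
  bump \<open>n\<close> is small enough that the tails at two points together cannot cancel its
  rise.\<close>

lemma G_tail: "\<bar>G t - (\<Sum>j<Suc n. g j t)\<bar> \<le> (1/2)^n * \<omega> (L n) / 4"
proof -
  let ?a = "(1/2)^n * \<omega> (L n)"
  have \<omega>L': "(1/2)^(k + Suc n) * \<omega> (L (k + Suc n)) \<le> ?a * (1/8) * (1/8)^k" for k
  proof (induction k)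
    case 0
    show ?case using \<omega>L_decr[of n] \<omega>L[of n] by simp
  next
    case (Suc k)
    have "(1/2)^(Suc k + Suc n) * \<omega> (L (Suc k + Suc n)) \<le> (1/2)^(Suc k + Suc n) * (\<omega> (L (k + Suc n)) / 16)"
      using \<omega>L_decr[of "k + Suc n"] by (intro mult_left_mono) auto
    also have "\<dots> = ((1/2)^(k + Suc n) * \<omega> (L (k + Suc n))) / 32" by simp
    also have "\<dots> \<le> (?a * (1/8) * (1/8)^k) / 32" using Suc by (intro divide_right_mono) auto
    also have "\<dots> \<le> ?a * (1/8) * (1/8)^Suc k" using \<omega>L[of n] by simp
    finally show ?case .
  qed
  have sums: "(\<lambda>k. ?a * (1/8) * (1/8)^k) sums (?a * (1/8) * (8/7))"
    using geometric_sums[of "1/8::real"] by (intro sums_mult) simp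
  have "G t - (\<Sum>j<Suc n. g j t) = (\<Sum>k. g (k + Suc n) t)"
    unfolding G_def using suminf_split_initial_segment[OF g_summable, of t "Suc n"] by simp
  also have "\<bar>\<dots>\<bar> \<le> (\<Sum>k. ?a * (1/8) * (1/8)^k)"
    using norm_suminf_le[of "\<lambda>k. g (k + Suc n) t" "\<lambda>k. ?a * (1/8) * (1/8)^k"] sums
      order_trans[OF g_bound \<omega>L'] by (simp add: sums_iff)
  also have "\<dots> = ?a * (1/8) * (8/7)" using sums by (simp add: sums_iff)
  also have "\<dots> \<le> ?a / 4" using \<omega>L[of n] by simp
  finally show ?thesis .
qed

text \<open>Between these two points the earlier bumps are constant by \<open>plateau\<close>, bump
  \<open>n\<close> rises by its full height, and the later ones change the difference by at most
  half of that.\<close>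

lemma G_not_constant: "G (x n + L n) \<noteq> G (x n)"
proof -
  let ?a = "(1/2)^n * \<omega> (L n)"
  have "(\<Sum>j<n. g j (x n + L n)) = (\<Sum>j<n. g j (x n))"
    unfolding g_def using L_pos[of n] by (intro plateau) auto
  moreover have "g n (x n + L n) = ?a" "g n (x n) = 0" by (simp_all add: g_def w_L w_out)
  ultimately have d: "(\<Sum>j<Suc n. g j (x n + L n)) - (\<Sum>j<Suc n. g j (x n)) = ?a" by simp
  have "0 < ?a" using \<omega>L by simp
  with d G_tail[of "x n + L n" n] G_tail[of "x n" n] show ?thesis by linarith
qed

section \<open>Fourier coefficients of the partial phases\<close>

definition \<Phi>_part :: "nat \<Rightarrow> real \<Rightarrow> real" where "\<Phi>_part n t = (\<Sum>j<n. f j t)"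

definition exp_coeff :: "(real \<Rightarrow> real) \<Rightarrow> real \<Rightarrow> int \<Rightarrow> complex" where
  "exp_coeff u lam k = integral {0..2*pi} (\<lambda>t. cis (lam * u t) * cis (- of_int k * t))"

lemma \<Phi>_part_cont: "continuous_on X (\<Phi>_part n)"
  unfolding \<Phi>_part_def[abs_def] by (intro continuous_intros f_cont)

lemma \<Phi>_part_close: "\<bar>\<Phi> t - \<Phi>_part n t\<bar> \<le> 4 * (1/8)^n"
proof -
  have sums: "(\<lambda>k. 3 * (1/8)^n * (1/8)^k :: real) sums (3 * (1/8)^n * (8/7))"
    using geometric_sums[of "1/8::real"] by (intro sums_mult) simp
  have "\<Phi> t - \<Phi>_part n t = (\<Sum>k. f (k + n) t)"
    unfolding \<Phi>_def \<Phi>_part_def using suminf_split_initial_segment[OF f_summable, of t n] by simp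
  also have "\<bar>\<dots>\<bar> \<le> (\<Sum>k. 3 * (1/8)^n * (1/8)^k)"
    using norm_suminf_le[of "\<lambda>k. f (k + n) t" "\<lambda>k. 3 * (1/8)^n * (1/8)^k"] sums f_bound[of "_ + n" t]
    by (simp add: sums_iff power_add mult_ac)
  also have "\<dots> = 3 * (1/8)^n * (8/7)" using sums by (simp add: sums_iff)
  also have "\<dots> \<le> 4 * (1/8)^n" by simp
  finally show ?thesis .
qed

lemma exp_coeff_limit: "(\<lambda>n. exp_coeff (\<Phi>_part n) lam k) \<longlonglongrightarrow> exp_coeff \<Phi> lam k"
proof (rule LIM_zero_cancel, rule Lim_null_comparison)
  have "norm (exp_coeff (\<Phi>_part n) lam k - exp_coeff \<Phi> lam k) \<le> \<bar>lam\<bar> * (4 * (1/8)^n) * (2*pi)" for n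
  proof -
    have "exp_coeff (\<Phi>_part n) lam k - exp_coeff \<Phi> lam k =
        integral {0..2*pi} (\<lambda>t. cis (lam * \<Phi>_part n t) * cis (- of_int k * t) - cis (lam * \<Phi> t) * cis (- of_int k * t))"
      unfolding exp_coeff_def
      by (intro Henstock_Kurzweil_Integration.integral_diff[symmetric] integrable_continuous_real
          continuous_intros \<Phi>_cont \<Phi>_part_cont)
    moreover have "norm (integral {0..2*pi} (\<lambda>t. cis (lam * \<Phi>_part n t) * cis (- of_int k * t) - cis (lam * \<Phi> t) * cis (- of_int k * t)))
        \<le> \<bar>lam\<bar> * (4 * (1/8)^n) * (2*pi - 0)"
    proof (rule integral_bound)
      fix t
      have "norm (cis (lam * \<Phi>_part n t) - cis (lam * \<Phi> t)) = norm (cis (lam * \<Phi>_part n t - lam * \<Phi> t) - 1)"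
      proof -
        have "cis (lam * \<Phi>_part n t) - cis (lam * \<Phi> t) = cis (lam * \<Phi> t) * (cis (lam * \<Phi>_part n t - lam * \<Phi> t) - 1)"
          by (simp add: right_diff_distrib cis_mult)
        then show ?thesis by (simp add: norm_mult)
      qed
      also have "\<dots> \<le> \<bar>lam * \<Phi>_part n t - lam * \<Phi> t\<bar>" by (rule norm_cis_minus_one)
      also have "\<dots> = \<bar>lam\<bar> * \<bar>\<Phi> t - \<Phi>_part n t\<bar>"
        by (metis abs_minus_commute abs_mult right_diff_distrib)
      also have "\<dots> \<le> \<bar>lam\<bar> * (4 * (1/8)^n)" by (intro mult_left_mono \<Phi>_part_close) auto
      finally show "norm (cis (lam * \<Phi>_part n t) * cis (- of_int k * t) - cis (lam * \<Phi> t) * cis (- of_int k * t))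
          \<le> \<bar>lam\<bar> * (4 * (1/8)^n)"
        by (simp add: norm_mult flip: left_diff_distrib)
    qed (auto intro!: continuous_intros \<Phi>_cont \<Phi>_part_cont)
    ultimately show ?thesis by simp
  qed
  then show "\<forall>\<^sub>F n in sequentially. norm (exp_coeff (\<Phi>_part n) lam k - exp_coeff \<Phi> lam k) \<le> \<bar>lam\<bar> * (4 * (1/8)^n) * (2*pi)"
    by simp
  show "(\<lambda>n. \<bar>lam\<bar> * (4 * (1/8)^n) * (2*pi)) \<longlonglongrightarrow> 0"
    by real_asymp
qed

end

lemma powr_add_le:
  fixes a b p :: real
  assumes "0 \<le> a" "0 \<le> b" "1 \<le> p"
  shows "(a + b) powr p \<le> 2 powr (p - 1) * (a powr p + b powr p)"
proof (cases "a = 0 \<or> b = 0")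
  case True
  have "1 \<le> 2 powr (p - 1)" using assms by (intro ge_one_powr_ge_zero) auto
  then have "y powr p \<le> 2 powr (p - 1) * y powr p" for y :: real
    by (simp add: mult_le_cancel_right1)
  with True show ?thesis using assms by auto
next
  case False
  then have ab: "0 < a" "0 < b" using assms by auto
  have "((1 - 1/2) *\<^sub>R (2*a) + (1/2) *\<^sub>R (2*b)) powr p \<le> (1 - 1/2) * (2*a) powr p + (1/2) * (2*b) powr p"
    by (rule convex_onD[OF powr_convex[OF assms(3)]]) (use ab in auto)
  also have "\<dots> = 2 powr (p - 1) * (a powr p + b powr p)"
    using ab by (simp add: powr_mult powr_diff field_simps)
  finally show ?thesis by simp
qed

text \<open>Splitting off the first term costs one factor \<open>2 powr (p - 1)\<close> for all the
  others. The weights grow with the position \<open>j\<close> only, not with \<open>n\<close>, so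
  decay of the bumps in \<open>j\<close> gives bounds uniform in \<open>n\<close>.\<close>

lemma powr_sum_le:
  fixes z :: "nat \<Rightarrow> complex" and p :: real
  assumes "1 \<le> p"
  shows "norm (\<Sum>j<n. z j) powr p \<le> (\<Sum>j<n. (2 powr (p - 1))^Suc j * norm (z j) powr p)"
proof (induction n arbitrary: z)
  case 0 then show ?case by simp
next
  case (Suc n)
  let ?\<kappa> = "2 powr (p - 1)"
  have "norm (\<Sum>j<Suc n. z j) powr p \<le> (norm (z 0) + norm (\<Sum>j<n. z (Suc j))) powr p"
    unfolding sum.lessThan_Suc_shift using assms by (intro powr_mono2 norm_triangle_ineq) auto
  also have "\<dots> \<le> ?\<kappa> * (norm (z 0) powr p + norm (\<Sum>j<n. z (Suc j)) powr p)"
    using assms by (intro powr_add_le) auto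
  also have "\<dots> \<le> ?\<kappa> * (norm (z 0) powr p + (\<Sum>j<n. ?\<kappa>^Suc j * norm (z (Suc j)) powr p))"
    using Suc[of "\<lambda>j. z (Suc j)"] by (intro mult_left_mono add_left_mono) auto
  also have "\<dots> = (\<Sum>j<Suc n. ?\<kappa>^Suc j * norm (z j) powr p)"
    unfolding sum.lessThan_Suc_shift by (simp add: distrib_left sum_distrib_left mult.assoc)
  finally show ?case .
qed

context bump_sequence
begin

lemma exp_coeff_zero: "norm (exp_coeff (\<Phi>_part 0) lam k) = (if k = 0 then 2*pi else 0)"
proof (cases "k = 0")
  case True
  then show ?thesis by (simp add: exp_coeff_def \<Phi>_part_def)
next
  case False
  let ?F = "\<lambda>t. \<i> / of_int k * cis (- of_int k * t)"
  have "((\<lambda>t. cis (- of_int k * t)) has_integral ?F (2*pi) - ?F 0) {0..2*pi}"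
  proof (rule fundamental_theorem_of_calculus)
    fix t
    have "((\<lambda>t. - of_int k * t) has_derivative (\<lambda>h. - of_int k * h)) (at t within {0..2*pi})"
      by (auto intro!: derivative_eq_intros)
    then have "((\<lambda>t. cis (- of_int k * t)) has_derivative (\<lambda>h. (- of_int k * h) *\<^sub>R (\<i> * cis (- of_int k * t)))) (at t within {0..2*pi})"
      by (rule has_derivative_cis)
    then have "(?F has_derivative (\<lambda>h. \<i> / of_int k * ((- of_int k * h) *\<^sub>R (\<i> * cis (- of_int k * t))))) (at t within {0..2*pi})"
      by (rule has_derivative_mult_right)
    then show "(?F has_vector_derivative cis (- of_int k * t)) (at t within {0..2*pi})"
      unfolding has_vector_derivative_def
      by (rule has_derivative_eq_rhs) (use False in \<open>auto simp: fun_eq_iff scaleR_conv_of_real complex_eq_iff\<close>)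
  qed simp
  moreover have "cis (- of_int k * (2*pi)) = 1"
    using cis_multiple_2pi[of "- of_int k"] by (simp add: mult_ac)
  ultimately have "((\<lambda>t. cis (- of_int k * t)) has_integral 0) {0..2*pi}" by simp
  then show ?thesis using False by (simp add: exp_coeff_def \<Phi>_part_def integral_unique)
qed

lemma \<Phi>_part_affine:
  defines "\<gamma> n \<equiv> (\<Sum>j<n. (1/2)^j * w j (x n - x j))"
  shows "\<exists>\<beta>. \<forall>t\<in>{x n..x n + 3 * L n}. \<Phi>_part n t = \<gamma> n * t + \<beta>"
proof -
  have "\<exists>\<beta>. \<forall>t\<in>{x n..x n + 3 * L n}. \<Phi>_part n t - \<gamma> n * t = \<beta>"
  proof (rule has_field_derivative_zero_constant)
    fix t assume t: "t \<in> {x n..x n + 3 * L n}"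
    have "(\<Phi>_part n has_real_derivative (\<Sum>j<n. g j t)) (at t within {x n..x n + 3 * L n})"
      unfolding \<Phi>_part_def[abs_def] by (intro DERIV_sum f_deriv)
    moreover have "(\<Sum>j<n. g j t) = \<gamma> n" unfolding g_def \<gamma>_def by (rule plateau[OF t])
    ultimately show "((\<lambda>t. \<Phi>_part n t - \<gamma> n * t) has_real_derivative 0) (at t within {x n..x n + 3 * L n})"
      by (auto intro!: derivative_eq_intros)
  qed simp
  then show ?thesis by (metis add.commute diff_add_cancel)
qed

text \<open>On the support of bump \<open>n\<close> the earlier phase is
  \<open>\<gamma> * t + \<beta>\<close>. Its exponential is a unimodular constant times a pure
  frequency, so the norm sees only the shift \<open>- lam * \<gamma>\<close>, the same for all
  \<open>k\<close>.\<close>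

lemma exp_coeff_step:
  "\<exists>\<theta>. \<forall>k. norm (exp_coeff (\<Phi>_part (Suc n)) lam k - exp_coeff (\<Phi>_part n) lam k) =
    norm (integral {0..3 * L n} (\<lambda>t. (cis (lam * (1/2)^n * W n t) - 1) * cis (- (of_int k + \<theta>) * t)))"
proof -
  obtain \<gamma> \<beta> where affine: "\<And>t. t \<in> {x n..x n + 3 * L n} \<Longrightarrow> \<Phi>_part n t = \<gamma> * t + \<beta>"
    using \<Phi>_part_affine[of n] by blast
  show ?thesis
  proof (intro exI allI)
    fix k
    let ?\<mu> = "lam * (1/2)^n"
    let ?h = "\<lambda>t. cis (lam * \<Phi>_part n t) * (cis (?\<mu> * W n (t - x n)) - 1) * cis (- of_int k * t)"
    let ?b = "\<lambda>t. (cis (?\<mu> * W n t) - 1) * cis (- (of_int k + - (lam * \<gamma>)) * t)"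
    have Wc: "continuous_on X (W n)" for X
      by (rule DERIV_continuous_on) (rule has_field_derivative_at_within[OF W_deriv])
    have hc: "continuous_on X ?h" for X
      by (intro continuous_intros \<Phi>_part_cont continuous_on_compose2[OF Wc[of UNIV]]) auto
    have h0: "?h t = 0" if "t \<notin> {x n..x n + 3 * L n}" for t
      using that W_out[of "t - x n" n] by auto
    have "exp_coeff (\<Phi>_part (Suc n)) lam k - exp_coeff (\<Phi>_part n) lam k =
        integral {0..2*pi} (\<lambda>t. cis (lam * \<Phi>_part (Suc n) t) * cis (- of_int k * t) - cis (lam * \<Phi>_part n t) * cis (- of_int k * t))"
      unfolding exp_coeff_def
      by (intro Henstock_Kurzweil_Integration.integral_diff[symmetric] integrable_continuous_real
          continuous_intros \<Phi>_part_cont)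
    also have "\<dots> = integral {0..2*pi} ?h"
    proof (rule integral_cong)
      fix t
      have "cis (lam * \<Phi>_part (Suc n) t) = cis (lam * \<Phi>_part n t) * cis (?\<mu> * W n (t - x n))"
        by (simp add: \<Phi>_part_def f_def cis_mult distrib_left mult.assoc)
      then show "cis (lam * \<Phi>_part (Suc n) t) * cis (- of_int k * t) - cis (lam * \<Phi>_part n t) * cis (- of_int k * t) = ?h t"
        by (simp add: algebra_simps)
    qed
    also have "\<dots> = integral {x n..x n + 3 * L n} ?h"
    proof (rule integral_unique)
      have "(?h has_integral integral {x n..x n + 3 * L n} ?h) {x n..x n + 3 * L n}"
        by (intro integrable_integral integrable_continuous_real hc)
      then show "(?h has_integral integral {x n..x n + 3 * L n} ?h) {0..2*pi}"
        by (rule has_integral_on_superset[OF _ h0]) (use x_pos[of n] x_less[of n] in auto)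
    qed
    also have "\<dots> = integral {0..3 * L n} (\<lambda>t. ?h (t + x n))"
      using integral_shift_real_ivl[of "x n" "x n" "x n + 3 * L n" ?h] by simp
    also have "\<dots> = integral {0..3 * L n} (\<lambda>t. cis (lam * (\<gamma> * x n + \<beta>) - of_int k * x n) * ?b t)"
    proof (rule integral_cong)
      fix t assume "t \<in> {0..3 * L n}"
      then have "\<Phi>_part n (t + x n) = \<gamma> * (t + x n) + \<beta>" by (intro affine) auto
      moreover have "lam * (\<gamma> * (t + x n) + \<beta>) + - of_int k * (t + x n) =
          (lam * (\<gamma> * x n + \<beta>) - of_int k * x n) + - (of_int k + - (lam * \<gamma>)) * t"
        by (simp add: algebra_simps)
      then have "cis (lam * (\<gamma> * (t + x n) + \<beta>)) * cis (- of_int k * (t + x n)) =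
          cis (lam * (\<gamma> * x n + \<beta>) - of_int k * x n) * cis (- (of_int k + - (lam * \<gamma>)) * t)"
        by (simp only: cis_mult)
      then have "cis (lam * (\<gamma> * (t + x n) + \<beta>)) * z * cis (- of_int k * (t + x n)) =
          cis (lam * (\<gamma> * x n + \<beta>) - of_int k * x n) * (z * cis (- (of_int k + - (lam * \<gamma>)) * t))" for z
        by (metis mult.assoc mult.commute)
      ultimately show "?h (t + x n) = cis (lam * (\<gamma> * x n + \<beta>) - of_int k * x n) * ?b t"
        by (simp only: add_diff_cancel_right')
    qed
    also have "\<dots> = cis (lam * (\<gamma> * x n + \<beta>) - of_int k * x n) * integral {0..3 * L n} ?b"
      by (rule integral_mult_right)
    finally have "exp_coeff (\<Phi>_part (Suc n)) lam k - exp_coeff (\<Phi>_part n) lam k =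
        cis (lam * (\<gamma> * x n + \<beta>) - of_int k * x n) * integral {0..3 * L n} ?b" .
    then show "norm (exp_coeff (\<Phi>_part (Suc n)) lam k - exp_coeff (\<Phi>_part n) lam k) = norm (integral {0..3 * L n} ?b)"
      by (simp only: norm_mult norm_cis mult_1_left)
  qed
qed

lemma step_sum:
  assumes p: "1 \<le> p" "p \<le> 2" and lam: "\<bar>lam\<bar> \<le> 2^Suc m" and T: "finite T"
  shows "(\<Sum>k\<in>T. norm (exp_coeff (\<Phi>_part (Suc n)) lam k - exp_coeff (\<Phi>_part n) lam k) powr p) \<le>
    200000 * (min 1 (2^Suc m * (1/2)^n) * L n powr (p - 1) + (1/8)^n * S p m)"
proof -
  obtain \<theta> where \<theta>: "\<And>k. norm (exp_coeff (\<Phi>_part (Suc n)) lam k - exp_coeff (\<Phi>_part n) lam k) =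
    norm (integral {0..3 * L n} (\<lambda>t. (cis (lam * (1/2)^n * W n t) - 1) * cis (- (of_int k + \<theta>) * t)))"
    using exp_coeff_step by blast
  have half: "(1/2::real)^n \<le> 1" by (intro power_le_one) auto
  have \<mu>1: "\<bar>lam * (1/2)^n\<bar> \<le> 2^Suc m * (1/2)^n" using lam by (simp add: abs_mult mult_right_mono)
  also have "\<dots> \<le> 2^Suc m * 1" using half by (intro mult_left_mono) auto
  finally have \<mu>: "\<bar>lam * (1/2)^n\<bar> \<le> 2^Suc m" by simp
  have e1: "(1/8::real)^n \<le> 1" by (intro power_le_one) auto
  have "(\<Sum>k\<in>T. norm (exp_coeff (\<Phi>_part (Suc n)) lam k - exp_coeff (\<Phi>_part n) lam k) powr p) \<le>
      200000 * (min 1 (\<bar>lam * (1/2)^n\<bar> * \<omega> (L n) * L n) * L n powr (p - 1) + \<omega> (L n) * S p m)"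
    unfolding \<theta> by (rule bump_sum[OF p \<mu> T])
  also have "\<dots> \<le> 200000 * (min 1 (2^Suc m * (1/2)^n) * L n powr (p - 1) + (1/8)^n * S p m)"
  proof (intro mult_left_mono add_mono mult_right_mono \<omega>L_small S_nonneg min.mono order_refl)
    have "\<bar>lam * (1/2)^n\<bar> * \<omega> (L n) * L n \<le> (2^Suc m * (1/2)^n) * 1 * 1"
      using \<omega>L_small[of n] L_small[of n] e1 \<omega>L[of n] L_pos[of n]
      by (intro mult_mono \<mu>1) auto
    then show "\<bar>lam * (1/2)^n\<bar> * \<omega> (L n) * L n \<le> 2^Suc m * (1/2)^n" by simp
  qed auto
  finally show ?thesis .
qed

text \<open>For \<open>p = 1\<close> the weights are 1 and the minima sum to
  \<open>m + O(1)\<close>, which \<open>S1_ge\<close> absorbs. For \<open>p > 1\<close> the factors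
  \<open>2 powr (p - 1)\<close> and \<open>(1/8) powr (p - 1)\<close> combine to the ratio
  \<open>(1/4) powr (p - 1) < 1\<close>, so the sum is bounded and \<open>S_ge\<close>
  suffices.\<close>

lemma weights_sum:
  assumes p: "1 \<le> p" "p \<le> 2"
  shows "\<exists>C\<ge>0. \<forall>m n. (\<Sum>j<n. (2 powr (p - 1))^Suc j * (min 1 (2^Suc m * (1/2)^j) * L j powr (p - 1))) \<le> C * S p m"
proof (cases "p = 1")
  case True
  have *: "(\<Sum>j<n. min 1 (2^m * (1/2::real)^j)) \<le> real m + 2" for m n
  proof (induction m arbitrary: n)
    case 0
    have "(\<Sum>j<n. min 1 (2^0 * (1/2::real)^j)) = (\<Sum>j<n. (1/2::real)^j)"
      by (intro sum.cong refl) (simp add: power_le_one)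
    also have "\<dots> \<le> 2" by (simp add: sum_gp_strict)
    finally show ?case by simp
  next
    case (Suc m)
    show ?case
    proof (cases n)
      case (Suc n')
      have "(\<Sum>j<n'. min 1 (2^Suc m * (1/2::real)^Suc j)) = (\<Sum>j<n'. min 1 (2^m * (1/2::real)^j))" by simp
      moreover have "min 1 (2^Suc m * (1/2::real)^0) \<le> 1" by simp
      ultimately show ?thesis unfolding Suc sum.lessThan_Suc_shift using Suc.IH[of n'] by simp
    qed simp
  qed
  have "(\<Sum>j<n. min 1 (2^Suc m * (1/2)^j)) \<le> 3 / \<rho> 0 * S 1 m" for m n
  proof -
    have "(\<Sum>j<n. min 1 (2^Suc m * (1/2::real)^j)) \<le> 3 * (real m + 1)" using *[where m = "Suc m"] by (rule order_trans) simp
    also have "\<dots> = 3 / \<rho> 0 * (\<rho> 0 * (real m + 1))" using \<rho>_pos[of 0] by simp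
    also have "\<dots> \<le> 3 / \<rho> 0 * S 1 m" using \<rho>_pos[of 0] by (intro mult_left_mono S1_ge) auto
    finally show ?thesis .
  qed
  moreover have "L j powr 0 = 1" for j using L_pos[of j] by simp
  ultimately show ?thesis using True \<rho>_pos[of 0] by (intro exI[of _ "3 / \<rho> 0"]) simp
next
  case False
  define q where "q = (1/4) powr (p - 1)"
  have q: "0 < q" "q < 1" using False p powr_less_mono'[of "1/4" 0 "p - 1"] by (auto simp: q_def)
  define \<kappa> where "\<kappa> = 2 powr (p - 1)"
  have \<kappa>: "0 < \<kappa>" by (simp add: \<kappa>_def)
  have each: "\<kappa>^Suc j * (min 1 (2^Suc m * (1/2)^j) * L j powr (p - 1)) \<le> \<kappa> * q^j" for j m
  proof -
    have "L j powr (p - 1) \<le> ((1/8)^j) powr (p - 1)" using p L_pos[of j] L_small[of j] by (intro powr_mono2) auto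
    also have "\<dots> = ((1/8) powr (p - 1))^j"
    proof -
      have "(a^j) powr b = (a powr b)^j" for a b :: real
        by (induction j) (simp_all add: powr_mult)
      then show ?thesis .
    qed
    finally have Lp: "L j powr (p - 1) \<le> ((1/8) powr (p - 1))^j" .
    have "\<kappa>^Suc j * (min 1 (2^Suc m * (1/2)^j) * L j powr (p - 1)) \<le> \<kappa>^Suc j * (1 * ((1/8) powr (p - 1))^j)"
      using \<kappa> by (intro mult_left_mono mult_mono Lp) auto
    also have "\<dots> = \<kappa> * (\<kappa> * (1/8) powr (p - 1))^j" by (simp add: power_mult_distrib)
    also have "\<kappa> * (1/8) powr (p - 1) = q" unfolding \<kappa>_def q_def by (simp flip: powr_mult)
    finally show ?thesis .
  qed
  have "(\<Sum>j<n. \<kappa>^Suc j * (min 1 (2^Suc m * (1/2)^j) * L j powr (p - 1))) \<le>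
      \<kappa> / (1 - q) / \<rho> 0 powr p * S p m" for m n
  proof -
    have "(\<Sum>j<n. \<kappa>^Suc j * (min 1 (2^Suc m * (1/2)^j) * L j powr (p - 1))) \<le> (\<Sum>j<n. \<kappa> * q^j)"
      by (intro sum_mono each)
    also have "\<dots> = \<kappa> * ((1 - q^n) / (1 - q))" using q by (simp add: sum_gp_strict flip: sum_distrib_left)
    also have "\<dots> \<le> \<kappa> * (1 / (1 - q))" using q \<kappa> by (intro mult_left_mono divide_right_mono) auto
    also have "\<dots> = \<kappa> / (1 - q) / \<rho> 0 powr p * \<rho> 0 powr p" using \<rho>_pos[of 0] by simp
    also have "\<dots> \<le> \<kappa> / (1 - q) / \<rho> 0 powr p * S p m" using q \<kappa> by (intro mult_left_mono S_ge) auto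
    finally show ?thesis .
  qed
  moreover have "0 \<le> \<kappa> / (1 - q) / \<rho> 0 powr p" using q \<kappa> by simp
  ultimately show ?thesis unfolding \<kappa>_def by blast
qed

lemma partial_exp_coeff_sum:
  assumes p: "1 \<le> p" "p \<le> 2"
  shows "\<exists>C. \<forall>lam m n T. \<bar>lam\<bar> \<le> 2^Suc m \<longrightarrow> finite T \<longrightarrow>
    (\<Sum>k\<in>T. norm (exp_coeff (\<Phi>_part n) lam k) powr p) \<le> C * S p m"
proof -
  obtain C0 where C0: "C0 \<ge> 0" "\<And>m n. (\<Sum>j<n. (2 powr (p - 1))^Suc j * (min 1 (2^Suc m * (1/2)^j) * L j powr (p - 1))) \<le> C0 * S p m"
    using weights_sum[OF p] by blast
  define \<kappa> where "\<kappa> = 2 powr (p - 1)"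
  have \<kappa>: "0 < \<kappa>" "\<kappa> \<le> 2" using p powr_mono[of "p - 1" 1 2] by (auto simp: \<kappa>_def)
  define C where "C = \<kappa> * ((2*pi) powr p / \<rho> 0 powr p + 200000 * (C0 + 4))"
  have "(\<Sum>k\<in>T. norm (exp_coeff (\<Phi>_part n) lam k) powr p) \<le> C * S p m"
    if lam: "\<bar>lam\<bar> \<le> 2^Suc m" and T: "finite T" for lam m n T
  proof -
    define c where "c k = norm (exp_coeff (\<Phi>_part 0) lam k)" for k
    define d where "d j k = exp_coeff (\<Phi>_part (Suc j)) lam k - exp_coeff (\<Phi>_part j) lam k" for j k
    have pt: "norm (exp_coeff (\<Phi>_part n) lam k) powr p \<le>
        \<kappa> * (c k powr p + (\<Sum>j<n. \<kappa>^Suc j * norm (d j k) powr p))" for k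
    proof -
      have eq: "exp_coeff (\<Phi>_part n) lam k = exp_coeff (\<Phi>_part 0) lam k + (\<Sum>j<n. d j k)"
        unfolding d_def by (induction n) simp_all
      have "norm (exp_coeff (\<Phi>_part n) lam k) powr p \<le> (c k + norm (\<Sum>j<n. d j k)) powr p"
        unfolding eq c_def using p by (intro powr_mono2 norm_triangle_ineq) auto
      also have "\<dots> \<le> \<kappa> * (c k powr p + norm (\<Sum>j<n. d j k) powr p)"
        unfolding \<kappa>_def using p by (intro powr_add_le) (auto simp: c_def)
      also have "\<dots> \<le> \<kappa> * (c k powr p + (\<Sum>j<n. \<kappa>^Suc j * norm (d j k) powr p))"
        using \<kappa> powr_sum_le[OF p(1), of "\<lambda>j. d j k" n] unfolding \<kappa>_def by (intro mult_left_mono add_left_mono) auto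
      finally show ?thesis .
    qed
    have c: "(\<Sum>k\<in>T. c k powr p) \<le> (2*pi) powr p / \<rho> 0 powr p * S p m"
    proof -
      have "(\<Sum>k\<in>T. c k powr p) = (\<Sum>k\<in>T. if k = 0 then (2*pi) powr p else 0)"
        unfolding c_def exp_coeff_zero by (intro sum.cong refl) auto
      also have "\<dots> \<le> (2*pi) powr p" using T by simp
      also have "\<dots> = (2*pi) powr p / \<rho> 0 powr p * \<rho> 0 powr p" using \<rho>_pos[of 0] by simp
      also have "\<dots> \<le> (2*pi) powr p / \<rho> 0 powr p * S p m" by (intro mult_left_mono S_ge) auto
      finally show ?thesis .
    qed
    have d: "(\<Sum>j<n. \<kappa>^Suc j * (\<Sum>k\<in>T. norm (d j k) powr p)) \<le> 200000 * (C0 + 4) * S p m"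
    proof -
      have "(\<Sum>j<n. \<kappa>^Suc j * (\<Sum>k\<in>T. norm (d j k) powr p)) \<le>
          (\<Sum>j<n. \<kappa>^Suc j * (200000 * (min 1 (2^Suc m * (1/2)^j) * L j powr (p - 1) + (1/8)^j * S p m)))"
        unfolding d_def using \<kappa> by (intro sum_mono mult_left_mono step_sum p lam T) auto
      also have "\<dots> = 200000 * ((\<Sum>j<n. \<kappa>^Suc j * (min 1 (2^Suc m * (1/2)^j) * L j powr (p - 1))) +
          (\<Sum>j<n. \<kappa>^Suc j * (1/8)^j) * S p m)"
        by (simp only: sum_distrib_left sum_distrib_right distrib_left sum.distrib mult_ac)
      also have "\<dots> \<le> 200000 * (C0 * S p m + 4 * S p m)"
      proof (intro mult_left_mono add_mono mult_right_mono S_nonneg)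
        have "(\<Sum>j<n. \<kappa>^Suc j * (1/8)^j) \<le> (\<Sum>j<n. 2 * (1/2)^j)"
        proof (rule sum_mono)
          fix j
          have "\<kappa>^Suc j * (1/8)^j \<le> 2^Suc j * (1/8)^j" using \<kappa> by (intro mult_right_mono power_mono) auto
          also have "\<dots> = 2 * (1/4)^j" by (simp flip: power_mult_distrib)
          also have "\<dots> \<le> 2 * (1/2)^j" by (intro mult_left_mono power_mono) auto
          finally show "\<kappa>^Suc j * (1/8)^j \<le> 2 * (1/2)^j" .
        qed
        also have "\<dots> \<le> 4" by (simp add: sum_gp_strict flip: sum_distrib_left)
        finally show "(\<Sum>j<n. \<kappa>^Suc j * (1/8)^j) \<le> 4" .
      qed (use C0(2) in \<open>auto simp: \<kappa>_def\<close>)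
      finally show ?thesis by (simp add: algebra_simps)
    qed
    have "(\<Sum>k\<in>T. norm (exp_coeff (\<Phi>_part n) lam k) powr p) \<le>
        (\<Sum>k\<in>T. \<kappa> * (c k powr p + (\<Sum>j<n. \<kappa>^Suc j * norm (d j k) powr p)))"
      by (intro sum_mono pt)
    also have "\<dots> = \<kappa> * ((\<Sum>k\<in>T. c k powr p) + (\<Sum>k\<in>T. \<Sum>j<n. \<kappa>^Suc j * norm (d j k) powr p))"
      by (simp only: sum.distrib flip: sum_distrib_left)
    also have "(\<Sum>k\<in>T. \<Sum>j<n. \<kappa>^Suc j * norm (d j k) powr p) = (\<Sum>j<n. \<kappa>^Suc j * (\<Sum>k\<in>T. norm (d j k) powr p))"
      unfolding sum_distrib_left by (rule sum.swap)
    also have "\<kappa> * ((\<Sum>k\<in>T. c k powr p) + (\<Sum>j<n. \<kappa>^Suc j * (\<Sum>k\<in>T. norm (d j k) powr p))) \<le>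
        \<kappa> * ((2*pi) powr p / \<rho> 0 powr p * S p m + 200000 * (C0 + 4) * S p m)"
      using \<kappa> by (intro mult_left_mono add_mono c d) auto
    also have "\<dots> = C * S p m" by (simp add: C_def distrib_right mult.assoc)
    finally show ?thesis .
  qed
  then show ?thesis by blast
qed

text \<open>The constant for the partial phases is independent of \<open>n\<close> and
  \<open>T\<close> is finite, so termwise convergence of the coefficients is enough.\<close>

lemma exp_coeff_sum:
  assumes p: "1 \<le> p" "p \<le> 2"
  shows "\<exists>C. \<forall>lam m T. \<bar>lam\<bar> \<le> 2^Suc m \<longrightarrow> finite T \<longrightarrow>
    (\<Sum>k\<in>T. norm (exp_coeff \<Phi> lam k) powr p) \<le> C * S p m"
proof -
  obtain C where C: "\<And>lam m n T. \<bar>lam\<bar> \<le> 2^Suc m \<Longrightarrow> finite T \<Longrightarrow>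
    (\<Sum>k\<in>T. norm (exp_coeff (\<Phi>_part n) lam k) powr p) \<le> C * S p m"
    using partial_exp_coeff_sum[OF p] by blast
  have "(\<Sum>k\<in>T. norm (exp_coeff \<Phi> lam k) powr p) \<le> C * S p m" if "\<bar>lam\<bar> \<le> 2^Suc m" "finite T" for lam m T
  proof (rule LIMSEQ_le_const2)
    show "(\<lambda>n. \<Sum>k\<in>T. norm (exp_coeff (\<Phi>_part n) lam k) powr p) \<longlonglongrightarrow> (\<Sum>k\<in>T. norm (exp_coeff \<Phi> lam k) powr p)"
      using p by (intro tendsto_intros tendsto_powr2 exp_coeff_limit) auto
  qed (use C[OF that] in blast)
  then show ?thesis by blast
qed

end

section \<open>Placement of the bumps on plateaus\<close>

definition plateau_dense :: "(real \<Rightarrow> real) \<Rightarrow> bool" where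
  "plateau_dense f \<longleftrightarrow> (\<forall>s t. s < t \<longrightarrow> (\<exists>p q. s \<le> p \<and> p < q \<and> q \<le> t \<and> (\<forall>x\<in>{p..q}. f x = f p)))"

lemma plateau_dense_const: "plateau_dense (\<lambda>_. c)"
  unfolding plateau_dense_def by (metis order_refl)

lemma plateau_dense_shift: assumes "plateau_dense f" shows "plateau_dense (\<lambda>t. c * f (t - x))"
  unfolding plateau_dense_def
proof (intro allI impI)
  fix s t :: real assume "s < t"
  then have "s - x < t - x" by simp
  with assms obtain p q where pq: "s - x \<le> p" "p < q" "q \<le> t - x" "\<forall>y\<in>{p..q}. f y = f p"
    unfolding plateau_dense_def by blast
  have "c * f (y - x) = c * f (p + x - x)" if "y \<in> {p + x..q + x}" for y
  proof -
    have "y - x \<in> {p..q}" using that by auto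
    from bspec[OF pq(4) this] show ?thesis by simp
  qed
  moreover have "s \<le> p + x" "p + x < q + x" "q + x \<le> t" using pq(1-3) by linarith+
  ultimately show "\<exists>p q. s \<le> p \<and> p < q \<and> q \<le> t \<and> (\<forall>y\<in>{p..q}. c * f (y - x) = c * f (p - x))"
    by blast
qed

lemma plateau_dense_add:
  assumes "plateau_dense f" "plateau_dense g" shows "plateau_dense (\<lambda>t. f t + g t)"
  unfolding plateau_dense_def
proof (intro allI impI)
  fix s t :: real assume "s < t"
  with assms(1) obtain p q where f: "s \<le> p" "p < q" "q \<le> t" "\<forall>y\<in>{p..q}. f y = f p"
    unfolding plateau_dense_def by blast
  with assms(2) obtain p' q' where g: "p \<le> p'" "p' < q'" "q' \<le> q" "\<forall>y\<in>{p'..q'}. g y = g p'"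
    unfolding plateau_dense_def by blast
  have "f y + g y = f p' + g p'" if "y \<in> {p'..q'}" for y
  proof -
    have "y \<in> {p..q}" "p' \<in> {p..q}" using f(1-3) g(1-3) that by auto
    then have "f y = f p" "f p' = f p" using f(4) by blast+
    then show ?thesis using g(4) that by metis
  qed
  moreover have "s \<le> p'" "q' \<le> t" using f g by linarith+
  ultimately show "\<exists>p q. s \<le> p \<and> p < q \<and> q \<le> t \<and> (\<forall>y\<in>{p..q}. f y + g y = f p + g p)"
    using g(2) by blast
qed

context modulus
begin

lemma place_bump:
  assumes f: "plateau_dense f" and ab: "a < b" and e: "0 < e"
  shows "\<exists>x L. 0 < L \<and> L < \<delta>0 \<and> L \<le> 1 \<and> L \<le> \<rho> 0 \<and> L \<le> e \<and> \<omega> L \<le> e \<and> a < x \<and> x + 3 * L < b \<and>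
    (\<forall>t\<in>{x..x + 3*L}. f t = f x)"
proof -
  \<comment> \<open>Searching in the middle third secures the strict inequalities
    \<open>a < x\<close> and \<open>x + 3 * L < b\<close>.\<close>
  have "(2*a+b)/3 < (a+2*b)/3" using ab by simp
  with f obtain p q where pq: "(2*a+b)/3 \<le> p" "p < q" "q \<le> (a+2*b)/3" "\<forall>y\<in>{p..q}. f y = f p"
    unfolding plateau_dense_def by blast
  obtain d where d: "d > 0" "\<And>x. 0 \<le> x \<Longrightarrow> x < d \<Longrightarrow> \<omega> x < e" using small[OF e] by blast
  define L where "L = Min {\<delta>0/2, 1, \<rho> 0, e, d/2, (q - p)/3}"
  have L0: "0 < L" unfolding L_def using \<delta>0 \<rho>_pos[of 0] e d(1) pq(2) by simp
  have L: "L \<le> \<delta>0/2" "L \<le> 1" "L \<le> \<rho> 0" "L \<le> e" "L \<le> d/2" "L \<le> (q - p)/3"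
    unfolding L_def by (rule Min_le; simp)+
  have "\<omega> L \<le> e" using d(2)[of L] L(5) L0 d(1) by simp
  moreover have "f t = f p" if "t \<in> {p..p + 3*L}" for t
  proof -
    have "t \<in> {p..q}" using that L(6) by auto
    then show ?thesis using pq(4) by blast
  qed
  moreover have "a < p" using pq(1) ab by simp
  moreover have "p + 3 * L < b" using pq(3) ab L(6) by (simp add: field_simps)
  moreover have "L < \<delta>0" using L(1) \<delta>0 by simp
  ultimately show ?thesis using L(2-4) L0 by blast
qed

definition rational_intervals :: "(real \<times> real) set" where
  "rational_intervals = {(a, b). a \<in> \<rat> \<and> b \<in> \<rat> \<and> 0 < a \<and> a < b \<and> b < 2*pi}"

lemma bump_sequence_exists:
  "\<exists>L x w W. bump_sequence \<omega> \<delta>0 L x w W \<and>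
    (\<forall>a b. (a, b) \<in> rational_intervals \<longrightarrow> (\<exists>n. a < x n \<and> x n + 3 * L n < b))"
proof -
  have "\<exists>w W. 0 < L \<longrightarrow> L < \<delta>0 \<longrightarrow> L \<le> 1 \<longrightarrow> L \<le> \<rho> 0 \<longrightarrow> bump L w W" for L
    using bump_exists[of L] by blast
  then obtain w W where bump: "\<And>L. 0 < L \<Longrightarrow> L < \<delta>0 \<Longrightarrow> L \<le> 1 \<Longrightarrow> L \<le> \<rho> 0 \<Longrightarrow> bump L (w L) (W L)" by metis
  define V where "V = from_nat_into rational_intervals"
  have "countable rational_intervals"
    by (rule countable_subset[of _ "\<rat> \<times> \<rat>"]) (auto simp: rational_intervals_def countable_rat)
  moreover have "(1, 2) \<in> rational_intervals" using pi_gt3 by (simp add: rational_intervals_def)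
  ultimately have V: "range V = rational_intervals" unfolding V_def by (intro range_from_nat_into) auto
  then have Vn: "0 < fst (V n)" "fst (V n) < snd (V n)" "snd (V n) < 2*pi" for n
    using rangeI[of V n] by (auto simp: rational_intervals_def)
  define good where "good n f x L \<longleftrightarrow> plateau_dense f \<and> 0 < L \<and> L < \<delta>0 \<and> L \<le> 1 \<and> L \<le> \<rho> 0 \<and>
      L \<le> (1/8)^n \<and> \<omega> L \<le> (1/8)^n \<and> fst (V n) < x \<and> x + 3*L < snd (V n) \<and> (\<forall>t\<in>{x..x + 3*L}. f t = f x)"
    for n :: nat and f :: "real \<Rightarrow> real" and x L :: real
  \<comment> \<open>The state carries the sum \<open>f\<close> of the earlier derivatives: the next
    position needs a plateau of the updated sum, and the next length refers to the previous one.
    Bump \<open>n\<close> goes into the \<open>n\<close>-th rational interval, so every open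
    subinterval of the period receives one.\<close>
  have "\<exists>s. \<forall>n. (case s n of (f, x, L) \<Rightarrow> good n f x L \<and> (n = 0 \<longrightarrow> f = (\<lambda>_. 0))) \<and>
      (case s n of (f, x, L) \<Rightarrow> case s (Suc n) of (f', x', L') \<Rightarrow>
        f' = (\<lambda>t. f t + (1/2)^n * w L (t - x)) \<and> \<omega> L' \<le> \<omega> L / 16)"
  proof (rule dependent_nat_choice)
    obtain x L where "0 < L \<and> L < \<delta>0 \<and> L \<le> 1 \<and> L \<le> \<rho> 0 \<and> L \<le> 1 \<and> \<omega> L \<le> 1 \<and> fst (V 0) < x \<and> x + 3 * L < snd (V 0)"
      using place_bump[OF plateau_dense_const Vn(2)[of 0], of 1] by auto
    then show "\<exists>s. case s of (f, x, L) \<Rightarrow> good 0 f x L \<and> (0 = (0::nat) \<longrightarrow> f = (\<lambda>_. 0))"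
      by (intro exI[of _ "(\<lambda>_. 0, x, L)"]) (simp add: good_def plateau_dense_const)
  next
    fix s :: "(real \<Rightarrow> real) \<times> real \<times> real" and n :: nat
    assume s: "case s of (f, x, L) \<Rightarrow> good n f x L \<and> (n = 0 \<longrightarrow> f = (\<lambda>_. 0))"
    obtain f x L where sfx: "s = (f, x, L)" by (cases s) auto
    have g: "good n f x L" using s sfx by simp
    then have "bump L (w L) (W L)" by (intro bump) (auto simp: good_def)
    then have wpl: "plateau_dense (w L)" unfolding bump_def plateau_dense_def by (elim conjE)
    define f' where "f' = (\<lambda>t. f t + (1/2)^n * w L (t - x))"
    have f': "plateau_dense f'"
      unfolding f'_def using g by (intro plateau_dense_add plateau_dense_shift wpl) (simp add: good_def)
    define e where "e = min ((1/8)^Suc n) (\<omega> L / 16)"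
    have "0 < e" using g pos[of L] by (simp add: e_def good_def)
    from place_bump[OF f' Vn(2)[of "Suc n"] this] obtain x' L' where x'L':
      "0 < L' \<and> L' < \<delta>0 \<and> L' \<le> 1 \<and> L' \<le> \<rho> 0 \<and> L' \<le> e \<and> \<omega> L' \<le> e \<and> fst (V (Suc n)) < x' \<and>
        x' + 3 * L' < snd (V (Suc n)) \<and> (\<forall>t\<in>{x'..x' + 3*L'}. f' t = f' x')" by blast
    then have "L' \<le> (1/8)^Suc n" "\<omega> L' \<le> (1/8)^Suc n" and \<omega>L': "\<omega> L' \<le> \<omega> L / 16"
      by (simp_all only: e_def min.bounded_iff)
    then have "good (Suc n) f' x' L'" using f' x'L' unfolding good_def by blast
    with \<omega>L' show "\<exists>s'. (case s' of (f, x, L) \<Rightarrow> good (Suc n) f x L \<and> (Suc n = 0 \<longrightarrow> f = (\<lambda>_. 0))) \<and>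
      (case s of (f, x, L) \<Rightarrow> case s' of (f', x', L') \<Rightarrow>
        f' = (\<lambda>t. f t + (1/2)^n * w L (t - x)) \<and> \<omega> L' \<le> \<omega> L / 16)"
      by (intro exI[of _ "(f', x', L')"]) (simp add: sfx f'_def)
  qed
  then obtain s where s': "\<forall>n. (case s n of (f, x, L) \<Rightarrow> good n f x L \<and> (n = 0 \<longrightarrow> f = (\<lambda>_. 0))) \<and>
      (case s n of (f, x, L) \<Rightarrow> case s (Suc n) of (f', x', L') \<Rightarrow>
        f' = (\<lambda>t. f t + (1/2)^n * w L (t - x)) \<and> \<omega> L' \<le> \<omega> L / 16)" ..
  have s: "case s n of (f, x, L) \<Rightarrow> good n f x L \<and> (n = 0 \<longrightarrow> f = (\<lambda>_. 0))"
    "case s n of (f, x, L) \<Rightarrow> case s (Suc n) of (f', x', L') \<Rightarrow>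
        f' = (\<lambda>t. f t + (1/2)^n * w L (t - x)) \<and> \<omega> L' \<le> \<omega> L / 16" for n
    using spec[OF s', of n] by (rule conjunct1, rule conjunct2)
  define f where "f n = fst (s n)" for n
  define x where "x n = fst (snd (s n))" for n
  define L where "L n = snd (snd (s n))" for n
  have sn: "s n = (f n, x n, L n)" for n by (simp add: f_def x_def L_def)
  have g: "good n (f n) (x n) (L n)" and f0: "f 0 = (\<lambda>_. 0)" for n
    using s(1)[of n] s(1)[of 0] by (auto simp: sn)
  have fS: "f (Suc n) = (\<lambda>t. f n t + (1/2)^n * w (L n) (t - x n))" and \<omega>S: "\<omega> (L (Suc n)) \<le> \<omega> (L n) / 16" for n
    using s(2)[of n] by (auto simp: sn)
  have fsum: "f n t = (\<Sum>j<n. (1/2)^j * w (L j) (t - x j))" for n t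
    by (induction n) (simp_all add: f0 fS)
  have "bump_sequence \<omega> \<delta>0 L x (\<lambda>n. w (L n)) (\<lambda>n. W (L n))"
  proof
    fix n
    note gn = g[of n, unfolded good_def]
    show "0 < L n" "L n \<le> (1/8)^n" "\<omega> (L n) \<le> (1/8)^n" "\<omega> (L (Suc n)) \<le> \<omega> (L n) / 16"
      using gn \<omega>S by auto
    show "bump (L n) (w (L n)) (W (L n))" using gn by (intro bump) auto
    show "0 < x n" "x n + 3 * L n < 2*pi" using gn Vn[of n] by auto
    fix t assume "t \<in> {x n..x n + 3 * L n}"
    then show "(\<Sum>j<n. (1/2)^j * w (L j) (t - x j)) = (\<Sum>j<n. (1/2)^j * w (L j) (x n - x j))"
      using gn unfolding fsum by blast
  qed
  moreover have "\<exists>n. a < x n \<and> x n + 3 * L n < b" if "(a, b) \<in> rational_intervals" for a b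
  proof -
    have "(a, b) \<in> range V" using V that by simp
    then obtain n where "V n = (a, b)" by (metis imageE)
    then show ?thesis using g[of n] unfolding good_def by (intro exI[of _ n]) simp
  qed
  ultimately show ?thesis by blast
qed

lemma phase_exists:
  obtains \<Phi> G where "\<And>t. (\<Phi> has_real_derivative G t) (at t)"
    "\<And>t. t \<le> 0 \<or> 2*pi \<le> t \<Longrightarrow> \<Phi> t = 0" "\<And>t. t \<le> 0 \<or> 2*pi \<le> t \<Longrightarrow> G t = 0"
    "\<And>s t. \<bar>G t - G s\<bar> \<le> 32 * \<omega> \<bar>t - s\<bar>"
    "\<And>\<alpha> \<beta>. 0 \<le> \<alpha> \<Longrightarrow> \<alpha> < \<beta> \<Longrightarrow> \<beta> \<le> 2*pi \<Longrightarrow> \<exists>s\<in>{\<alpha><..<\<beta>}. \<exists>t\<in>{\<alpha><..<\<beta>}. G s \<noteq> G t"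
    "\<And>p. 1 \<le> p \<Longrightarrow> p \<le> 2 \<Longrightarrow> \<exists>C. \<forall>lam m T. \<bar>lam\<bar> \<le> 2^Suc m \<longrightarrow> finite T \<longrightarrow>
      (\<Sum>k\<in>T. norm (integral {0..2*pi} (\<lambda>t. cis (lam * \<Phi> t) * cis (- of_int k * t))) powr p) \<le> C * S p m"
proof -
  obtain L x w W where "bump_sequence \<omega> \<delta>0 L x w W"
    and dense: "\<And>a b. (a, b) \<in> rational_intervals \<Longrightarrow> \<exists>n. a < x n \<and> x n + 3 * L n < b"
    using bump_sequence_exists by blast
  then interpret bump_sequence \<omega> \<delta>0 L x w W by blast
  have "\<exists>s\<in>{\<alpha><..<\<beta>}. \<exists>t\<in>{\<alpha><..<\<beta>}. G s \<noteq> G t" if "0 \<le> \<alpha>" "\<alpha> < \<beta>" "\<beta> \<le> 2*pi" for \<alpha> \<beta>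
  proof -
    obtain a where a: "a \<in> \<rat>" "\<alpha> < a" "a < \<beta>" using Rats_dense_in_real[OF \<open>\<alpha> < \<beta>\<close>] by blast
    obtain b where b: "b \<in> \<rat>" "a < b" "b < \<beta>" using Rats_dense_in_real[OF \<open>a < \<beta>\<close>] by blast
    have "(a, b) \<in> rational_intervals" using a b that by (simp add: rational_intervals_def)
    then obtain n where n: "a < x n" "x n + 3 * L n < b" using dense by blast
    have "x n \<in> {\<alpha><..<\<beta>}" "x n + L n \<in> {\<alpha><..<\<beta>}" using n a b L_pos[of n] by auto
    then show ?thesis using G_not_constant[of n] by blast
  qed
  from that[OF \<Phi>_deriv \<Phi>_out G_out G_modulus this exp_coeff_sum[unfolded exp_coeff_def]] show thesis .
qed

end

subsection \<open>Periodic functions of one coordinate\<close>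

definition periodize :: "(real \<Rightarrow> real) \<Rightarrow> real \<Rightarrow> real" where
  "periodize u t = u (t - 2*pi * of_int \<lfloor>t / (2*pi)\<rfloor>)"

lemma periodize_periodic: "periodize u (t + 2*pi) = periodize u t"
proof -
  have "(t + 2*pi) / (2*pi) = t / (2*pi) + 1" by (simp add: add_divide_distrib)
  then have "\<lfloor>(t + 2*pi) / (2*pi)\<rfloor> = \<lfloor>t / (2*pi)\<rfloor> + 1" by simp
  then show ?thesis by (simp add: periodize_def algebra_simps)
qed

lemma periodize_floor:
  assumes "2*pi * of_int n \<le> t" "t < 2*pi * (of_int n + 1)"
  shows "periodize u t = u (t - 2*pi * of_int n)"
proof -
  have "\<lfloor>t / (2*pi)\<rfloor> = n" using assms by (intro floor_unique) (auto simp: field_simps)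
  then show ?thesis by (simp add: periodize_def)
qed

lemma periodize_base:
  assumes "\<And>t. t \<le> 0 \<or> 2*pi \<le> t \<Longrightarrow> u t = 0" "t \<in> {0..2*pi}"
  shows "periodize u t = u t"
proof (cases "t = 2*pi")
  case True
  then show ?thesis using assms(1)[of t] assms(1)[of 0] periodize_periodic[of u 0] periodize_floor[of 0 0 u] by simp
next
  case False
  then show ?thesis using assms(2) periodize_floor[of 0 t u] by simp
qed

text \<open>Two neighbouring translates describe the periodization on a window of two periods,
  across the point where they meet. Derivative and modulus at that point then follow without
  distinguishing sides.\<close>

lemma periodize_local:
  assumes u: "\<And>t. t \<le> 0 \<or> 2*pi \<le> t \<Longrightarrow> u t = 0"
    and t: "2*pi * (of_int n - 1) < t" "t < 2*pi * (of_int n + 1)"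
  shows "periodize u t = u (t - 2*pi * (of_int n - 1)) + u (t - 2*pi * of_int n)"
proof (cases "t < 2*pi * of_int n")
  case True
  then have "u (t - 2*pi * of_int n) = 0" by (intro u) auto
  then show ?thesis using periodize_floor[of "n - 1" t u] t True by simp
next
  case False
  then have "u (t - 2*pi * (of_int n - 1)) = 0" by (intro u) (auto simp: algebra_simps)
  then show ?thesis using periodize_floor[of n t u] t False by simp
qed

text \<open>Centring the window at the multiple of \<open>2*pi\<close> nearest to \<open>t\<close>
  leaves room at least \<open>pi\<close> on both sides, more than the distance 1 used for the
  modulus.\<close>

lemma near_period:
  obtains n :: int where "2*pi * (of_int n - 1) + 1 \<le> t" "t + 1 \<le> 2*pi * (of_int n + 1)"
proof
  define n where "n = round (t / (2*pi))"
  have "\<bar>of_int n - t / (2*pi)\<bar> \<le> 1/2" unfolding n_def by (rule of_int_round_abs_le)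
  then have "of_int n - 1/2 \<le> t / (2*pi)" "t / (2*pi) \<le> of_int n + 1/2" by linarith+
  then have "2*pi * (of_int n - 1/2) \<le> t" "t \<le> 2*pi * (of_int n + 1/2)"
    by (simp_all add: pos_le_divide_eq pos_divide_le_eq mult.commute)
  then show "2*pi * (of_int n - 1) + 1 \<le> t" "t + 1 \<le> 2*pi * (of_int n + 1)"
    using pi_gt3 by (simp_all add: algebra_simps)
qed

lemma periodize_deriv:
  assumes F: "\<And>t. (F has_real_derivative G t) (at t)"
    and F0: "\<And>t. t \<le> 0 \<or> 2*pi \<le> t \<Longrightarrow> F t = 0" and G0: "\<And>t. t \<le> 0 \<or> 2*pi \<le> t \<Longrightarrow> G t = 0"
  shows "(periodize F has_real_derivative periodize G t) (at t)"
proof -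
  obtain n :: int where n: "2*pi * (of_int n - 1) + 1 \<le> t" "t + 1 \<le> 2*pi * (of_int n + 1)"
    using near_period .
  let ?I = "{2*pi * (of_int n - 1)<..<2*pi * (of_int n + 1)}"
  have t: "t \<in> ?I" using n by simp
  have sh: "((\<lambda>t. F (t - c)) has_real_derivative G (t - c)) (at t)" for c
    by (rule DERIV_chain'[where g = F, THEN DERIV_cong]) (auto intro!: derivative_eq_intros F)
  have "((\<lambda>t. F (t - 2*pi * (of_int n - 1)) + F (t - 2*pi * of_int n)) has_real_derivative
      G (t - 2*pi * (of_int n - 1)) + G (t - 2*pi * of_int n)) (at t)"
    by (intro DERIV_add sh)
  also have "G (t - 2*pi * (of_int n - 1)) + G (t - 2*pi * of_int n) = periodize G t"
    using periodize_local[of G n t, OF G0] t by simp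
  finally show ?thesis
    by (rule has_field_derivative_transform_within_open[OF _ _ t])
      (auto intro!: periodize_local[OF F0, symmetric])
qed

lemma periodize_modulus:
  assumes G: "\<And>s t. \<bar>G t - G s\<bar> \<le> C * \<omega> \<bar>t - s\<bar>"
    and G0: "\<And>t. t \<le> 0 \<or> 2*pi \<le> t \<Longrightarrow> G t = 0" and st: "\<bar>t - s\<bar> < 1"
  shows "\<bar>periodize G t - periodize G s\<bar> \<le> 2 * (C * \<omega> \<bar>t - s\<bar>)"
proof -
  obtain n :: int where n: "2*pi * (of_int n - 1) + 1 \<le> t" "t + 1 \<le> 2*pi * (of_int n + 1)"
    using near_period .
  have "periodize G t = G (t - 2*pi * (of_int n - 1)) + G (t - 2*pi * of_int n)"
    using n by (intro periodize_local[OF G0]) auto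
  moreover have "periodize G s = G (s - 2*pi * (of_int n - 1)) + G (s - 2*pi * of_int n)"
    using n st by (intro periodize_local[OF G0]) (auto simp: abs_less_iff)
  moreover have "\<bar>G (t - c) - G (s - c)\<bar> \<le> C * \<omega> \<bar>t - s\<bar>" for c
    using G[of "t - c" "s - c"] by simp
  from this[of "2*pi * (of_int n - 1)"] this[of "2*pi * of_int n"]
  have "\<bar>G (t - 2*pi * (of_int n - 1)) + G (t - 2*pi * of_int n) -
      (G (s - 2*pi * (of_int n - 1)) + G (s - 2*pi * of_int n))\<bar> \<le> 2 * (C * \<omega> \<bar>t - s\<bar>)"
    by linarith
  ultimately show ?thesis by simp
qed

lemma periodize_not_constant:
  assumes G: "\<And>\<alpha> \<beta>. 0 \<le> \<alpha> \<Longrightarrow> \<alpha> < \<beta> \<Longrightarrow> \<beta> \<le> 2*pi \<Longrightarrow> \<exists>s\<in>{\<alpha><..<\<beta>}. \<exists>t\<in>{\<alpha><..<\<beta>}. G s \<noteq> G t"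
    and ab: "a < b"
  shows "\<exists>s\<in>{a<..<b}. \<exists>t\<in>{a<..<b}. periodize G s < periodize G t"
proof -
  define n where "n = \<lfloor>a / (2*pi)\<rfloor>"
  have "of_int n \<le> a / (2*pi)" "a / (2*pi) < of_int n + 1" by (auto simp: n_def)
  then have n: "2*pi * of_int n \<le> a" "a < 2*pi * (of_int n + 1)"
    by (simp_all add: pos_le_divide_eq pos_divide_less_eq mult.commute)
  define \<alpha> where "\<alpha> = a - 2*pi * of_int n"
  define \<beta> where "\<beta> = min (b - 2*pi * of_int n) (2*pi)"
  have "0 \<le> \<alpha>" "\<alpha> < \<beta>" "\<beta> \<le> 2*pi" using n ab by (auto simp: \<alpha>_def \<beta>_def algebra_simps)
  from G[OF this] obtain s t where st: "s \<in> {\<alpha><..<\<beta>}" "t \<in> {\<alpha><..<\<beta>}" "G s \<noteq> G t" by blast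
  have shift: "periodize G (y + 2*pi * of_int n) = G y \<and> y + 2*pi * of_int n \<in> {a<..<b}" if "y \<in> {\<alpha><..<\<beta>}" for y
    using that n periodize_floor[of n "y + 2*pi * of_int n" G] by (auto simp: \<alpha>_def \<beta>_def algebra_simps)
  show ?thesis using st shift by (metis linorder_neqE_linordered_idom)
qed

section \<open>Sums over the coordinates\<close>

definition coord_sum :: "(real \<Rightarrow> real) \<Rightarrow> real^'m \<Rightarrow> real" where
  "coord_sum u x = (\<Sum>i\<in>UNIV. u (x $ i))"

lemma torus_periodic_coord_sum: "torus_periodic (coord_sum (periodize u))"
proof -
  have eq: "periodize u ((x + (2*pi) *\<^sub>R axis i 1) $ j) = periodize u (x $ j)" for x :: "real^'m" and i j
    by (cases "j = i") (auto simp: axis_def periodize_periodic)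
  show ?thesis unfolding torus_periodic_def coord_sum_def by (simp only: eq simp_thms)
qed

lemma partials_coord_sum:
  assumes u: "\<And>t. (u has_real_derivative v t) (at t)"
  shows "partials (coord_sum u :: real^'m \<Rightarrow> real) (\<lambda>i x. v (x $ i))"
  unfolding partials_def
proof (intro allI)
  fix i and x :: "real^'m"
  have "((\<lambda>s. u ((x + s *\<^sub>R axis i 1) $ j)) has_real_derivative (if j = i then v (x $ i) else 0)) (at 0)" for j
  proof (cases "j = i")
    case True
    have "((\<lambda>s. u (x $ i + s)) has_real_derivative v (x $ i + 0)) (at 0)"
      by (rule DERIV_chain'[where g = u, THEN DERIV_cong]) (auto intro!: derivative_eq_intros u)
    then show ?thesis using True by (simp add: axis_def)
  qed (simp add: axis_def)
  then have "((\<lambda>s. \<Sum>j\<in>UNIV. u ((x + s *\<^sub>R axis i 1) $ j)) has_real_derivative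
      (\<Sum>j\<in>UNIV. if j = i then v (x $ i) else 0)) (at 0)"
    by (intro DERIV_sum)
  then show "((\<lambda>s. coord_sum u (x + s *\<^sub>R axis i 1)) has_real_derivative v (x $ i)) (at 0)"
    by (simp add: coord_sum_def)
qed

text \<open>The gradient acts coordinatewise, so on a box the intermediate value property along each
  axis puts a nondegenerate box into the image. Measurability holds because an open set is a
  countable union of compact boxes, whose images are compact.\<close>

lemma grad_nowhere_degenerate_coord_sum:
  assumes u: "\<And>t. (u has_real_derivative v t) (at t)" and v: "continuous_on UNIV v"
    and nc: "\<And>a b. a < b \<Longrightarrow> \<exists>s\<in>{a<..<b}. \<exists>t\<in>{a<..<b}. v s < v t"
  shows "grad_nowhere_degenerate (coord_sum u :: real^'m \<Rightarrow> real)"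
  unfolding grad_nowhere_degenerate_def
proof (intro exI conjI allI impI)
  show "partials (coord_sum u :: real^'m \<Rightarrow> real) (\<lambda>i x. v (x $ i))" by (rule partials_coord_sum[OF u])
  let ?g = "\<lambda>x::real^'m. \<chi> i. v (x $ i)"
  have g: "continuous_on X ?g" for X
    by (intro continuous_on_vec_lambda continuous_on_compose2[OF v] continuous_intros) auto
  fix V :: "(real^'m) set" assume V: "open V \<and> V \<noteq> {}"
  then obtain D where D: "countable D" "\<And>X. X \<in> D \<Longrightarrow> \<exists>a b. X = cbox a b" "\<Union>D = V"
    using open_countable_Union_open_cbox[of V] by metis
  have gV: "?g ` V = (\<Union>X\<in>D. ?g ` X)" using D(3) by blast
  have gX: "?g ` X \<in> sets lebesgue" if "X \<in> D" for X
  proof -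
    have "compact X" using D(2)[OF that] by auto
    then have "compact (?g ` X)" by (intro compact_continuous_image g)
    then show ?thesis by (simp add: compact_imp_closed borel_closed)
  qed
  show meas: "?g ` V \<in> sets lebesgue"
    unfolding gV by (rule sets.countable_UN'[OF D(1)]) (use gX in blast)
  obtain x0 where "x0 \<in> V" using V by blast
  then obtain a b where ab: "cbox a b \<subseteq> V" "\<forall>i\<in>Basis. a \<bullet> i < b \<bullet> i"
    using V open_contains_cbox[of V x0] by metis
  have abi: "a $ i < b $ i" for i using ab(2) by (auto simp: Basis_vec_def inner_axis)
  have "\<forall>i. \<exists>s t. s \<in> {a$i<..<b$i} \<and> t \<in> {a$i<..<b$i} \<and> v s < v t"
    using nc[OF abi] by blast
  then obtain s t where st: "\<And>i. s i \<in> {a$i<..<b$i}" "\<And>i. t i \<in> {a$i<..<b$i}" "\<And>i. v (s i) < v (t i)"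
    by metis
  define p q where "p = (\<chi> i. v (s i))" and "q = (\<chi> i. v (t i))"
  have "cbox p q \<subseteq> ?g ` V"
  proof
    fix y assume "y \<in> cbox p q"
    then have y: "v (s i) \<le> y $ i" "y $ i \<le> v (t i)" for i by (auto simp: p_def q_def mem_box_cart)
    have "\<exists>z. a $ i \<le> z \<and> z \<le> b $ i \<and> v z = y $ i" for i
    proof -
      have "connected (v ` {a$i..b$i})"
        by (intro connected_continuous_image continuous_on_subset[OF v]) auto
      moreover have "v (s i) \<in> v ` {a$i..b$i}" "v (t i) \<in> v ` {a$i..b$i}"
        using st(1,2)[of i] by (auto intro!: imageI)
      ultimately have "{v (s i)..v (t i)} \<subseteq> v ` {a$i..b$i}" by (rule connected_contains_Icc)
      moreover have "y $ i \<in> {v (s i)..v (t i)}" using y[of i] by simp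
      ultimately have "y $ i \<in> v ` {a$i..b$i}" by (rule subsetD)
      then show ?thesis by auto
    qed
    then obtain z where z: "\<And>i. a $ i \<le> z i" "\<And>i. z i \<le> b $ i" "\<And>i. v (z i) = y $ i" by metis
    have "(\<chi> i. z i) \<in> cbox a b" using z by (simp add: mem_box_cart)
    moreover have "?g (\<chi> i. z i) = y" using z by (simp add: vec_eq_iff)
    ultimately show "y \<in> ?g ` V" using ab(1) by blast
  qed
  then have "emeasure lebesgue (cbox p q) \<le> emeasure lebesgue (?g ` V)"
    using meas by (intro emeasure_mono) auto
  moreover have "0 < emeasure lebesgue (cbox p q)"
  proof -
    have lt: "p \<bullet> i < q \<bullet> i" if "i \<in> Basis" for i
      using that st(3) by (auto simp: Basis_vec_def inner_axis p_def q_def)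
    have "emeasure lebesgue (cbox p q) = emeasure lborel (cbox p q)" by simp
    also have "\<dots> = (\<Prod>i\<in>Basis. (q - p) \<bullet> i)" using lt by (intro emeasure_lborel_cbox) (auto intro: less_imp_le)
    finally have e: "emeasure lebesgue (cbox p q) = ennreal (\<Prod>i\<in>Basis. (q - p) \<bullet> i)" .
    show ?thesis unfolding e using lt by (auto intro!: prod_pos simp: inner_diff_left)
  qed
  ultimately show "emeasure lebesgue (?g ` V) > 0" by (rule less_le_trans[rotated])
qed

subsection \<open>The torus\<close>

text \<open>Lebesgue measure is the image of the product of the coordinate measures, so the integral
  of a product of one-variable functions can be pulled back and factored.\<close>

lemma lborel_integral_prod:
  fixes F :: "'a::euclidean_space \<Rightarrow> real \<Rightarrow> complex"
  assumes F: "\<And>b. b \<in> Basis \<Longrightarrow> integrable lborel (F b)"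
  shows "(LINT t|lborel. (\<Prod>b\<in>Basis. F b (t \<bullet> b))) = (\<Prod>b\<in>(Basis::'a set). LINT s|lborel. F b s)"
proof -
  interpret product_sigma_finite "\<lambda>_::'a. lborel :: real measure" by standard
  have F': "F b \<in> borel_measurable borel" if "b \<in> Basis" for b
    using borel_measurable_integrable[OF F[OF that]] by simp
  have "(\<lambda>t. \<Prod>b\<in>(Basis::'a set). F b (t \<bullet> b)) \<in> borel_measurable borel"
    by (intro borel_measurable_prod measurable_compose[OF _ F'] borel_measurable_inner) auto
  then have "(LINT t|lborel. (\<Prod>b\<in>Basis. F b (t \<bullet> b))) =
      (LINT f|(\<Pi>\<^sub>M b\<in>(Basis::'a set). lborel). (\<Prod>b\<in>(Basis::'a set). F b ((\<Sum>c\<in>Basis. f c *\<^sub>R c) \<bullet> b)))"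
    unfolding lborel_eq[where 'a='a] by (subst integral_distr) auto
  also have "\<dots> = (LINT f|(\<Pi>\<^sub>M b\<in>(Basis::'a set). lborel). (\<Prod>b\<in>(Basis::'a set). F b (f b)))"
    by (intro Bochner_Integration.integral_cong refl prod.cong) (simp add: inner_sum_left_Basis)
  also have "\<dots> = (\<Prod>b\<in>(Basis::'a set). LINT s|lborel. F b s)"
    by (rule product_integral_prod[OF finite_Basis F])
  finally show ?thesis .
qed

lemma prod_Basis_vec: "(\<Prod>b\<in>(Basis :: (real^'m) set). h b) = (\<Prod>i\<in>UNIV. h (axis i 1))"
proof -
  have B: "(Basis :: (real^'m) set) = (\<lambda>i. axis i 1) ` UNIV" by (auto simp: Basis_vec_def)
  have inj: "inj (\<lambda>i. axis i 1 :: real^'m)" by (auto simp: inj_on_def axis_eq_axis)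
  show ?thesis unfolding B by (subst prod.reindex[OF inj]) (simp add: o_def)
qed

lemma integral_cbox_prod:
  fixes h :: "'m::finite \<Rightarrow> real \<Rightarrow> complex" and a b :: "real^'m"
  assumes h: "\<And>i. continuous_on UNIV (h i)"
  shows "integral (cbox a b) (\<lambda>t. \<Prod>i\<in>UNIV. h i (t $ i)) = (\<Prod>i\<in>UNIV. integral {a$i..b$i} (h i))"
proof -
  let ?f = "\<lambda>t::real^'m. \<Prod>i\<in>UNIV. h i (t $ i)"
  \<comment> \<open>Putting the indicator of each side of the box into its factor turns the integral
    over the box into one over the whole space.\<close>
  define F where "F c s = indicator {a \<bullet> c..b \<bullet> c} s *\<^sub>R h (axis_index c) s" for c :: "real^'m" and s
  have F_int: "integrable lborel (F c)" for c
    unfolding F_def using borel_integrable_compact[of "{a \<bullet> c..b \<bullet> c}" "h (axis_index c)"] h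
    by (auto intro: continuous_on_subset)
  have eq: "integral {a$i..b$i} (h i) = (LINT s|lborel. F (axis i 1) s)" for i
  proof -
    have "set_integrable lborel {a$i..b$i} (h i)"
      unfolding set_integrable_def by (intro borel_integrable_compact continuous_on_subset[OF h]) auto
    from set_borel_integral_eq_integral(2)[OF this] show ?thesis
      by (simp add: F_def set_lebesgue_integral_def inner_axis)
  qed
  have "continuous_on UNIV ?f"
    by (intro continuous_on_prod continuous_on_compose2[OF h] continuous_intros) auto
  then have "set_integrable lborel (cbox a b) ?f"
    unfolding set_integrable_def by (intro borel_integrable_compact) (auto intro: continuous_on_subset)
  from set_borel_integral_eq_integral(2)[OF this]
  have "integral (cbox a b) ?f = (LINT t|lborel. indicator (cbox a b) t *\<^sub>R ?f t)"
    by (simp add: set_lebesgue_integral_def)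
  also have "\<dots> = (LINT t|lborel. (\<Prod>c\<in>Basis. F c (t \<bullet> c)))"
  proof (intro Bochner_Integration.integral_cong refl)
    fix t :: "real^'m"
    have "indicator (cbox a b) t = (\<Prod>i\<in>UNIV. indicator {a$i..b$i} (t$i) :: real)"
      by (auto simp: indicator_def mem_box_cart prod_zero_iff split: if_splits)
    then show "indicator (cbox a b) t *\<^sub>R ?f t = (\<Prod>c\<in>Basis. F c (t \<bullet> c))"
      by (simp add: prod_Basis_vec F_def inner_axis scaleR_conv_of_real prod.distrib of_real_prod)
  qed
  also have "\<dots> = (\<Prod>c\<in>Basis. LINT s|lborel. F c s)" by (rule lborel_integral_prod[OF F_int])
  also have "\<dots> = (\<Prod>i\<in>UNIV. integral {a$i..b$i} (h i))" by (simp add: prod_Basis_vec eq)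
  finally show ?thesis .
qed

lemma norm_fourier_coeff_coord_sum:
  fixes u :: "real \<Rightarrow> real" and k :: "int^'m"
  assumes u: "continuous_on UNIV u"
  shows "norm (fourier_coeff (\<lambda>t. exp (\<i> * complex_of_real (lam * coord_sum u t))) k) =
    (\<Prod>i\<in>UNIV. norm (integral {0..2*pi} (\<lambda>t. cis (lam * u t) * cis (- of_int (k $ i) * t))) / (2*pi))"
proof -
  let ?h = "\<lambda>i t. cis (lam * u t) * cis (- of_int (k $ i) * t)"
  have cis_sum: "cis (sum y X) = (\<Prod>i\<in>X. cis (y i))" if "finite X" for y and X :: "'m set"
    using that by (induction X) (auto simp flip: cis_mult)
  have "exp (\<i> * complex_of_real (lam * coord_sum u t)) * exp (- \<i> * complex_of_real (\<Sum>i\<in>UNIV. of_int (k $ i) * t $ i)) =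
      (\<Prod>i\<in>UNIV. ?h i (t $ i))" for t
  proof -
    have "exp (\<i> * complex_of_real (lam * coord_sum u t)) = cis (\<Sum>i\<in>UNIV. lam * u (t $ i))"
      by (simp add: cis_conv_exp coord_sum_def sum_distrib_left)
    moreover have "exp (- \<i> * complex_of_real (\<Sum>i\<in>UNIV. of_int (k $ i) * t $ i)) = cis (\<Sum>i\<in>UNIV. - of_int (k $ i) * t $ i)"
      by (simp add: cis_conv_exp sum_negf)
    ultimately show ?thesis by (simp only: cis_sum[OF finite] prod.distrib)
  qed
  then have "fourier_coeff (\<lambda>t. exp (\<i> * complex_of_real (lam * coord_sum u t))) k =
      complex_of_real ((2*pi) powr (- real CARD('m))) * integral (cbox 0 (\<chi> i. 2*pi)) (\<lambda>t. \<Prod>i\<in>UNIV. ?h i (t $ i))"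
    by (simp only: fourier_coeff_def)
  also have "integral (cbox 0 (\<chi> i. 2*pi)) (\<lambda>t::real^'m. \<Prod>i\<in>UNIV. ?h i (t $ i)) = (\<Prod>i\<in>UNIV. integral {0..2*pi} (?h i))"
    by (subst integral_cbox_prod) (auto intro!: continuous_intros u)
  finally have "norm (fourier_coeff (\<lambda>t. exp (\<i> * complex_of_real (lam * coord_sum u t))) k) =
      (2*pi) powr (- real CARD('m)) * (\<Prod>i\<in>UNIV. norm (integral {0..2*pi} (?h i)))"
    by (simp add: norm_mult prod_norm)
  also have "\<dots> = (\<Prod>i\<in>UNIV. norm (integral {0..2*pi} (?h i)) / (2*pi))"
    by (simp add: prod_dividef powr_minus powr_realpow field_simps)
  finally show ?thesis .
qed

text \<open>A finite set of lattice points lies in the cube over the coordinate values that occur,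
  and over a cube the sum of products factors.\<close>

lemma sum_prod_le_power:
  fixes c :: "int \<Rightarrow> real" and F :: "(int^'m) set"
  assumes c: "\<And>z. 0 \<le> c z" and B: "\<And>T. finite T \<Longrightarrow> sum c T \<le> B" and F: "finite F"
  shows "(\<Sum>k\<in>F. \<Prod>i\<in>UNIV. c (k $ i)) \<le> B ^ CARD('m)"
proof -
  define T where "T = (\<Union>i\<in>UNIV. (\<lambda>k. k $ i) ` F)"
  have T: "finite T" using F by (simp add: T_def)
  have inj: "inj_on (\<lambda>k. ($) k) F" by (auto simp: inj_on_def vec_eq_iff)
  have "(\<Sum>k\<in>F. \<Prod>i\<in>UNIV. c (k $ i)) = (\<Sum>g\<in>(\<lambda>k. ($) k) ` F. \<Prod>i\<in>UNIV. c (g i))"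
    by (simp add: sum.reindex[OF inj])
  also have "\<dots> \<le> (\<Sum>g\<in>PiE (UNIV::'m set) (\<lambda>_. T). \<Prod>i\<in>UNIV. c (g i))"
  proof (rule sum_mono2)
    show "finite (PiE (UNIV::'m set) (\<lambda>_. T))" using T by (intro finite_PiE) auto
    show "($) ` F \<subseteq> PiE UNIV (\<lambda>_. T)" by (auto simp: T_def)
    show "0 \<le> (\<Prod>i\<in>(UNIV::'m set). c (g i))" for g by (intro prod_nonneg c)
  qed
  also have "\<dots> = (\<Prod>i\<in>(UNIV::'m set). \<Sum>z\<in>T. c z)"
    using T by (intro prod_sum_PiE[symmetric]) auto
  also have "\<dots> = (\<Sum>z\<in>T. c z) ^ CARD('m)" by simp
  also have "\<dots> \<le> B ^ CARD('m)" using T c by (intro power_mono B sum_nonneg) auto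
  finally show ?thesis .
qed

lemma Ap_norm_coord_sum:
  fixes u :: "real \<Rightarrow> real" and lam p B :: real
  defines "f \<equiv> \<lambda>t::real^'m. exp (\<i> * complex_of_real (lam * coord_sum u t))"
  assumes u: "continuous_on UNIV u" and p: "1 \<le> p"
    and B: "\<And>T. finite T \<Longrightarrow> (\<Sum>k\<in>T. norm (integral {0..2*pi} (\<lambda>t. cis (lam * u t) * cis (- of_int k * t))) powr p) \<le> B"
  shows "in_Ap p f" "Ap_norm p f \<le> (B powr (1/p)) ^ CARD('m)"
proof -
  define c where "c k = (norm (integral {0..2*pi} (\<lambda>t. cis (lam * u t) * cis (- of_int k * t))) / (2*pi)) powr p" for k :: int
  have cB: "sum c T \<le> B" if "finite T" for T
  proof -
    \<comment> \<open>Since \<open>2*pi \<ge> 1\<close>, the normalising factor only decreases the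
      terms.\<close>
    have "sum c T \<le> (\<Sum>k\<in>T. norm (integral {0..2*pi} (\<lambda>t. cis (lam * u t) * cis (- of_int k * t))) powr p)"
    proof (rule sum_mono)
      fix k
      let ?n = "norm (integral {0..2*pi} (\<lambda>t. cis (lam * u t) * cis (- of_int k * t)))"
      have "1 \<le> 2 * pi" using pi_gt3 by simp
      then have "?n * 1 \<le> ?n * (2*pi)" by (intro mult_left_mono) auto
      then have "?n / (2*pi) \<le> ?n" by (simp add: divide_le_eq)
      then show "c k \<le> ?n powr p" unfolding c_def using p by (intro powr_mono2) auto
    qed
    with B[OF that] show ?thesis by simp
  qed
  have B0: "0 \<le> B" using cB[of "{}"] by simp
  have eq: "norm (fourier_coeff f k) powr p = (\<Prod>i\<in>UNIV. c (k $ i))" for k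
    unfolding f_def norm_fourier_coeff_coord_sum[OF u] c_def by (rule prod_powr_distrib)
  have fin: "(\<Sum>k\<in>F. norm (fourier_coeff f k) powr p) \<le> B ^ CARD('m)" if "finite F" for F
    unfolding eq by (rule sum_prod_le_power[OF _ cB that]) (auto simp: c_def)
  then have s: "(\<lambda>k. norm (fourier_coeff f k) powr p) summable_on UNIV"
    by (intro nonneg_bdd_above_summable_on bdd_aboveI2[of _ _ "B ^ CARD('m)"]) auto
  then show "in_Ap p f" by (simp add: in_Ap_def)
  have "infsum (\<lambda>k. norm (fourier_coeff f k) powr p) UNIV \<le> B ^ CARD('m)"
    by (rule infsum_le_finite_sums[OF s fin])
  moreover have "0 \<le> infsum (\<lambda>k. norm (fourier_coeff f k) powr p) UNIV" by (rule infsum_nonneg) simp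
  ultimately have "Ap_norm p f \<le> (B ^ CARD('m)) powr (1/p)"
    unfolding Ap_norm_def using p by (intro powr_mono2) auto
  also have "\<dots> = (B powr (1/p)) ^ CARD('m)"
  proof -
    have "(B^n) powr (1/p) = (B powr (1/p))^n" for n by (induction n) (simp_all add: powr_mult)
    then show ?thesis .
  qed
  finally show "Ap_norm p f \<le> (B powr (1/p)) ^ CARD('m)" .
qed

lemma binary_magnitude:
  assumes "1 \<le> (y::real)" obtains m :: nat where "2^m \<le> y" "y \<le> 2^Suc m"
proof -
  define m where "m = nat \<lfloor>log 2 y\<rfloor>"
  have l: "0 \<le> log 2 y" using assms by simp
  have "real m \<le> log 2 y" "log 2 y < real m + 1" using l by (auto simp: m_def)
  then have "2 powr real m \<le> y" "y < 2 powr (real m + 1)"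
    using assms by (auto simp: le_log_iff log_less_iff)
  then show thesis using that[of m] by (simp add: powr_realpow powr_add mult.commute)
qed

lemma (in modulus) torus_phase_exists:
  "\<exists>\<phi> :: real^'m \<Rightarrow> real. C1_omega \<omega> \<phi> \<and> grad_nowhere_degenerate \<phi> \<and>
     (\<forall>p. 1 \<le> p \<and> p < 2 \<longrightarrow>
        (\<exists>C R. \<forall>lam::real. \<bar>lam\<bar> \<ge> R \<longrightarrow>
           in_Ap p (\<lambda>t. exp (\<i> * complex_of_real (lam * \<phi> t))) \<and>
           Ap_norm p (\<lambda>t. exp (\<i> * complex_of_real (lam * \<phi> t)))
             \<le> C * (Theta \<omega> p \<bar>lam\<bar>) ^ CARD('m)))"
proof -
  obtain \<Phi> G where \<Phi>: "\<And>t. (\<Phi> has_real_derivative G t) (at t)"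
    and out: "\<And>t. t \<le> 0 \<or> 2*pi \<le> t \<Longrightarrow> \<Phi> t = 0" "\<And>t. t \<le> 0 \<or> 2*pi \<le> t \<Longrightarrow> G t = 0"
    and G: "\<And>s t. \<bar>G t - G s\<bar> \<le> 32 * \<omega> \<bar>t - s\<bar>"
    and nc: "\<And>\<alpha> \<beta>. 0 \<le> \<alpha> \<Longrightarrow> \<alpha> < \<beta> \<Longrightarrow> \<beta> \<le> 2*pi \<Longrightarrow> \<exists>s\<in>{\<alpha><..<\<beta>}. \<exists>t\<in>{\<alpha><..<\<beta>}. G s \<noteq> G t"
    and sums: "\<And>p. 1 \<le> p \<Longrightarrow> p \<le> 2 \<Longrightarrow> \<exists>C. \<forall>lam m T. \<bar>lam\<bar> \<le> 2^Suc m \<longrightarrow> finite T \<longrightarrow>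
      (\<Sum>k\<in>T. norm (integral {0..2*pi} (\<lambda>t. cis (lam * \<Phi> t) * cis (- of_int k * t))) powr p) \<le> C * S p m"
    by (rule phase_exists, rule that)
  define u where "u = periodize \<Phi>"
  define v where "v = periodize G"
  have u: "(u has_real_derivative v t) (at t)" for t
    unfolding u_def v_def by (rule periodize_deriv[OF \<Phi> out])
  have uc: "continuous_on X u" for X
    by (rule DERIV_continuous_on) (rule has_field_derivative_at_within[OF u])
  have v_mod: "\<bar>v t - v s\<bar> \<le> 64 * \<omega> \<bar>t - s\<bar>" if "\<bar>t - s\<bar> < 1" for s t
    using periodize_modulus[of G 32 \<omega>, OF G out(2) that] by (simp add: v_def)
  have vc: "continuous_on UNIV v"
    unfolding continuous_on_iff
  proof (intro ballI allI impI)
    fix x e :: real assume "0 < e"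
    then obtain d where d: "d > 0" "\<And>x. 0 \<le> x \<Longrightarrow> x < d \<Longrightarrow> \<omega> x < e / 64" using small[of "e/64"] by auto
    have "dist (v y) (v x) < e" if "dist y x < min d 1" for y
      using v_mod[of y x] d(2)[of "\<bar>y - x\<bar>"] that by (simp add: dist_real_def)
    with d(1) show "\<exists>d>0. \<forall>y\<in>UNIV. dist y x < d \<longrightarrow> dist (v y) (v x) < e"
      by (intro exI[of _ "min d 1"]) auto
  qed
  have v_nc: "\<exists>s\<in>{a<..<b}. \<exists>t\<in>{a<..<b}. v s < v t" if "a < b" for a b
    unfolding v_def by (rule periodize_not_constant[OF nc that])
  have C1: "C1_omega \<omega> (coord_sum u :: real^'m \<Rightarrow> real)"
    unfolding C1_omega_def
  proof (intro conjI exI allI impI)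
    show "torus_periodic (coord_sum u :: real^'m \<Rightarrow> real)" unfolding u_def by (rule torus_periodic_coord_sum)
    show "partials (coord_sum u :: real^'m \<Rightarrow> real) (\<lambda>i x. v (x $ i))" by (rule partials_coord_sum[OF u])
    \<comment> \<open>Distances up to 1/2 stay inside the range below 1 in which
      \<open>v_mod\<close> holds.\<close>
    show "(0::real) < 1/2" by simp
    fix i \<delta> and t1 t2 :: "real^'m" assume \<delta>: "0 < \<delta> \<and> \<delta> \<le> 1/2 \<and> dist t1 t2 \<le> \<delta>"
    have "\<bar>t1 $ i - t2 $ i\<bar> \<le> dist t1 t2" using component_le_norm_cart[of "t1 - t2" i] by (simp add: dist_norm)
    with \<delta> have d: "\<bar>t1 $ i - t2 $ i\<bar> \<le> \<delta>" by simp
    then have "\<bar>v (t1 $ i) - v (t2 $ i)\<bar> \<le> 64 * \<omega> \<bar>t1 $ i - t2 $ i\<bar>" using \<delta> by (intro v_mod) simp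
    also have "\<dots> \<le> 64 * \<omega> \<delta>" using d by (intro mult_left_mono le) auto
    finally show "\<bar>v (t1 $ i) - v (t2 $ i)\<bar> \<le> 64 * \<omega> \<delta>" .
  qed
  have est: "\<exists>C R. \<forall>lam::real. \<bar>lam\<bar> \<ge> R \<longrightarrow>
      in_Ap p (\<lambda>t::real^'m. exp (\<i> * complex_of_real (lam * coord_sum u t))) \<and>
      Ap_norm p (\<lambda>t::real^'m. exp (\<i> * complex_of_real (lam * coord_sum u t))) \<le> C * (Theta \<omega> p \<bar>lam\<bar>) ^ CARD('m)"
    if p: "1 \<le> p" "p < 2" for p
  proof -
    obtain C1 where C1: "\<And>lam m T. \<bar>lam\<bar> \<le> 2^Suc m \<Longrightarrow> finite T \<Longrightarrow>
      (\<Sum>k\<in>T. norm (integral {0..2*pi} (\<lambda>t. cis (lam * \<Phi> t) * cis (- of_int k * t))) powr p) \<le> C1 * S p m"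
      using sums[of p] p by auto
    obtain C2 R where C2: "\<And>y n. y \<ge> R \<Longrightarrow> 2^n \<le> y \<Longrightarrow> S p n \<le> C2 * Theta \<omega> p y powr p"
      using S_Theta[OF p(1)] by blast
    define K where "K = max 0 C1 * max 0 C2"
    have K0: "0 \<le> K" by (simp add: K_def)
    have "in_Ap p (\<lambda>t::real^'m. exp (\<i> * complex_of_real (lam * coord_sum u t))) \<and>
      Ap_norm p (\<lambda>t::real^'m. exp (\<i> * complex_of_real (lam * coord_sum u t))) \<le> (K powr (1/p)) ^ CARD('m) * (Theta \<omega> p \<bar>lam\<bar>) ^ CARD('m)"
      if lam: "\<bar>lam\<bar> \<ge> max R 1" for lam
    proof -
      define \<theta> where "\<theta> = Theta \<omega> p \<bar>lam\<bar>"
      have \<theta>0: "0 \<le> \<theta>" using lam by (simp add: \<theta>_def Theta_def)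
      \<comment> \<open>The upper bound on \<open>\<bar>lam\<bar>\<close> admits the coefficient
        estimate by \<open>S p m\<close>; the lower bound lets \<open>S p m\<close> be compared with
        \<open>Theta\<close> at \<open>\<bar>lam\<bar>\<close> itself.\<close>
      obtain m :: nat where m: "2^m \<le> \<bar>lam\<bar>" "\<bar>lam\<bar> \<le> 2^Suc m" using binary_magnitude[of "\<bar>lam\<bar>"] lam by auto
      have "S p m \<le> C2 * \<theta> powr p" unfolding \<theta>_def using lam m by (intro C2) auto
      also have "\<dots> \<le> max 0 C2 * \<theta> powr p" by (intro mult_right_mono) auto
      finally have S: "S p m \<le> max 0 C2 * \<theta> powr p" .
      have B: "(\<Sum>k\<in>T. norm (integral {0..2*pi} (\<lambda>t. cis (lam * u t) * cis (- of_int k * t))) powr p) \<le> K * \<theta> powr p"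
        if T: "finite T" for T
      proof -
        have "integral {0..2*pi} (\<lambda>t. cis (lam * u t) * cis (- of_int k * t)) =
            integral {0..2*pi} (\<lambda>t. cis (lam * \<Phi> t) * cis (- of_int k * t))" for k :: int
          unfolding u_def by (intro integral_cong) (simp add: periodize_base[OF out(1)])
        then have "(\<Sum>k\<in>T. norm (integral {0..2*pi} (\<lambda>t. cis (lam * u t) * cis (- of_int k * t))) powr p) \<le> C1 * S p m"
          using C1[OF m(2) T] by simp
        also have "\<dots> \<le> max 0 C1 * S p m" using S_nonneg by (intro mult_right_mono) auto
        also have "\<dots> \<le> max 0 C1 * (max 0 C2 * \<theta> powr p)" using S by (intro mult_left_mono) auto
        finally show ?thesis by (simp add: K_def mult.assoc)
      qed
      note Ap = Ap_norm_coord_sum[OF uc p(1) B, where 'm='m]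
      have "((K * \<theta> powr p) powr (1/p)) ^ CARD('m) = (K powr (1/p)) ^ CARD('m) * \<theta> ^ CARD('m)"
        using K0 \<theta>0 p by (simp add: powr_mult powr_powr power_mult_distrib)
      with Ap show ?thesis unfolding \<theta>_def by simp
    qed
    then show ?thesis by blast
  qed
  show ?thesis
  proof (intro exI[of _ "coord_sum u"] conjI allI impI)
    show "C1_omega \<omega> (coord_sum u :: real^'m \<Rightarrow> real)" by (rule C1)
    show "grad_nowhere_degenerate (coord_sum u :: real^'m \<Rightarrow> real)"
      by (rule grad_nowhere_degenerate_coord_sum[OF u vc v_nc])
  qed (use est in blast)
qed

theorem theorem2:
  fixes \<omega> :: "real \<Rightarrow> real"
  assumes "continuous_on {0..} \<omega>"
    and "mono_on {0..} \<omega>"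
    and "\<omega> 0 = 0"
    and "\<exists>\<delta>0>0. \<forall>\<delta>. 0 < \<delta> \<and> \<delta> < \<delta>0 \<longrightarrow> \<omega> (2*\<delta>) < 2 * \<omega> \<delta>"
  shows "\<exists>\<phi> :: real^'m \<Rightarrow> real. C1_omega \<omega> \<phi> \<and> grad_nowhere_degenerate \<phi> \<and>
     (\<forall>p. 1 \<le> p \<and> p < 2 \<longrightarrow>
        (\<exists>C R. \<forall>lam::real. \<bar>lam\<bar> \<ge> R \<longrightarrow>
           in_Ap p (\<lambda>t. exp (\<i> * complex_of_real (lam * \<phi> t))) \<and>
           Ap_norm p (\<lambda>t. exp (\<i> * complex_of_real (lam * \<phi> t)))
             \<le> C * (Theta \<omega> p \<bar>lam\<bar>) ^ CARD('m)))"
proof -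
  obtain \<delta>0 where "\<delta>0 > 0" "\<forall>\<delta>. 0 < \<delta> \<and> \<delta> < \<delta>0 \<longrightarrow> \<omega> (2*\<delta>) < 2 * \<omega> \<delta>"
    using assms(4) by blast
  then interpret modulus \<omega> \<delta>0
    using assms by unfold_locales auto
  show ?thesis by (rule torus_phase_exists)
qed

end
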